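(* Let $\mathbb{K}$ be a field, $r>1$ an integer, and let $H=(V,E)$ be an $r$-uniform good forest on $V=[n]$. Then, for integers $d\ge 1$: (1) $L_H^{\mathbb{K}}(d)$ is radical for all $d$. (2) $L_H^{\mathbb{K}}(d)$ is a complete intersection if and only if $d\geq\Delta(H)$. (3) $L_H^{\mathbb{K}}(d)$ is prime if $d\geq\Delta(H)+1$.
   Context: $[n]=\{1,\dots,n\}$. A hypergraph is $r$-uniform if every edge has exactly $r$ vertices. An $r$-uniform hypergraph $H=(V,E)$ with $m=|E|$ is a good forest if its edges can be ordered $e_1,\dots,e_m$ so that $|(e_1\cup\dots\cup e_i)\cap e_{i+1}|\le 1$ for all $1\le i\le m-1$. $\Delta(H)$ is the maximal degree of a vertex of $H$, where the degree of a vertex is the number of edges containing it. For $e\subset[n]$ put $f_e^{(d)}=\sum_{j=1}^{d}\prod_{i\in e}x_{ij}$ in $S=\mathbb{K}[x_{ij}\mid i\in[n],\,j\in[d]]$; the Lovász–Saks–Schrijver (LSS) ideal is $L_H^{\mathbb{K}}(d)=(f_e^{(d)}\mid e\in E)\subset S$. A homogeneous ideal $I\subset S$ is a complete intersection if $\mu(I)=\mathrm{ht}(I)$, where $\mu(I)$ is the cardinality of a minimal homogeneous generating set of $I$. *)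

theory Defs
  imports "HOL-Algebra.Ideal" "HOL-Library.Poly_Mapping" "HOL-Library.Extended_Nat"
begin

section \<open>Hypergraphs\<close>

definition uniform_hypergraph :: "nat \<Rightarrow> 'v set \<Rightarrow> 'v set set \<Rightarrow> bool" where
  "uniform_hypergraph r V E \<longleftrightarrow> finite V \<and> (\<forall>e\<in>E. e \<subseteq> V \<and> card e = r)"

text \<open>Lists are indexed from \<open>0\<close>, so \<open>set (take i es)\<close> is $\{e_1,\dots,e_i\}$ and \<open>es ! i\<close>
  is $e_{i+1}$.\<close>

definition good_forest :: "'v set set \<Rightarrow> bool" where
  "good_forest E \<longleftrightarrow>
     (\<exists>es. distinct es \<and> set es = E \<and>
        (\<forall>i. 1 \<le> i \<and> i < length es \<longrightarrow> card (\<Union>(set (take i es)) \<inter> es ! i) \<le> 1))"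

definition vertex_degree :: "'v set set \<Rightarrow> 'v \<Rightarrow> nat" where
  "vertex_degree E v = card {e \<in> E. v \<in> e}"

text \<open>On natural numbers \<open>Sup {} = 0\<close>, so the maximal degree of a hypergraph without vertices
  is \<open>0\<close>.\<close>

definition max_degree :: "'v set \<Rightarrow> 'v set set \<Rightarrow> nat" where
  "max_degree V E = (SUP v\<in>V. vertex_degree E v)"


section \<open>Ideals in a commutative ring\<close>

definition radical_ideal :: "('a, 'b) ring_scheme \<Rightarrow> 'a set \<Rightarrow> bool" where
  "radical_ideal R I \<longleftrightarrow>
     ideal I R \<and> I = {a \<in> carrier R. \<exists>k::nat. a [^]\<^bsub>R\<^esub> k \<in> I}"

definition prime_height :: "('a, 'b) ring_scheme \<Rightarrow> 'a set \<Rightarrow> enat" where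
  "prime_height R P =
     Sup {enat k | k. \<exists>C :: nat \<Rightarrow> 'a set.
            (\<forall>i\<le>k. primeideal (C i) R) \<and> (\<forall>i<k. C i \<subset> C (Suc i)) \<and> C k = P}"

definition ideal_height :: "('a, 'b) ring_scheme \<Rightarrow> 'a set \<Rightarrow> enat" where
  "ideal_height R I = Inf {prime_height R P | P. primeideal P R \<and> I \<subseteq> P}"


section \<open>The polynomial ring $\mathbb{K}[x_{ij} \mid i\in[n],\, j\in[d]]$\<close>

text \<open>The ambient type is $\mathbb{K}[x_{ij} \mid i,j\in\mathbb{N}]$: a monomial maps the index pair
  \<open>(i, j)\<close> to the exponent of $x_{ij}$, and a polynomial maps monomials to coefficients.
  The ring \<open>lss_ring n d\<close> is the subring in which only the variables with \<open>i \<in> {1..n}\<close> and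
  \<open>j \<in> {1..d}\<close> occur.\<close>

type_synonym monomial = "(nat \<times> nat) \<Rightarrow>\<^sub>0 nat"
type_synonym 'k xpoly = "monomial \<Rightarrow>\<^sub>0 'k"

definition xvar :: "nat \<Rightarrow> nat \<Rightarrow> 'k::field xpoly" where
  "xvar i j = Poly_Mapping.single (Poly_Mapping.single (i, j) 1) 1"

definition lss_ring :: "nat \<Rightarrow> nat \<Rightarrow> ('k::field xpoly) ring" where
  "lss_ring n d =
     \<lparr>carrier = {p. \<forall>m\<in>Poly_Mapping.keys p. Poly_Mapping.keys m \<subseteq> {1..n} \<times> {1..d}},
      monoid.mult = (*), one = 1, ring.zero = 0, add = (+)\<rparr>"

definition monomial_degree :: "monomial \<Rightarrow> nat" where
  "monomial_degree m = (\<Sum>x\<in>Poly_Mapping.keys m. Poly_Mapping.lookup m x)"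

definition homogeneous :: "'k::field xpoly \<Rightarrow> bool" where
  "homogeneous p \<longleftrightarrow> (\<exists>k. \<forall>m\<in>Poly_Mapping.keys p. monomial_degree m = k)"


section \<open>Complete intersections\<close>

text \<open>In the following definitions the ring \<open>R\<close> is meant to be some \<open>lss_ring n d\<close>.\<close>

definition homogeneous_ideal :: "('k::field xpoly) ring \<Rightarrow> 'k xpoly set \<Rightarrow> bool" where
  "homogeneous_ideal R I \<longleftrightarrow>
     (\<exists>G \<subseteq> carrier R. (\<forall>g\<in>G. homogeneous g) \<and> I = Idl\<^bsub>R\<^esub> G)"

definition minimal_homogeneous_generators ::
    "('k::field xpoly) ring \<Rightarrow> 'k xpoly set \<Rightarrow> 'k xpoly set \<Rightarrow> bool" where
  "minimal_homogeneous_generators R I G \<longleftrightarrow>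
     G \<subseteq> carrier R \<and> finite G \<and> (\<forall>g\<in>G. homogeneous g) \<and> I = Idl\<^bsub>R\<^esub> G \<and>
     (\<forall>G'. G' \<subset> G \<longrightarrow> Idl\<^bsub>R\<^esub> G' \<noteq> I)"

text \<open>By the graded Nakayama lemma all minimal homogeneous generating sets of a homogeneous ideal
  have the same cardinality, so the description below is a proper one.\<close>

definition num_generators :: "('k::field xpoly) ring \<Rightarrow> 'k xpoly set \<Rightarrow> nat" where
  "num_generators R I = (THE k. \<exists>G. minimal_homogeneous_generators R I G \<and> card G = k)"

definition complete_intersection :: "('k::field xpoly) ring \<Rightarrow> 'k xpoly set \<Rightarrow> bool" where
  "complete_intersection R I \<longleftrightarrow>
     homogeneous_ideal R I \<and> enat (num_generators R I) = ideal_height R I"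


section \<open>Lovasz-Saks-Schrijver ideals\<close>

definition lss_poly :: "nat \<Rightarrow> nat set \<Rightarrow> 'k::field xpoly" where
  "lss_poly d e = (\<Sum>j\<in>{1..d}. \<Prod>i\<in>e. xvar i j)"

definition lss_ideal :: "nat \<Rightarrow> nat set set \<Rightarrow> nat \<Rightarrow> 'k::field xpoly set" where
  "lss_ideal n E d = Idl\<^bsub>lss_ring n d\<^esub> (lss_poly d ` E)"


section \<open>Basic facts\<close>

lemma cring_lss_ring: "cring (lss_ring n d)"
proof -
  have add: "p + q \<in> carrier (lss_ring n d)"
    if "p \<in> carrier (lss_ring n d)" "q \<in> carrier (lss_ring n d)" for p q :: "'a xpoly"
    using that keys_add[of p q] by (fastforce simp: lss_ring_def)
  have mult: "p * q \<in> carrier (lss_ring n d)"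
    if "p \<in> carrier (lss_ring n d)" "q \<in> carrier (lss_ring n d)" for p q :: "'a xpoly"
  proof -
    have "Poly_Mapping.keys m \<subseteq> {1..n} \<times> {1..d}" if m: "m \<in> Poly_Mapping.keys (p * q)" for m
    proof -
      obtain a b where "m = a + b" "a \<in> Poly_Mapping.keys p" "b \<in> Poly_Mapping.keys q"
        using m keys_mult[of p q] by blast
      with keys_add[of a b] \<open>p \<in> _\<close> \<open>q \<in> _\<close> show ?thesis
        by (auto simp: lss_ring_def)
    qed
    then show ?thesis by (simp add: lss_ring_def)
  qed
  have neg: "- p \<in> carrier (lss_ring n d)"
    if "p \<in> carrier (lss_ring n d)" for p :: "'a xpoly"
    using that by (simp add: lss_ring_def)
  have ops: "x \<oplus>\<^bsub>lss_ring n d\<^esub> y = x + y" "x \<otimes>\<^bsub>lss_ring n d\<^esub> y = x * y"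
    "\<zero>\<^bsub>lss_ring n d\<^esub> = 0" "\<one>\<^bsub>lss_ring n d\<^esub> = 1" for x y :: "'a xpoly"
    by (simp_all add: lss_ring_def)
  have zero_one: "0 \<in> carrier (lss_ring n d :: 'a xpoly ring)"
    "1 \<in> carrier (lss_ring n d :: 'a xpoly ring)"
    by (simp_all add: lss_ring_def)
  show ?thesis
  proof (rule cringI)
    show "abelian_group (lss_ring n d :: 'a xpoly ring)"
    proof (rule abelian_groupI)
      show "\<exists>y\<in>carrier (lss_ring n d). y \<oplus>\<^bsub>lss_ring n d\<^esub> x = \<zero>\<^bsub>lss_ring n d\<^esub>"
        if "x \<in> carrier (lss_ring n d)" for x :: "'a xpoly"
        using neg[OF that] by (intro bexI[of _ "- x"]) (simp_all add: ops)
    qed (simp_all add: ops add zero_one ac_simps)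
    show "Group.comm_monoid (lss_ring n d :: 'a xpoly ring)"
      by (rule comm_monoidI) (simp_all add: ops mult zero_one ac_simps)
  qed (simp_all add: ops algebra_simps)
qed

lemma lss_poly_in_carrier:
  assumes "e \<subseteq> {1..n}"
  shows "lss_poly d e \<in> carrier (lss_ring n d)"
proof -
  interpret cring "lss_ring n d :: 'a xpoly ring" by (rule cring_lss_ring)
  have prod: "(\<Prod>i\<in>e. xvar i j) \<in> carrier (lss_ring n d :: 'a xpoly ring)" if "j \<in> {1..d}" for j
    using finite_subset[OF assms finite_atLeastAtMost] assms
  proof (induction e rule: finite_induct)
    case empty
    then show ?case using one_closed by (simp add: lss_ring_def)
  next
    case (insert i F)
    have "xvar i j \<in> carrier (lss_ring n d :: 'a xpoly ring)"
      using insert.prems that by (auto simp: xvar_def lss_ring_def)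
    from m_closed[OF this insert.IH] insert show ?case by (simp add: lss_ring_def)
  qed
  have "(\<Sum>j\<in>J. \<Prod>i\<in>e. xvar i j) \<in> carrier (lss_ring n d :: 'a xpoly ring)"
    if "finite J" "J \<subseteq> {1..d}" for J
    using that
  proof (induction J rule: finite_induct)
    case empty
    then show ?case using zero_closed by (simp add: lss_ring_def)
  next
    case (insert j F)
    with a_closed[OF prod[of j] insert.IH] show ?case by (simp add: lss_ring_def)
  qed
  then show ?thesis unfolding lss_poly_def by simp
qed

end

theory Submission
  imports Defs "HOL-Computational_Algebra.Polynomial_Factorial" "HOL-Library.Product_Lexorder"
begin

text \<open>
  Every edge of a forest meets the union of the earlier edges in at most one vertex \<open>v\<close>.

  \<^bold>\<open>Radicality.\<close> More generally, over an infinite field, any family of multilinear polynomials, one for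
  each edge of a forest, generates a radical ideal; this class is closed under substituting linear forms.
  If the last generator \<open>F\<close> is linear in two variables \<open>y1\<close>, \<open>y2\<close> of a vertex not used before, then
  \<open>y2 := c y1\<close> leads to a radical ideal for each scalar \<open>c\<close> by induction. So a homogeneous nilpotent is
  a multiple of \<open>y2 - c y1\<close>, and for a suitable \<open>c\<close> the cofactor is again nilpotent, of smaller degree.
  If only one such variable is left, \<open>F\<close> is a product, and the factors are treated separately.
  A finite field \<open>K\<close> is first enlarged to \<open>K(t)\<close>.

  \<^bold>\<open>Regularity.\<close> The edges of a forest of maximal degree at most \<open>d\<close> have a proper colouring \<open>col\<close> with
  \<open>d\<close> colours. Each generator is linear in the variable \<open>(u, col e)\<close> of a new vertex \<open>u\<close>, with a
  leading coefficient that is a product of variables whose colour is unused at their vertex among the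
  earlier edges; such variables are regular modulo the earlier generators. Hence the generators form a
  regular sequence, and with a spare colour the ideal is prime.

  \<^bold>\<open>Height.\<close> A regular sequence gives a chain of primes below each prime containing the ideal.
  Conversely, a prime that meets a polynomial ring in all but \<open>h\<close> of the variables trivially has height at
  most \<open>h\<close>. If the maximal degree exceeds \<open>d\<close>, killing the \<open>d\<close> variables of a vertex with more
  than \<open>d\<close> edges produces a prime of height less than the number of edges.
\<close>

text \<open>Two obstacles shape the radicality proof. Once the new vertices of the last edge are
  used up, its generator is a linear form at the vertex shared with earlier edges. Dividing by it
  substitutes a linear form into the earlier generators; they lose the shape of
  \<open>lss_poly\<close>, but stay multilinear. Secondly, each scalar c has its own cofactor. All
  cofactors lie in one finite-dimensional space, and a linear relation among more of them than its
  dimension singles out a good c; hence the need for many scalars. The way back from K(t) to K uses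
  that K is a direct summand of K(t) as a vector space. Upper bounds for heights rest on counting
  alone: each link of a chain of primes multiplies the number of linearly independent polynomials,
  while a box of monomials with exponents at most D in N variables has room for only (D + 1)^N.
  Generated ideals are formed in the ring with variables for all pairs of natural numbers, and then
  intersected with the ring in the variables of the grid. Setting all other variables to 0 shows
  that this intersection is the ideal generated in the smaller ring.\<close>

definition ring_morph :: "('a::comm_ring_1 \<Rightarrow> 'b::comm_ring_1) \<Rightarrow> bool" where
  "ring_morph f \<longleftrightarrow> f 1 = 1 \<and> (\<forall>a b. f (a + b) = f a + f b) \<and> (\<forall>a b. f (a * b) = f a * f b)"

lemma
  assumes "ring_morph f"
  shows ring_morph_one: "f 1 = 1"
    and ring_morph_add: "f (a + b) = f a + f b"
    and ring_morph_mult: "f (a * b) = f a * f b"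
  using assms by (auto simp: ring_morph_def)

lemma ring_morph_zero: "ring_morph f \<Longrightarrow> f 0 = 0"
  using ring_morph_add[of f 0 0] by simp

lemma ring_morph_uminus: "ring_morph f \<Longrightarrow> f (- a) = - f a"
  using ring_morph_add[of f "- a" a] by (simp add: ring_morph_zero eq_neg_iff_add_eq_0)

lemma ring_morph_diff: "ring_morph f \<Longrightarrow> f (a - b) = f a - f b"
  using ring_morph_add[of f a "- b"] by (simp add: ring_morph_uminus)

lemma ring_morph_power: "ring_morph f \<Longrightarrow> f (a ^ n) = f a ^ n"
  by (induction n) (simp_all add: ring_morph_one ring_morph_mult)

lemma ring_morph_sum: "ring_morph f \<Longrightarrow> f (\<Sum>i\<in>I. g i) = (\<Sum>i\<in>I. f (g i))"
  by (induction I rule: infinite_finite_induct) (simp_all add: ring_morph_zero ring_morph_add)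

lemma ring_morph_prod: "ring_morph f \<Longrightarrow> f (\<Prod>i\<in>I. g i) = (\<Prod>i\<in>I. f (g i))"
  by (induction I rule: infinite_finite_induct) (simp_all add: ring_morph_one ring_morph_mult)

lemmas ring_morph_simps = ring_morph_zero ring_morph_one ring_morph_add ring_morph_mult
  ring_morph_uminus ring_morph_diff ring_morph_power ring_morph_sum ring_morph_prod

lemma ring_morph_comp: "ring_morph f \<Longrightarrow> ring_morph g \<Longrightarrow> ring_morph (\<lambda>x. f (g x))"
  by (simp add: ring_morph_def)

section \<open>Ideals\<close>

text \<open>A commutative ring is a module over itself, and its submodules are its ideals; so
  \<open>span\<close> with its induction rules serves for generated ideals.\<close>

global_interpretation ideal_gen: module "(*) :: 'a::comm_ring_1 \<Rightarrow> 'a \<Rightarrow> 'a"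
  defines ideal_of = ideal_gen.span and is_ideal = ideal_gen.subspace
  by unfold_locales (auto simp: algebra_simps)

text \<open>Oriented against associativity of multiplication, this simplification rule would loop.\<close>
declare ideal_gen.scale_scale [simp del]

lemma ideal_of_mult_right: "p \<in> ideal_of G \<Longrightarrow> p * a \<in> ideal_of G"
  using ideal_gen.span_scale[of p G a] by (simp add: mult.commute)

lemma ideal_of_insert_iff: "p \<in> ideal_of (insert f G) \<longleftrightarrow> (\<exists>q. p - q * f \<in> ideal_of G)"
  by (rule ideal_gen.span_breakdown_eq)

lemma ring_morph_ideal_of:
  assumes "ring_morph f" "p \<in> ideal_of G" "\<And>g. g \<in> G \<Longrightarrow> f g \<in> ideal_of H"
  shows "f p \<in> ideal_of H"
  using assms(2)
proof (induction rule: ideal_gen.span_induct_alt)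
  case base
  then show ?case using ideal_gen.span_zero by (simp add: ring_morph_zero[OF assms(1)])
next
  case (step c x y)
  then show ?case
    by (auto simp: ring_morph_simps[OF assms(1)] intro!: ideal_gen.span_add ideal_gen.span_scale assms(3))
qed

text \<open>The exponent \<open>N\<close> may be 0, which matters only if \<open>1 \<in> I\<close>;
  an ideal then contains everything.\<close>

definition radical_set :: "'a::comm_ring_1 set \<Rightarrow> bool" where
  "radical_set I \<longleftrightarrow> (\<forall>p N. p ^ N \<in> I \<longrightarrow> p \<in> I)"

definition rad :: "'a::comm_ring_1 set \<Rightarrow> 'a set" where
  "rad I = {p. \<exists>N. p ^ N \<in> I}"

lemma radD: "radical_set I \<Longrightarrow> p ^ N \<in> I \<Longrightarrow> p \<in> I"
  by (auto simp: radical_set_def)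

text \<open>In each term of the binomial expansion either the exponent of \<open>a\<close> is at
  least \<open>N\<close> or that of \<open>b\<close> is at least \<open>M\<close>.\<close>

lemma power_add_in_ideal:
  fixes a b :: "'a::comm_ring_1"
  assumes I: "is_ideal I" and a: "a ^ N \<in> I" and b: "b ^ M \<in> I"
  shows "(a + b) ^ (N + M) \<in> I"
proof -
  have "of_nat ((N + M) choose k) * a ^ k * b ^ (N + M - k) \<in> I" for k
  proof (cases "k \<ge> N")
    case True
    then have *: "a ^ k = a ^ (k - N) * a ^ N" by (simp flip: power_add)
    show ?thesis
      using ideal_gen.subspace_scale[OF I a, of "of_nat ((N + M) choose k) * b ^ (N + M - k) * a ^ (k - N)"]
      by (subst *) (simp add: mult_ac)
  next
    case False
    then have *: "b ^ (N + M - k) = b ^ (N - k) * b ^ M" by (simp flip: power_add)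
    show ?thesis
      using ideal_gen.subspace_scale[OF I b, of "of_nat ((N + M) choose k) * a ^ k * b ^ (N - k)"]
      by (subst *) (simp add: mult_ac)
  qed
  then show ?thesis
    unfolding binomial_ring by (intro ideal_gen.subspace_sum[OF I]) auto
qed

lemma is_ideal_rad:
  fixes I :: "'a::comm_ring_1 set"
  assumes "is_ideal I"
  shows "is_ideal (rad I)"
proof (rule ideal_gen.subspaceI)
  show "0 \<in> rad I"
    using ideal_gen.subspace_0[OF assms] by (auto simp: rad_def intro!: exI[of _ 1])
  show "x + y \<in> rad I" if xy: "x \<in> rad I" "y \<in> rad I" for x y
  proof -
    obtain N M where "x ^ N \<in> I" "y ^ M \<in> I" using xy by (auto simp: rad_def)
    from power_add_in_ideal[OF assms this] show ?thesis unfolding rad_def by blast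
  qed
  show "c * x \<in> rad I" if x: "x \<in> rad I" for c x
  proof -
    obtain N where "x ^ N \<in> I" using x by (auto simp: rad_def)
    from ideal_gen.subspace_scale[OF assms this, of "c ^ N"] have "(c * x) ^ N \<in> I"
      by (simp add: power_mult_distrib)
    then show ?thesis unfolding rad_def by blast
  qed
qed

lemma rad_ideal_of: "is_ideal (rad (ideal_of G))"
  by (intro is_ideal_rad ideal_gen.subspace_span)

lemma subset_rad: "I \<subseteq> rad I"
  by (auto simp: rad_def intro!: exI[of _ 1])

lemma power_in_rad:
  assumes "p ^ N \<in> rad I"
  shows "p \<in> rad I"
proof -
  obtain M where "(p ^ N) ^ M \<in> I" using assms by (auto simp: rad_def)
  then have "p ^ (N * M) \<in> I" by (simp add: power_mult)
  then show ?thesis unfolding rad_def by blast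
qed

section \<open>Polynomials\<close>

definition con :: "'k \<Rightarrow> 'k::field xpoly" where
  "con c = Poly_Mapping.single 0 c"

definition var :: "nat \<times> nat \<Rightarrow> 'k::field xpoly" where
  "var x = Poly_Mapping.single (Poly_Mapping.single x 1) 1"

lemma con_1 [simp]: "con 1 = 1" and con_0 [simp]: "con 0 = 0"
  and con_add: "con (a + b) = con a + con b" and con_mult: "con (a * b) = con a * con b"
  by (simp_all add: con_def single_add mult_single)

definition vars_in :: "(nat \<times> nat) set \<Rightarrow> 'k::field xpoly set" where
  "vars_in X = {p. \<forall>m\<in>Poly_Mapping.keys p. Poly_Mapping.keys m \<subseteq> X}"

lemma poly_mapping_additive_induct [case_names zero single add]:
  fixes p :: "'a \<Rightarrow>\<^sub>0 'b::comm_monoid_add"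
  assumes "P 0" "\<And>m c. m \<in> Poly_Mapping.keys p \<Longrightarrow> P (Poly_Mapping.single m c)"
    "\<And>p q. P p \<Longrightarrow> P q \<Longrightarrow> P (p + q)"
  shows "P p"
proof -
  have p: "p = (\<Sum>m\<in>Poly_Mapping.keys p. Poly_Mapping.single m (Poly_Mapping.lookup p m))"
    by (rule poly_mapping_eqI)
       (auto simp: lookup_sum lookup_single when_def in_keys_iff sum.delta)
  have "P (\<Sum>m\<in>M. Poly_Mapping.single m (Poly_Mapping.lookup p m))"
    if "M \<subseteq> Poly_Mapping.keys p" for M
    using finite_subset[OF that finite_keys] that
    by (induction M rule: finite_induct) (auto intro: assms)
  from this[OF order_refl] p show ?thesis by simp
qed

lemma single_eq_monomial:
  "Poly_Mapping.single m c = con c * (\<Prod>x\<in>Poly_Mapping.keys m. var x ^ Poly_Mapping.lookup m x)"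
proof -
  have pw: "var x ^ k = Poly_Mapping.single (Poly_Mapping.single x k) (1::'a)" for x k
    by (induction k) (simp_all add: var_def mult_single flip: single_add)
  have "(\<Prod>x\<in>X. var x ^ Poly_Mapping.lookup m x) = Poly_Mapping.single (\<Sum>x\<in>X. Poly_Mapping.single x (Poly_Mapping.lookup m x)) (1::'a)"
    if "finite X" for X
    using that by (induction X rule: finite_induct) (simp_all add: pw mult_single)
  moreover have "(\<Sum>x\<in>Poly_Mapping.keys m. Poly_Mapping.single x (Poly_Mapping.lookup m x)) = m"
    by (rule poly_mapping_eqI)
       (auto simp: lookup_sum lookup_single when_def in_keys_iff sum.delta)
  ultimately show ?thesis by (simp add: con_def mult_single)
qed

lemma xpoly_induct [consumes 1, case_names con var add mult]:
  fixes p :: "'k::field xpoly"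
  assumes "p \<in> vars_in X" "\<And>c. P (con c)" "\<And>x. x \<in> X \<Longrightarrow> P (var x)"
    "\<And>p q. P p \<Longrightarrow> P q \<Longrightarrow> P (p + q)" "\<And>p q. P p \<Longrightarrow> P q \<Longrightarrow> P (p * q)"
  shows "P p"
proof (induction rule: poly_mapping_additive_induct)
  case zero
  show ?case using assms(2)[of 0] by simp
next
  case (single m c)
  have sub: "Poly_Mapping.keys m \<subseteq> X" using single assms(1) by (auto simp: vars_in_def)
  have pw: "P (var x ^ k)" if "x \<in> X" for x k
    using assms(2)[of 1] by (induction k) (auto intro: assms(3,5) that)
  have "P (\<Prod>x\<in>Y. var x ^ Poly_Mapping.lookup m x)" if "Y \<subseteq> X" "finite Y" for Y
    using that(2,1) assms(2)[of 1] by (induction Y rule: finite_induct) (auto intro!: assms(5) pw)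
  from assms(5)[OF assms(2) this[OF sub finite_keys]] show ?case
    unfolding single_eq_monomial[of m c] .
next
  case (add p q)
  then show ?case by (rule assms(4))
qed

lemma vars_in_UNIV [simp]: "p \<in> vars_in UNIV"
  by (simp add: vars_in_def)

lemma vars_in_con [simp]: "con c \<in> vars_in X"
  by (simp add: con_def vars_in_def)

lemma vars_in_0 [simp]: "0 \<in> vars_in X" and vars_in_1 [simp]: "1 \<in> vars_in X"
  by (simp_all add: vars_in_def)

lemma vars_in_var [simp]: "var x \<in> vars_in X \<longleftrightarrow> x \<in> X"
  by (simp add: var_def vars_in_def)

lemma vars_in_add: "p \<in> vars_in X \<Longrightarrow> q \<in> vars_in X \<Longrightarrow> p + q \<in> vars_in X"
  using keys_add[of p q] by (fastforce simp: vars_in_def)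

lemma vars_in_mult:
  assumes "p \<in> vars_in X" "q \<in> vars_in X"
  shows "p * q \<in> vars_in X"
proof -
  have "Poly_Mapping.keys m \<subseteq> X" if m: "m \<in> Poly_Mapping.keys (p * q)" for m
  proof -
    obtain a b where "m = a + b" "a \<in> Poly_Mapping.keys p" "b \<in> Poly_Mapping.keys q"
      using m keys_mult[of p q] by blast
    with keys_add[of a b] assms show ?thesis by (auto simp: vars_in_def)
  qed
  then show ?thesis by (simp add: vars_in_def)
qed

lemma vars_in_uminus: "p \<in> vars_in X \<Longrightarrow> - p \<in> vars_in X"
  by (simp add: vars_in_def)

lemma vars_in_diff: "p \<in> vars_in X \<Longrightarrow> q \<in> vars_in X \<Longrightarrow> p - q \<in> vars_in X"
  using vars_in_add[OF _ vars_in_uminus, of p X q] by simp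

lemma vars_in_sum: "(\<And>i. i \<in> I \<Longrightarrow> f i \<in> vars_in X) \<Longrightarrow> (\<Sum>i\<in>I. f i) \<in> vars_in X"
  by (induction I rule: infinite_finite_induct) (auto intro: vars_in_add)

lemma vars_in_prod: "(\<And>i. i \<in> I \<Longrightarrow> f i \<in> vars_in X) \<Longrightarrow> (\<Prod>i\<in>I. f i) \<in> vars_in X"
  by (induction I rule: infinite_finite_induct) (auto intro: vars_in_mult)

lemma vars_in_power: "p \<in> vars_in X \<Longrightarrow> p ^ k \<in> vars_in X"
  by (induction k) (auto intro: vars_in_mult)

lemma vars_in_mono: "p \<in> vars_in X \<Longrightarrow> X \<subseteq> Y \<Longrightarrow> p \<in> vars_in Y"
  by (auto simp: vars_in_def)

lemmas vars_in_intros = vars_in_add vars_in_mult vars_in_uminus vars_in_diff vars_in_sum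
  vars_in_prod vars_in_power

section \<open>Evaluation\<close>

text \<open>The coefficient map \<open>\<phi>\<close> is a parameter because the same evaluation
  serves for substitutions (\<open>con\<close>), for passing to univariate polynomials, and for
  extending the field.\<close>

definition ev :: "('k \<Rightarrow> 'r) \<Rightarrow> (nat \<times> nat \<Rightarrow> 'r) \<Rightarrow> 'k::field xpoly \<Rightarrow> 'r::comm_ring_1" where
  "ev \<phi> s p = (\<Sum>m\<in>Poly_Mapping.keys p. \<phi> (Poly_Mapping.lookup p m) *
                 (\<Prod>x\<in>Poly_Mapping.keys m. s x ^ Poly_Mapping.lookup m x))"

lemma ev_add:
  assumes "ring_morph \<phi>"
  shows "ev \<phi> s (p + q) = ev \<phi> s p + ev \<phi> s q"
proof -
  define w where "w m = (\<Prod>x\<in>Poly_Mapping.keys m. s x ^ Poly_Mapping.lookup m x)" for m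
  define M where "M = Poly_Mapping.keys p \<union> Poly_Mapping.keys q"
  have eq: "ev \<phi> s r = (\<Sum>m\<in>M. \<phi> (Poly_Mapping.lookup r m) * w m)"
    if "Poly_Mapping.keys r \<subseteq> M" for r
    unfolding ev_def w_def
    by (rule sum.mono_neutral_left)
       (use that in \<open>auto simp: M_def in_keys_iff ring_morph_zero[OF assms]\<close>)
  have sub: "Poly_Mapping.keys (p + q) \<subseteq> M" "Poly_Mapping.keys p \<subseteq> M" "Poly_Mapping.keys q \<subseteq> M"
    using keys_add[of p q] by (auto simp: M_def)
  show ?thesis
    unfolding sub[THEN eq]
    by (simp add: lookup_add ring_morph_add[OF assms] distrib_right sum.distrib)
qed

lemma ev_single:
  assumes "ring_morph \<phi>"
  shows "ev \<phi> s (Poly_Mapping.single m c) =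
    \<phi> c * (\<Prod>x\<in>Poly_Mapping.keys m. s x ^ Poly_Mapping.lookup m x)"
  by (cases "c = 0") (simp_all add: ev_def ring_morph_zero[OF assms])

lemma ev_monomial_mult:
  assumes "ring_morph \<phi>"
  shows "ev \<phi> s (Poly_Mapping.single m c * Poly_Mapping.single m' c') =
    ev \<phi> s (Poly_Mapping.single m c) * ev \<phi> s (Poly_Mapping.single m' c')"
proof -
  define M where "M = Poly_Mapping.keys m \<union> Poly_Mapping.keys m'"
  have eq: "(\<Prod>x\<in>Poly_Mapping.keys r. s x ^ Poly_Mapping.lookup r x) =
      (\<Prod>x\<in>M. s x ^ Poly_Mapping.lookup r x)"
    if "Poly_Mapping.keys r \<subseteq> M" for r
    by (rule prod.mono_neutral_left) (use that in \<open>auto simp: M_def in_keys_iff\<close>)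
  have sub: "Poly_Mapping.keys (m + m') \<subseteq> M" "Poly_Mapping.keys m \<subseteq> M" "Poly_Mapping.keys m' \<subseteq> M"
    using keys_add[of m m'] by (auto simp: M_def)
  show ?thesis
    unfolding mult_single ev_single[OF assms] sub[THEN eq]
    by (simp only: lookup_add power_add prod.distrib ring_morph_mult[OF assms] mult_ac)
qed

lemma ev_mult:
  assumes "ring_morph \<phi>"
  shows "ev \<phi> s (p * q) = ev \<phi> s p * ev \<phi> s q"
proof (induction p rule: poly_mapping_additive_induct)
  case zero
  show ?case by (simp add: ev_def)
next
  case (single m c)
  show ?case
  proof (induction q rule: poly_mapping_additive_induct)
    case zero
    show ?case by (simp add: ev_def)
  next
    case (single m' c')
    show ?case by (rule ev_monomial_mult[OF assms])
  next
    case (add p q)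
    then show ?case by (simp add: distrib_left ev_add[OF assms])
  qed
next
  case (add p q)
  then show ?case by (simp add: distrib_right ev_add[OF assms])
qed

lemma ev_con: "ring_morph \<phi> \<Longrightarrow> ev \<phi> s (con c) = \<phi> c"
  by (simp add: con_def ev_single)

lemma ev_var: "ring_morph \<phi> \<Longrightarrow> ev \<phi> s (var x) = s x"
  by (simp add: var_def ev_single ring_morph_one)

lemma ring_morph_ev: "ring_morph \<phi> \<Longrightarrow> ring_morph (ev \<phi> s)"
  using ev_con[of \<phi> s 1]
  by (simp add: ring_morph_def[of "ev \<phi> s"] ev_add ev_mult) (simp add: ring_morph_one)

lemma ring_morph_con: "ring_morph con"
  by (simp add: ring_morph_def con_add con_mult)

abbreviation subst_vars :: "(nat \<times> nat \<Rightarrow> 'k xpoly) \<Rightarrow> 'k::field xpoly \<Rightarrow> 'k xpoly" where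
  "subst_vars \<equiv> ev con"

lemmas ring_morph_subst = ring_morph_ev[OF ring_morph_con]
lemmas subst_simps = ring_morph_simps[OF ring_morph_subst] ev_var[OF ring_morph_con]
  ev_con[OF ring_morph_con]

lemma subst_vars_cong:
  assumes "p \<in> vars_in X" "\<And>x. x \<in> X \<Longrightarrow> s x = t x"
  shows "subst_vars s p = subst_vars t p"
  using assms(1) by (induction rule: xpoly_induct) (simp_all add: subst_simps assms(2))

lemma subst_vars_var: "subst_vars var p = p"
  by (rule xpoly_induct[OF vars_in_UNIV[of p]]) (simp_all add: subst_simps)

lemma subst_vars_id:
  assumes "p \<in> vars_in X" "\<And>x. x \<in> X \<Longrightarrow> s x = var x"
  shows "subst_vars s p = p"
  using subst_vars_cong[where t = var, OF assms] subst_vars_var[of p] by simp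

lemma subst_vars_in:
  assumes "p \<in> vars_in X" "\<And>x. x \<in> X \<Longrightarrow> s x \<in> vars_in Y"
  shows "subst_vars s p \<in> vars_in Y"
  using assms(1)
  by (induction rule: xpoly_induct) (auto simp: subst_simps assms(2) intro: vars_in_intros)

text \<open>Congruence modulo \<open>I\<close> respects sums and products, so the variables
  decide.\<close>

lemma subst_vars_cong_mod:
  assumes I: "is_ideal I" and "\<And>x. s x - var x \<in> I"
  shows "subst_vars s p - p \<in> I"
proof (rule xpoly_induct[OF vars_in_UNIV[of p]])
  show "subst_vars s (con c) - con c \<in> I" for c
    using ideal_gen.subspace_0[OF I] by (simp add: subst_simps)
  show "subst_vars s (var x) - var x \<in> I" for x
    using assms by (simp add: subst_simps)
next
  fix p q assume *: "subst_vars s p - p \<in> I" "subst_vars s q - q \<in> I"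
  show "subst_vars s (p + q) - (p + q) \<in> I"
    using ideal_gen.subspace_add[OF I *] by (simp add: subst_simps algebra_simps)
  have "subst_vars s q * (subst_vars s p - p) + p * (subst_vars s q - q) \<in> I"
    by (intro ideal_gen.subspace_add[OF I] ideal_gen.subspace_scale[OF I] *)
  then show "subst_vars s (p * q) - (p * q) \<in> I" by (simp add: subst_simps algebra_simps)
qed

lemma finite_vars: obtains X where "finite X" "p \<in> vars_in X"
proof
  show "finite (\<Union>m\<in>Poly_Mapping.keys p. Poly_Mapping.keys m)" by simp
  show "p \<in> vars_in (\<Union>m\<in>Poly_Mapping.keys p. Poly_Mapping.keys m)" by (auto simp: vars_in_def)
qed

section \<open>Polynomials as univariate polynomials in one variable\<close>

text \<open>The coefficients stay in the type of the polynomial itself, although \<open>y\<close> no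
  longer occurs in them, so that they can be tested for membership in the same ideals.\<close>

definition in_var :: "nat \<times> nat \<Rightarrow> 'k::field xpoly \<Rightarrow> 'k xpoly poly" where
  "in_var y = ev (\<lambda>c. [:con c:]) (\<lambda>x. if x = y then [:0, 1:] else [:var x:])"

lemma ring_morph_con_poly: "ring_morph (\<lambda>c. [:con c:])"
  by (simp add: ring_morph_def con_add con_mult one_pCons)

lemma ring_morph_in_var: "ring_morph (in_var y)"
  unfolding in_var_def by (rule ring_morph_ev[OF ring_morph_con_poly])

lemma in_var_con: "in_var y (con c) = [:con c:]"
  and in_var_self: "in_var y (var y) = [:0, 1:]"
  and in_var_other: "x \<noteq> y \<Longrightarrow> in_var y (var x) = [:var x:]"
  unfolding in_var_def by (simp_all add: ev_con ev_var ring_morph_con_poly)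

lemmas in_var_simps = ring_morph_simps[OF ring_morph_in_var]

lemma in_var_free: "p \<in> vars_in (- {y}) \<Longrightarrow> in_var y p = [:p:]"
  by (induction rule: xpoly_induct) (auto simp: in_var_con in_var_other in_var_simps)

lemma poly_in_var: "poly (in_var y p) (var y) = p"
proof (rule xpoly_induct[OF vars_in_UNIV[of p]])
  show "poly (in_var y (var x)) (var y) = var x" for x
    by (cases "x = y") (simp_all add: in_var_self in_var_other)
qed (auto simp: in_var_con in_var_simps)

text \<open>Generators without \<open>y\<close> become constants of the polynomial ring in
  \<open>y\<close>, so membership can be tested coefficient by coefficient;
  \<open>in_ideal_of_if_coeffs\<close> is the converse.\<close>

lemma coeff_in_var_ideal_of:
  assumes "G \<subseteq> vars_in (- {y})" "p \<in> ideal_of G"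
  shows "coeff (in_var y p) k \<in> ideal_of G"
  using assms(2)
proof (induction rule: ideal_gen.span_induct_alt)
  case base
  then show ?case by (simp add: in_var_simps ideal_gen.span_zero)
next
  case (step c x z)
  have "in_var y (c * x + z) = smult x (in_var y c) + in_var y z"
    using in_var_free[of x y] step(1) assms(1) by (auto simp: in_var_simps)
  then show ?case
    using step ideal_gen.span_add[OF ideal_of_mult_right[OF ideal_gen.span_base[OF step(1)]] step(2)]
    by simp
qed

lemma in_ideal_of_if_coeffs:
  assumes "\<And>k. coeff (in_var y p) k \<in> ideal_of G"
  shows "p \<in> ideal_of G"
proof -
  have "poly (in_var y p) (var y) \<in> ideal_of G"
    unfolding poly_altdef by (intro ideal_gen.span_sum ideal_of_mult_right assms)
  then show ?thesis by (simp add: poly_in_var)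
qed

text \<open>These are the coefficients of the given congruence at the powers 0 and
  \<open>Suc k\<close> of \<open>y\<close>.\<close>

lemma linear_elimination_coeffs:
  assumes G: "G \<subseteq> vars_in (- {y})" and ab: "a \<in> vars_in (- {y})" "b \<in> vars_in (- {y})"
    and p: "p \<in> vars_in (- {y})" and mem: "(var y * a + b) * q - p \<in> ideal_of G"
  shows "b * coeff (in_var y q) 0 - p \<in> ideal_of G"
    and "a * coeff (in_var y q) k + b * coeff (in_var y q) (Suc k) \<in> ideal_of G"
proof -
  have "in_var y ((var y * a + b) * q - p) = (pCons 0 [:a:] + [:b:]) * in_var y q - [:p:]"
    using ab p by (simp add: in_var_simps in_var_self in_var_free)
  also have "\<dots> = pCons 0 (smult a (in_var y q)) + smult b (in_var y q) - [:p:]"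
    by (simp add: algebra_simps)
  finally have eq: "in_var y ((var y * a + b) * q - p) = \<dots>" .
  show "b * coeff (in_var y q) 0 - p \<in> ideal_of G"
    using coeff_in_var_ideal_of[OF G mem, of 0] unfolding eq by simp
  show "a * coeff (in_var y q) k + b * coeff (in_var y q) (Suc k) \<in> ideal_of G"
    using coeff_in_var_ideal_of[OF G mem, of "Suc k"] unfolding eq by simp
qed

text \<open>Read downwards from the degree of q, the relations a q_k = - b q_(k+1) show that a power
  of \<open>a\<close> kills the constant coefficient of q, and \<open>p\<close> is congruent to
  \<open>b\<close> times that coefficient. Geometrically, y = - b / a where \<open>a\<close> is
  invertible.\<close>

lemma linear_elimination:
  assumes G: "G \<subseteq> vars_in (- {y})" and ab: "a \<in> vars_in (- {y})" "b \<in> vars_in (- {y})"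
    and p: "p \<in> vars_in (- {y})" and mem: "p \<in> ideal_of (insert (var y * a + b) G)"
  shows "\<exists>M. a ^ M * p \<in> ideal_of G"
proof -
  obtain q where "p - q * (var y * a + b) \<in> ideal_of G"
    using mem by (auto simp: ideal_of_insert_iff)
  then have "(var y * a + b) * q - p \<in> ideal_of G"
    using ideal_gen.span_neg by (fastforce simp: mult.commute)
  note rec = linear_elimination_coeffs[OF G ab p this]
  \<comment> \<open>One more than the degree, so that the recursion starts at a coefficient that is
    0.\<close>
  define D where "D = Suc (degree (in_var y q))"
  have ak: "a ^ k * coeff (in_var y q) (D - k) \<in> ideal_of G" if "k \<le> D" for k
    using that
  proof (induction k)
    case 0
    then show ?case by (simp add: D_def coeff_eq_0 ideal_gen.span_zero)
  next
    case (Suc k)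
    have S: "Suc (D - Suc k) = D - k" using Suc.prems by simp
    have "a ^ k * (a * coeff (in_var y q) (D - Suc k) + b * coeff (in_var y q) (D - k)) - 
        b * (a ^ k * coeff (in_var y q) (D - k)) \<in> ideal_of G"
      using rec(2)[of "D - Suc k"] Suc unfolding S
      by (blast intro: ideal_gen.span_diff ideal_gen.span_scale Suc_leD)
    then show ?case by (simp add: algebra_simps)
  qed
  have "b * (a ^ D * coeff (in_var y q) 0) - a ^ D * (b * coeff (in_var y q) 0 - p) \<in> ideal_of G"
    using ideal_gen.span_diff[OF ideal_gen.span_scale ideal_gen.span_scale, OF ak[of D] rec(1)] by simp
  then show ?thesis by (intro exI[of _ D]) (simp add: algebra_simps)
qed

section \<open>Nonzerodivisors modulo an ideal\<close>

definition regular_mod :: "'a::comm_ring_1 set \<Rightarrow> 'a \<Rightarrow> bool" where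
  "regular_mod I f \<longleftrightarrow> (\<forall>q. f * q \<in> I \<longrightarrow> q \<in> I)"

lemma regular_modD: "regular_mod I f \<Longrightarrow> f * q \<in> I \<Longrightarrow> q \<in> I"
  by (auto simp: regular_mod_def)

lemma regular_mod_power:
  assumes "regular_mod I f"
  shows "f ^ N * q \<in> I \<Longrightarrow> q \<in> I"
proof (induction N)
  case (Suc N)
  then have "f * (f ^ N * q) \<in> I" by (simp add: mult.assoc)
  from Suc.IH[OF regular_modD[OF assms this]] show ?case .
qed simp

lemma regular_mod_prod:
  assumes "\<And>i. i \<in> A \<Longrightarrow> regular_mod I (f i)"
  shows "regular_mod I (\<Prod>i\<in>A. f i)"
  using assms
proof (induction A rule: infinite_finite_induct)
  case (insert i A)
  show ?case unfolding regular_mod_def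
  proof (intro allI impI)
    fix q assume "prod f (insert i A) * q \<in> I"
    with insert.hyps have "f i * (prod f A * q) \<in> I" by (simp add: mult.assoc)
    have "regular_mod I (f i)" "regular_mod I (prod f A)" using insert by auto
    with \<open>f i * (prod f A * q) \<in> I\<close> show "q \<in> I" by (auto dest: regular_modD)
  qed
qed (simp_all add: regular_mod_def)

text \<open>In the relations a q_k = - b q_(k+1) the factor \<open>a\<close> can be cancelled, so
  the coefficients of \<open>q\<close> fall into the ideal one after the other, from the top
  down.\<close>

lemma linear_regular:
  assumes G: "G \<subseteq> vars_in (- {y})" and ab: "a \<in> vars_in (- {y})" "b \<in> vars_in (- {y})"
    and reg: "regular_mod (ideal_of G) a"
  shows "regular_mod (ideal_of G) (var y * a + b)"
  unfolding regular_mod_def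
proof (intro allI impI)
  fix q assume "(var y * a + b) * q \<in> ideal_of G"
  then have "(var y * a + b) * q - 0 \<in> ideal_of G" by simp
  note rec = linear_elimination_coeffs(2)[OF G ab vars_in_0 this]
  define D where "D = Suc (degree (in_var y q))"
  have ak: "coeff (in_var y q) k \<in> ideal_of G" for k
  proof (cases "k \<le> D")
    case True
    then show ?thesis
    proof (induction rule: inc_induct)
      case base
      then show ?case by (simp add: D_def coeff_eq_0 ideal_gen.span_zero)
    next
      case (step k)
      from rec[of k] ideal_gen.span_scale[OF step.IH, of b]
      have "a * coeff (in_var y q) k \<in> ideal_of G"
        using ideal_gen.span_diff by fastforce
      then show ?case by (rule regular_modD[OF reg])
    qed
  next
    case False
    then show ?thesis by (simp add: D_def coeff_eq_0 ideal_gen.span_zero)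
  qed
  then show "q \<in> ideal_of G" by (rule in_ideal_of_if_coeffs)
qed

lemma var_regular:
  assumes "G \<subseteq> vars_in (- {y})"
  shows "regular_mod (ideal_of G) (var y)"
  using linear_regular[OF assms, of 1 0] by (simp add: regular_mod_def)

text \<open>Modulo \<open>var y * a + b\<close>, one factor \<open>a\<close> turns one factor
  \<open>var y\<close> into \<open>- b\<close>.\<close>

lemma pseudo_division:
  assumes ab: "a \<in> vars_in (- {y})" "b \<in> vars_in (- {y})" 
  shows "\<exists>N h'. h' \<in> vars_in (- {y}) \<and> a ^ N * h - h' \<in> ideal_of {var y * a + b}"
proof (rule xpoly_induct[OF vars_in_UNIV[of h]])
  show "\<exists>N h'. h' \<in> vars_in (- {y}) \<and> a ^ N * con c - h' \<in> ideal_of {var y * a + b}" for c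
    by (intro exI[of _ 0] exI[of _ "con c"]) (simp add: ideal_gen.span_zero)
  show "\<exists>N h'. h' \<in> vars_in (- {y}) \<and> a ^ N * var x - h' \<in> ideal_of {var y * a + b}" for x
  proof (cases "x = y")
    case True
    then show ?thesis using ab
      by (intro exI[of _ 1] exI[of _ "- b"])
         (auto intro!: ideal_gen.span_base vars_in_intros simp: mult.commute)
  next
    case False
    then show ?thesis by (intro exI[of _ 0] exI[of _ "var x"]) (simp add: ideal_gen.span_zero)
  qed
next
  fix p q
  assume "\<exists>N h'. h' \<in> vars_in (- {y}) \<and> a ^ N * p - h' \<in> ideal_of {var y * a + b}"
    "\<exists>N h'. h' \<in> vars_in (- {y}) \<and> a ^ N * q - h' \<in> ideal_of {var y * a + b}"
  then obtain N p' M q' where p: "p' \<in> vars_in (- {y})" "a ^ N * p - p' \<in> ideal_of {var y * a + b}"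
    and q: "q' \<in> vars_in (- {y})" "a ^ M * q - q' \<in> ideal_of {var y * a + b}" by blast
  have "a ^ M * (a ^ N * p - p') + a ^ N * (a ^ M * q - q') \<in> ideal_of {var y * a + b}"
    by (intro ideal_gen.span_add ideal_gen.span_scale p q)
  then have "a ^ (N + M) * (p + q) - (a ^ M * p' + a ^ N * q') \<in> ideal_of {var y * a + b}"
    by (simp add: algebra_simps power_add)
  then show "\<exists>N h'. h' \<in> vars_in (- {y}) \<and> a ^ N * (p + q) - h' \<in> ideal_of {var y * a + b}"
    using p q ab by (intro exI[of _ "N + M"] exI[of _ "a ^ M * p' + a ^ N * q'"])
      (auto intro!: vars_in_intros)
  have "a ^ M * q * (a ^ N * p - p') + p' * (a ^ M * q - q') \<in> ideal_of {var y * a + b}"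
    by (intro ideal_gen.span_add ideal_gen.span_scale p q)
  then have "a ^ (N + M) * (p * q) - p' * q' \<in> ideal_of {var y * a + b}"
    by (simp add: algebra_simps power_add)
  then show "\<exists>N h'. h' \<in> vars_in (- {y}) \<and> a ^ N * (p * q) - h' \<in> ideal_of {var y * a + b}"
    using p q by (intro exI[of _ "N + M"] exI[of _ "p' * q'"]) (auto intro!: vars_in_intros)
qed

section \<open>The grading by total degree\<close>

text \<open>Each variable x is replaced by x T with a new variable T, so the coefficient of T^s is
  the homogeneous part of degree s. Agreement with \<open>monomial_degree\<close> is shown in
  \<open>homog_iff\<close>.\<close>

definition in_degree :: "'k::field xpoly \<Rightarrow> 'k xpoly poly" where
  "in_degree = ev (\<lambda>c. [:con c:]) (\<lambda>x. [:0, var x:])"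

lemma ring_morph_in_degree: "ring_morph in_degree"
  unfolding in_degree_def by (rule ring_morph_ev[OF ring_morph_con_poly])

lemma in_degree_con: "in_degree (con c) = monom (con c) 0"
  and in_degree_var: "in_degree (var x) = monom (var x) 1"
  unfolding in_degree_def by (simp_all add: ev_con ev_var ring_morph_con_poly monom_altdef)

lemmas in_degree_simps = ring_morph_simps[OF ring_morph_in_degree]

definition component :: "nat \<Rightarrow> 'k::field xpoly \<Rightarrow> 'k xpoly" where
  "component s p = coeff (in_degree p) s"

definition homog :: "nat \<Rightarrow> 'k::field xpoly \<Rightarrow> bool" where
  "homog s p \<longleftrightarrow> in_degree p = monom p s"

lemma homog_0 [simp]: "homog s 0"
  by (simp add: homog_def in_degree_simps)

lemma homog_con: "homog 0 (con c)" and homog_var: "homog 1 (var x)"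
  by (simp_all add: homog_def in_degree_con in_degree_var)

lemma homog_add: "homog s p \<Longrightarrow> homog s q \<Longrightarrow> homog s (p + q)"
  by (simp add: homog_def in_degree_simps add_monom)

lemma homog_diff: "homog s p \<Longrightarrow> homog s q \<Longrightarrow> homog s (p - q)"
  by (simp add: homog_def in_degree_simps diff_monom)

lemma homog_mult: "homog s p \<Longrightarrow> homog t q \<Longrightarrow> homog (s + t) (p * q)"
  by (simp add: homog_def in_degree_simps mult_monom)

lemma homog_sum: "(\<And>i. i \<in> I \<Longrightarrow> homog s (f i)) \<Longrightarrow> homog s (\<Sum>i\<in>I. f i)"
  by (induction I rule: infinite_finite_induct) (auto intro: homog_add)

lemma component_0 [simp]: "component s 0 = 0"
  and component_add: "component s (p + q) = component s p + component s q"
  and component_diff: "component s (p - q) = component s p - component s q"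
  by (simp_all add: component_def in_degree_simps)

lemma component_of_homog: "homog t p \<Longrightarrow> component s p = (if s = t then p else 0)"
  by (auto simp: component_def homog_def)

lemma component_homog_mult:
  "homog t g \<Longrightarrow> component s (g * p) = (if s < t then 0 else g * component (s - t) p)"
  by (simp add: component_def homog_def in_degree_simps coeff_monom_mult)

lemma component_vars_in: "p \<in> vars_in X \<Longrightarrow> component s p \<in> vars_in X"
proof (induction arbitrary: s rule: xpoly_induct)
  case (con c)
  then show ?case by (simp add: component_of_homog[OF homog_con])
next
  case (var x)
  then show ?case by (simp add: component_of_homog[OF homog_var])
next
  case (add p q)
  then show ?case by (simp add: component_add vars_in_add)
next
  case (mult p q)
  then show ?case
    unfolding component_def
    by (simp add: in_degree_simps coeff_mult) (intro vars_in_sum vars_in_mult)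
qed

lemma homog_component:
  fixes p :: "'k::field xpoly"
  shows "homog s (component s p)"
proof -
  have "\<forall>s. homog s (component s p)"
  proof (rule xpoly_induct[OF vars_in_UNIV[of p]])
    show "\<forall>s. homog s (component s (con c :: 'k xpoly))" for c
      by (simp add: component_of_homog[OF homog_con] homog_con)
    show "\<forall>s. homog s (component s (var x :: 'k xpoly))" for x
      by (simp add: component_of_homog[OF homog_var] homog_var del: One_nat_def)
  next
    fix p q :: "'k xpoly"
    assume *: "\<forall>s. homog s (component s p)" "\<forall>s. homog s (component s q)"
    show "\<forall>s. homog s (component s (p + q))" using * by (simp add: component_add homog_add)
    have "homog s (component i p * component (s - i) q)" if "i \<le> s" for i s
      using homog_mult[of i "component i p" "s - i" "component (s - i) q"] * that by simp
    then show "\<forall>s. homog s (component s (p * q))"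
      by (auto simp: component_def in_degree_simps coeff_mult intro!: homog_sum)
  qed
  then show ?thesis ..
qed

lemma poly_in_degree: "poly (in_degree p) 1 = p"
proof (rule xpoly_induct[OF vars_in_UNIV[of p]])
qed (simp_all add: in_degree_simps in_degree_con in_degree_var poly_monom)

lemma component_ideal_of:
  assumes "\<And>g. g \<in> G \<Longrightarrow> \<exists>t. homog t g" "p \<in> ideal_of G"
  shows "component s p \<in> ideal_of G"
  using assms(2)
proof (induction rule: ideal_gen.span_induct_alt)
  case base
  then show ?case by (simp add: ideal_gen.span_zero)
next
  case (step c x y)
  from assms(1)[OF step(1)] obtain t where "homog t x" ..
  then have "component s (c * x) \<in> ideal_of G"
    using component_homog_mult[of t x s c]
      ideal_of_mult_right[OF ideal_gen.span_base[OF step(1)], of "component (s - t) c"]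
    by (simp add: mult.commute ideal_gen.span_zero)
  then show ?case by (simp add: component_add ideal_gen.span_add step)
qed

text \<open>Top components are multiplicative, so the top component of a nilpotent modulo a
  homogeneous ideal is nilpotent too; subtracting it leaves a nilpotent of smaller degree.\<close>

lemma radical_set_homogeneousI:
  fixes G :: "'k::field xpoly set"
  assumes G: "\<And>g. g \<in> G \<Longrightarrow> \<exists>t. homog t g"
    and rad: "\<And>s h. homog s h \<Longrightarrow> h \<in> rad (ideal_of G) \<Longrightarrow> h \<in> ideal_of G"
  shows "radical_set (ideal_of G)"
proof -
  have "h \<in> rad (ideal_of G) \<longrightarrow> h \<in> ideal_of G" for h
  proof (induction "degree (in_degree h)" arbitrary: h rule: less_induct)
    case less
    show ?case
    proof
      assume h: "h \<in> rad (ideal_of G)"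
      define s where "s = degree (in_degree h)"
      define l where "l = component s h"
      obtain N where N: "h ^ N \<in> ideal_of G" using h by (auto simp: rad_def)
      have "component (N * s) (h ^ N) = l ^ N"
      proof (cases "in_degree h = 0")
        case True
        then show ?thesis by (simp add: component_def l_def s_def in_degree_simps) (cases N; simp)
      next
        case False
        then have "degree (in_degree h ^ N) = N * s" by (simp add: s_def degree_power_eq)
        with lead_coeff_power[of "in_degree h" N] show ?thesis
          by (simp add: component_def l_def s_def in_degree_simps)
      qed
      with component_ideal_of[OF G N, of "N * s"] have "l \<in> rad (ideal_of G)"
        by (auto simp: rad_def)
      then have l: "l \<in> ideal_of G" using rad homog_component[of s h] by (simp add: l_def)
      have eq: "in_degree (h - l) = in_degree h - monom l s"
        using homog_component[of s h] by (simp add: in_degree_simps homog_def l_def)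
      have "h - l \<in> ideal_of G"
      proof (cases "degree (in_degree (h - l)) < s")
        case True
        have "h - l \<in> rad (ideal_of G)"
          using ideal_gen.subspace_diff[OF rad_ideal_of h] subset_rad l by blast
        then show ?thesis using less True by (auto simp: s_def)
      next
        case False
        \<comment> \<open>The coefficient at \<open>s\<close> cancels, so the degree fails to drop
          only if \<open>h = l\<close>.\<close>
        have "degree (in_degree (h - l)) \<le> s"
          unfolding eq by (intro degree_diff_le) (auto simp: s_def degree_monom_le)
        with False have "degree (in_degree (h - l)) = s" by simp
        moreover have "coeff (in_degree (h - l)) s = 0"
          unfolding eq by (simp add: l_def component_def)
        ultimately have "in_degree (h - l) = 0" by (metis leading_coeff_0_iff)
        then have "h - l = 0" using poly_in_degree[of "h - l"] by simp
        then show ?thesis by (simp add: ideal_gen.span_zero)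
      qed
      from ideal_gen.span_add[OF this l] show "h \<in> ideal_of G" by simp
    qed
  qed
  then show ?thesis unfolding radical_set_def rad_def by blast
qed

lemma in_degree_single:
  "in_degree (Poly_Mapping.single m c) = monom (Poly_Mapping.single m c) (monomial_degree m)"
proof -
  have prod: "in_degree (\<Prod>x\<in>X. var x ^ Poly_Mapping.lookup m x) =
      monom (\<Prod>x\<in>X. var x ^ Poly_Mapping.lookup m x) (\<Sum>x\<in>X. Poly_Mapping.lookup m x)"
    if "finite X" for X
    using that
    by (induction X rule: finite_induct)
       (simp_all add: in_degree_simps in_degree_var monom_power mult_monom)
  show ?thesis
    unfolding single_eq_monomial[of m c] monomial_degree_def
    by (simp only: ring_morph_mult[OF ring_morph_in_degree] in_degree_con prod[OF finite_keys]
        mult_monom add_0)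
qed

lemma lookup_component:
  "Poly_Mapping.lookup (component s p) m =
    (if monomial_degree m = s then Poly_Mapping.lookup p m else 0)"
proof (induction p rule: poly_mapping_additive_induct)
  case (single m' c)
  then show ?case
    by (auto simp: component_def in_degree_single lookup_single when_def)
qed (simp_all add: component_add lookup_add)

lemma homog_iff: "homog s p \<longleftrightarrow> (\<forall>m\<in>Poly_Mapping.keys p. monomial_degree m = s)"
proof
  assume "homog s p"
  then have "component s p = p" by (simp add: component_of_homog)
  then show "\<forall>m\<in>Poly_Mapping.keys p. monomial_degree m = s"
    using lookup_component[of s p] by (metis in_keys_iff)
next
  assume "\<forall>m\<in>Poly_Mapping.keys p. monomial_degree m = s"
  then have "component s p = p"
    by (intro poly_mapping_eqI) (auto simp: lookup_component in_keys_iff)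
  then show "homog s p" using homog_component[of s p] by simp
qed

lemma homogeneous_iff: "homogeneous p \<longleftrightarrow> (\<exists>s. homog s p)"
  by (simp add: homogeneous_def homog_iff)

section \<open>Finite-dimensional spaces of polynomials\<close>

text \<open>The same type as a vector space over the constants, for dimension counts;
  \<open>ideal_of\<close> is the span over the whole ring.\<close>

global_interpretation kvs: vector_space "\<lambda>c p. con c * p"
  defines kspan = kvs.span and kdependent = kvs.dependent
  by unfold_locales (auto simp: algebra_simps con_add con_mult)

declare kvs.scale_scale [simp del]

definition box_monomial :: "(nat \<times> nat) set \<Rightarrow> (nat \<times> nat \<Rightarrow> nat) \<Rightarrow> 'k::field xpoly" where
  "box_monomial X f = Poly_Mapping.single (\<Sum>x\<in>X. Poly_Mapping.single x (f x)) 1"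

text \<open>Bounding the exponents one by one, rather than the total degree, makes the number of
  monomials an exact power.\<close>

definition box_monomials :: "(nat \<times> nat) set \<Rightarrow> nat \<Rightarrow> 'k::field xpoly set" where
  "box_monomials X D = box_monomial X ` (X \<rightarrow>\<^sub>E {..D})"

lemma lookup_box:
  "finite X \<Longrightarrow> Poly_Mapping.lookup (\<Sum>x\<in>X. Poly_Mapping.single x (f x)) y = (if y \<in> X then f y else (0::nat))"
  by (simp add: lookup_sum lookup_single when_def sum.delta')

lemma inj_on_box_monomial:
  assumes "finite X"
  shows "inj_on (box_monomial X :: _ \<Rightarrow> 'k::field xpoly) (X \<rightarrow>\<^sub>E {..D})"
proof (rule inj_onI)
  fix f g assume f: "f \<in> X \<rightarrow>\<^sub>E {..D}" and g: "g \<in> X \<rightarrow>\<^sub>E {..D}"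
    and eq: "box_monomial X f = (box_monomial X g :: 'k xpoly)"
  from arg_cong[OF eq, of Poly_Mapping.keys]
  have "(\<Sum>x\<in>X. Poly_Mapping.single x (f x)) = (\<Sum>x\<in>X. Poly_Mapping.single x (g x))"
    by (simp add: box_monomial_def)
  then have "f x = g x" if "x \<in> X" for x
    using lookup_box[OF assms, of f x] lookup_box[OF assms, of g x] that by simp
  then show "f = g" using f g by (intro PiE_ext) auto
qed

lemma
  assumes "finite X"
  shows finite_box_monomials: "finite (box_monomials X D)"
    and card_box_monomials: "card (box_monomials X D :: 'k::field xpoly set) = (D + 1) ^ card X"
  using inj_on_box_monomial[OF assms, of D, where 'k = 'k] assms
  by (auto simp: box_monomials_def card_image card_PiE intro!: finite_imageI finite_PiE)

definition in_box :: "(nat \<times> nat) set \<Rightarrow> nat \<Rightarrow> 'k::field xpoly set" where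
  "in_box X D = {p. \<forall>m\<in>Poly_Mapping.keys p. Poly_Mapping.keys m \<subseteq> X \<and> (\<forall>x. Poly_Mapping.lookup m x \<le> D)}"

lemma in_box_subset_kspan:
  assumes "finite X" "p \<in> in_box X D"
  shows "p \<in> kspan (box_monomials X D)"
proof (induction p rule: poly_mapping_additive_induct)
  case zero
  then show ?case by (rule kvs.span_zero)
next
  case (single m c)
  have m: "Poly_Mapping.keys m \<subseteq> X" "\<And>x. Poly_Mapping.lookup m x \<le> D"
    using single assms(2) by (auto simp: in_box_def)
  define f where "f = restrict (Poly_Mapping.lookup m) X"
  have "(\<Sum>x\<in>X. Poly_Mapping.single x (f x)) = m"
    by (rule poly_mapping_eqI) (use m in \<open>auto simp: lookup_box[OF assms(1)] f_def in_keys_iff\<close>)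
  then have "Poly_Mapping.single m c = con c * box_monomial X f"
    by (simp add: box_monomial_def con_def mult_single)
  moreover have "f \<in> X \<rightarrow>\<^sub>E {..D}" using m by (auto simp: f_def)
  ultimately show ?case
    using kvs.span_scale[OF kvs.span_base[of "box_monomial X f" "box_monomials X D"], of c]
    by (simp add: box_monomials_def)
next
  case (add p q)
  then show ?case by (rule kvs.span_add)
qed

lemma homog_in_box:
  assumes "homog s p" "p \<in> vars_in X"
  shows "p \<in> in_box X s"
proof -
  have "Poly_Mapping.lookup m x \<le> monomial_degree m" for m x
  proof (cases "x \<in> Poly_Mapping.keys m")
    case True
    then show ?thesis unfolding monomial_degree_def by (intro member_le_sum) auto
  qed (simp add: in_keys_iff)
  then show ?thesis using assms by (fastforce simp: in_box_def homog_iff vars_in_def)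
qed

text \<open>A family rather than a set, since values may repeat; a repeated value is already a
  relation of the required kind.\<close>

lemma dependent_family:
  assumes "finite M" "finite C" "card C > card M" "\<And>c. c \<in> C \<Longrightarrow> h c \<in> kspan M"
  shows "\<exists>c\<in>C. h c \<in> kspan (h ` (C - {c}))"
proof (cases "inj_on h C")
  case True
  have "kdependent (h ` C)"
  proof (rule ccontr)
    assume "\<not> kdependent (h ` C)"
    moreover have "h ` C \<subseteq> kspan M" using assms(4) by (rule image_subsetI)
    ultimately have "card (h ` C) \<le> card M"
      using kvs.independent_span_bound[OF assms(1)] by simp
    with True assms(3) show False by (simp add: card_image)
  qed
  then obtain a where a: "a \<in> h ` C" "a \<in> kspan (h ` C - {a})"
    by (auto simp: kvs.dependent_def)
  then obtain c where c: "c \<in> C" "a = h c" by blast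
  have "h ` C - {h c} \<subseteq> h ` (C - {c})" by blast
  from kvs.span_mono[OF this] a(2) c(2) have "h c \<in> kspan (h ` (C - {c}))" by (simp add: subset_iff)
  with c(1) show ?thesis ..
next
  case False
  then obtain c c' where "c \<in> C" "c' \<in> C" "c \<noteq> c'" "h c = h c'" by (auto simp: inj_on_def)
  then have "h c \<in> h ` (C - {c})" by blast
  from kvs.span_base[OF this] \<open>c \<in> C\<close> show ?thesis ..
qed

section \<open>Congruences modulo an ideal\<close>

lemma power_diff_in_ideal:
  assumes I: "is_ideal I" and "x - y \<in> I"
  shows "x ^ N - y ^ N \<in> I"
proof (induction N)
  case 0
  then show ?case using ideal_gen.subspace_0[OF I] by simp
next
  case (Suc N)
  have "x * (x ^ N - y ^ N) + y ^ N * (x - y) \<in> I"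
    by (intro ideal_gen.subspace_add[OF I] ideal_gen.subspace_scale[OF I] assms Suc)
  then show ?case by (simp add: algebra_simps)
qed

lemma in_ideal_cong:
  assumes "is_ideal I" "x - y \<in> I"
  shows "x \<in> I \<longleftrightarrow> y \<in> I"
  using ideal_gen.subspace_diff[OF assms(1) _ assms(2), of x]
    ideal_gen.subspace_add[OF assms(1) _ assms(2), of y] by auto

lemmas ideal_of_cong = in_ideal_cong[OF ideal_gen.subspace_span]

lemma ideal_of_insertI: "g \<in> ideal_of G \<Longrightarrow> g \<in> ideal_of (insert f G)"
  using ideal_gen.span_mono[of G "insert f G"] by blast

lemma ideal_of_insert_0: "ideal_of (insert 0 G) = ideal_of G"
  by (auto simp: ideal_of_insert_iff)

lemma ideal_of_insert_self: "q * f \<in> ideal_of (insert f G)" "f * q \<in> ideal_of (insert f G)"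
  using ideal_gen.span_scale[OF ideal_gen.span_base[of f "insert f G"], of q]
  by (simp_all add: mult.commute)

lemma ideal_of_subset: "G \<subseteq> ideal_of H \<Longrightarrow> ideal_of G \<subseteq> ideal_of H"
  by (rule ideal_gen.span_minimal) auto

section \<open>Generators that are linear in two variables\<close>

text \<open>Once \<open>a\<close> is inverted, \<open>var z * a + b\<close> can be solved for
  \<open>z\<close>, and what remains is a quotient without \<open>z\<close>, cut out by
  \<open>G\<close> alone; there nilpotents vanish and \<open>var y\<close> is a nonzerodivisor.
  Coming back from the localisation costs a power of \<open>a\<close>, which within the radical
  amounts to one factor.\<close>

lemma leading_coefficient_mult_in_rad:
  fixes G :: "'k::field xpoly set"
  assumes G: "G \<subseteq> vars_in (- {z})" "G \<subseteq> vars_in (- {y})" and yz: "y \<noteq> z"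
    and ab: "a \<in> vars_in (- {z})" "b \<in> vars_in (- {z})"
    and radG: "radical_set (ideal_of G)"
    and h: "var y * h \<in> rad (ideal_of (insert (var z * a + b) G))"
  shows "a * h \<in> rad (ideal_of (insert (var z * a + b) G))"
proof -
  define I where "I = ideal_of (insert (var z * a + b) G)"
  have I: "is_ideal I" by (simp add: I_def)
  obtain N where N: "(var y * h) ^ N \<in> I" using h by (auto simp: rad_def I_def)
  obtain M h' where h': "h' \<in> vars_in (- {z})" "a ^ M * h - h' \<in> ideal_of {var z * a + b}"
    using pseudo_division[OF ab, of h] by blast
  have eq: "a ^ M * h - h' \<in> I"
    using h'(2) ideal_gen.span_mono[of "{var z * a + b}" "insert (var z * a + b) G"]
    by (auto simp: I_def)
  have "var y * (a ^ M * h - h') \<in> I" by (rule ideal_gen.subspace_scale[OF I eq])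
  then have "a ^ M * (var y * h) - var y * h' \<in> I" by (simp add: algebra_simps)
  from power_diff_in_ideal[OF I this, of N]
  have "(a ^ M * (var y * h)) ^ N - (var y * h') ^ N \<in> I" .
  moreover have "(a ^ M * (var y * h)) ^ N \<in> I"
    using ideal_gen.subspace_scale[OF I N, of "(a ^ M) ^ N"] by (simp add: power_mult_distrib)
  ultimately have "(var y * h') ^ N \<in> I" using in_ideal_cong[OF I] by blast
  moreover have "(var y * h') ^ N \<in> vars_in (- {z})"
    using h'(1) yz by (intro vars_in_intros) auto
  ultimately obtain K where K: "a ^ K * (var y * h') ^ N \<in> ideal_of G"
    using linear_elimination[OF G(1) ab] unfolding I_def by blast
  have "(var y * (a * h')) ^ (N + K) = (a ^ K * (var y * h') ^ N) * (a ^ N * (var y * h') ^ K)"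
    by (simp add: power_add power_mult_distrib mult_ac)
  then have "(var y * (a * h')) ^ (N + K) \<in> ideal_of G"
    using ideal_of_mult_right[OF K] by simp
  then have "var y * (a * h') \<in> ideal_of G" by (rule radD[OF radG])
  then have "a * h' \<in> ideal_of G" by (rule regular_modD[OF var_regular[OF G(2)]])
  then have "a * h' \<in> I" unfolding I_def by (rule ideal_of_insertI)
  moreover have "a * (a ^ M * h) - a * h' \<in> I"
    using ideal_gen.subspace_scale[OF I eq, of a] by (simp add: algebra_simps)
  ultimately have "a * (a ^ M * h) \<in> I" using in_ideal_cong[OF I] by blast
  from ideal_gen.subspace_scale[OF I this, of "h ^ M"] have "(a * h) ^ Suc M \<in> I"
    by (simp add: power_mult_distrib mult_ac)
  then show ?thesis unfolding rad_def I_def by blast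
qed

lemma vars_in_Un_subset: "G \<subseteq> vars_in X \<Longrightarrow> X \<subseteq> Y \<Longrightarrow> G \<subseteq> vars_in Y"
  using vars_in_mono by blast

text \<open>Geometrically: no component of the zero set of \<open>F\<close> and \<open>G\<close> lies in \<open>y1 = y2 = 0\<close>.\<close>

lemma two_variables_regular_mod_rad:
  fixes G :: "'k::field xpoly set"
  assumes G: "G \<subseteq> vars_in (- {y1, y2})" and y: "y1 \<noteq> y2"
    and F: "F0 \<in> vars_in (- {y1, y2})" "F1 \<in> vars_in (- {y1, y2})" "F2 \<in> vars_in (- {y1, y2})"
    and radG: "radical_set (ideal_of G)"
    and I_def: "I = ideal_of (insert (var y1 * F1 + var y2 * F2 + F0) G)"
    and h: "var y1 * h \<in> rad I" "var y2 * h \<in> rad I"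
  shows "h \<in> rad I"
proof -
  have I: "is_ideal I" by (simp add: I_def)
  note R = is_ideal_rad[OF I]
  have G1: "G \<subseteq> vars_in (- {y1})" and G2: "G \<subseteq> vars_in (- {y2})"
    using G by (auto elim!: vars_in_mono)
  have F': "f \<in> vars_in (- {y1})" "f \<in> vars_in (- {y2})" if "f \<in> vars_in (- {y1, y2})" for f :: "'k xpoly"
    using that by (auto elim!: vars_in_mono)
  have yv: "var y1 \<in> vars_in (- {y2})" "var y2 \<in> vars_in (- {y1})" using y by auto
  have 1: "F1 * h \<in> rad I"
    using leading_coefficient_mult_in_rad[OF G1 G2 _ F'(1)[OF F(2)] _ radG, of "var y2 * F2 + F0" h]
      h(2) y F' F yv unfolding I_def by (simp add: vars_in_intros add.assoc)
  have 2: "F2 * h \<in> rad I"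
    using leading_coefficient_mult_in_rad[OF G2 G1 _ F'(2)[OF F(3)] _ radG, of "var y1 * F1 + F0" h]
      h(1) y F' F yv unfolding I_def by (simp add: vars_in_intros add_ac)
  have "(var y1 * F1 + var y2 * F2 + F0) * h \<in> I" unfolding I_def by (rule ideal_of_insert_self)
  then have "(var y1 * F1 + var y2 * F2 + F0) * h - var y1 * (F1 * h) - var y2 * (F2 * h) \<in> rad I"
    using subset_rad by (blast intro: ideal_gen.subspace_diff[OF R] ideal_gen.subspace_scale[OF R] 1 2)
  then have 0: "F0 * h \<in> rad I" by (simp add: algebra_simps)
  \<comment> \<open>The ideal of \<open>H\<close> contains \<open>I\<close>, and \<open>y1\<close>
    does not occur in \<open>H\<close>; so \<open>var y1\<close> cancels and a power of
    \<open>h\<close> lies in the ideal of \<open>H\<close>. As every element of \<open>H\<close>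
    multiplies \<open>h\<close> into \<open>rad I\<close>, so does that power.\<close>
  define H where "H = insert F0 (insert F1 (insert F2 G))"
  obtain N where "(var y1 * h) ^ N \<in> I" using h by (auto simp: rad_def)
  moreover have "I \<subseteq> ideal_of H"
    unfolding I_def
  proof (rule ideal_of_subset, rule insert_subsetI)
    show "var y1 * F1 + var y2 * F2 + F0 \<in> ideal_of H"
      by (intro ideal_gen.span_add ideal_gen.span_scale ideal_gen.span_base) (auto simp: H_def)
    show "G \<subseteq> ideal_of H" using ideal_gen.span_superset[of H] by (auto simp: H_def)
  qed
  ultimately have "var y1 ^ N * h ^ N \<in> ideal_of H" by (auto simp: power_mult_distrib)
  moreover have "regular_mod (ideal_of H) (var y1)"
    by (rule var_regular) (use G1 F F' in \<open>auto simp: H_def\<close>)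
  ultimately have "h ^ N \<in> ideal_of H" using regular_mod_power by blast
  then have "h ^ N * h \<in> rad I"
  proof (induction rule: ideal_gen.span_induct_alt)
    case base
    then show ?case using ideal_gen.subspace_0[OF R] by simp
  next
    case (step c x y)
    have "x * h \<in> rad I"
    proof (cases "x \<in> G")
      case True
      then have "x \<in> I" unfolding I_def by (intro ideal_gen.span_base) simp
      from ideal_gen.subspace_scale[OF I this, of h] show ?thesis
        using subset_rad by (auto simp: mult.commute)
    qed (use step 0 1 2 in \<open>auto simp: H_def\<close>)
    from ideal_gen.subspace_scale[OF R this, of c] step(2)
    show ?case by (simp add: distrib_right mult.assoc ideal_gen.subspace_add[OF R])
  qed
  then have "h ^ Suc N \<in> rad I" by (simp add: mult.commute)
  then show ?thesis by (rule power_in_rad)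
qed

text \<open>Eigenvectors of a pencil: if \<open>y2 - c y1\<close> kills \<open>h c\<close> modulo a radical ideal for more values
  of \<open>c\<close> than the dimension of a space containing all \<open>h c\<close>, then some \<open>h c\<close> is a combination of
  the others, and multiplying this relation by \<open>y1 h c\<close> shows that \<open>y1\<close> kills \<open>h c\<close>.\<close>

lemma pencil_eigenvector:
  fixes h :: "'k::field \<Rightarrow> 'k xpoly"
  assumes R: "is_ideal R" and Rpow: "\<And>p N. p ^ N \<in> R \<Longrightarrow> p \<in> R"
    and ann: "\<And>c. c \<in> C \<Longrightarrow> (var y2 - con c * var y1) * h c \<in> R"
    and M: "finite M" "finite C" "card C > card M" "\<And>c. c \<in> C \<Longrightarrow> h c \<in> kspan M"
  shows "\<exists>c\<in>C. var y1 * h c \<in> R \<and> var y2 * h c \<in> R"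
proof -
  obtain c0 where c0: "c0 \<in> C" "h c0 \<in> kspan (h ` (C - {c0}))"
    using dependent_family[OF M(1-3), of h] M(4) by auto
  have gen: "var y1 * x * h c0 \<in> R" if "x \<in> h ` (C - {c0})" for x
  proof -
    obtain c where c: "c \<in> C" "c \<noteq> c0" "x = h c" using \<open>x \<in> _\<close> by blast
    \<comment> \<open>Multiplying each of the two annihilation relations by the other eigenvector
      and subtracting cancels \<open>var y2\<close>.\<close>
    have "con (inverse (c - c0)) * (h c * ((var y2 - con c0 * var y1) * h c0) -
        h c0 * ((var y2 - con c * var y1) * h c)) \<in> R"
      by (rule ideal_gen.subspace_scale[OF R], rule ideal_gen.subspace_diff[OF R])
        (rule ideal_gen.subspace_scale[OF R], rule ann, fact)+
    moreover have "h c * ((var y2 - con c0 * var y1) * h c0) - h c0 * ((var y2 - con c * var y1) * h c)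
        = con (c - c0) * (var y1 * x * h c0)"
      using con_add[of "c - c0" c0] c(3) by (simp add: algebra_simps)
    ultimately show ?thesis using c(2) by (simp add: mult.assoc[symmetric] flip: con_mult)
  qed
  have "var y1 * x * h c0 \<in> R" if "x \<in> kspan (h ` (C - {c0}))" for x
    using that
  proof (induction rule: kvs.span_induct_alt)
    case base
    then show ?case using ideal_gen.subspace_0[OF R] by simp
  next
    case (step c x y)
    have "con c * (var y1 * x * h c0) + var y1 * y * h c0 \<in> R"
      by (intro ideal_gen.subspace_add[OF R] ideal_gen.subspace_scale[OF R] gen step)
    then show ?case by (simp add: algebra_simps)
  qed
  from this[OF c0(2)] have "var y1 * (var y1 * h c0 * h c0) \<in> R"
    by (rule ideal_gen.subspace_scale[OF R])
  then have "(var y1 * h c0) ^ 2 \<in> R" by (simp add: power2_eq_square mult_ac)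
  then have 1: "var y1 * h c0 \<in> R" by (rule Rpow)
  have "(var y2 - con c0 * var y1) * h c0 + con c0 * (var y1 * h c0) \<in> R"
    by (intro ideal_gen.subspace_add[OF R] ideal_gen.subspace_scale[OF R 1] ann c0(1))
  then have "var y2 * h c0 \<in> R" by (simp add: algebra_simps)
  with 1 c0(1) show ?thesis by blast
qed

text \<open>Specialising \<open>y2\<close> to c times \<open>y1\<close> shows that a nilpotent
  \<open>h\<close> has a cofactor q_c for every scalar c. After truncation to one degree and
  finitely many variables, all q_c lie in a fixed finite-dimensional space, so
  \<open>pencil_eigenvector\<close> finds a c for which \<open>var y1\<close> and
  \<open>var y2\<close> both multiply q_c into the radical;
  \<open>two_variables_regular_mod_rad\<close> then puts q_c itself there.\<close>

lemma radical_of_specializations: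
  fixes G :: "'k::field xpoly set"
  assumes infK: "infinite (UNIV :: 'k set)" and finG: "finite G"
    and homG: "\<And>g. g \<in> G \<Longrightarrow> \<exists>t. homog t g"
    and G: "G \<subseteq> vars_in (- {y1, y2})" and y: "y1 \<noteq> y2"
    and F: "F0 \<in> vars_in (- {y1, y2})" "F1 \<in> vars_in (- {y1, y2})" "F2 \<in> vars_in (- {y1, y2})"
    and radG: "radical_set (ideal_of G)"
    and homF: "homog t (var y1 * F1 + var y2 * F2 + F0)"
    and spec: "\<And>c. radical_set (ideal_of (insert (var y1 * (F1 + con c * F2) + F0) G))"
  shows "radical_set (ideal_of (insert (var y1 * F1 + var y2 * F2 + F0) G))"
proof (rule radical_set_homogeneousI)
  define F where "F = var y1 * F1 + var y2 * F2 + F0"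
  define I where "I = ideal_of (insert F G)"
  have I: "is_ideal I" by (simp add: I_def)
  note R = is_ideal_rad[OF I]
  show homI: "\<exists>t. homog t g" if "g \<in> insert F G" for g
    using that homF homG by (auto simp: F_def)
  obtain X where X: "finite X" "insert (var y1) (insert (var y2) (insert F G)) \<subseteq> vars_in X"
  proof -
    define v where "v p = (\<Union>m\<in>Poly_Mapping.keys p. Poly_Mapping.keys m)" for p :: "'k xpoly"
    have v: "p \<in> vars_in (v p)" "finite (v p)" for p by (auto simp: v_def vars_in_def)
    define S where "S = insert (var y1) (insert (var y2) (insert F G))"
    have "finite (\<Union>p\<in>S. v p)" using finG v by (auto simp: S_def)
    moreover have "S \<subseteq> vars_in (\<Union>p\<in>S. v p)"
    proof
      fix p assume "p \<in> S"
      then have "v p \<subseteq> (\<Union>p\<in>S. v p)" by blast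
      with v(1) show "p \<in> vars_in (\<Union>p\<in>S. v p)" by (rule vars_in_mono)
    qed
    ultimately show thesis by (rule that[folded S_def])
  qed
  have quotient: "\<exists>q. h - (var y2 - con c * var y1) * q \<in> I" if h: "h \<in> rad I" for h c
  proof -
    define l where "l = var y2 - con c * var y1"
    define \<sigma> where "\<sigma> = subst_vars (\<lambda>x. if x = y2 then con c * var y1 else var x)"
    obtain N where N: "h ^ N \<in> I" using h by (auto simp: rad_def)
    have \<sigma>_id: "\<sigma> p = p" if "p \<in> vars_in (- {y1, y2})" for p
      unfolding \<sigma>_def by (rule subst_vars_id[OF that]) auto
    have \<sigma>F: "\<sigma> F = var y1 * (F1 + con c * F2) + F0"
      using \<sigma>_id[OF assms(6)] \<sigma>_id[OF assms(7)] \<sigma>_id[OF assms(8)] y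
      unfolding F_def \<sigma>_def by (simp add: subst_simps algebra_simps)
    have "\<sigma> (h ^ N) \<in> ideal_of (insert (\<sigma> F) G)"
    proof (rule ring_morph_ideal_of[OF _ N[unfolded I_def]])
      show "ring_morph \<sigma>" unfolding \<sigma>_def by (rule ring_morph_subst)
      show "\<sigma> g \<in> ideal_of (insert (\<sigma> F) G)" if "g \<in> insert F G" for g
        using that \<sigma>_id G by (auto intro!: ideal_gen.span_base)
    qed
    then have "\<sigma> h ^ N \<in> ideal_of (insert (\<sigma> F) G)" by (simp add: \<sigma>_def subst_simps)
    then have \<sigma>h: "\<sigma> h \<in> ideal_of (insert (\<sigma> F) G)"
      using spec[of c] unfolding \<sigma>F by (rule radD[rotated])
    have mod_l: "\<sigma> p - p \<in> ideal_of {l}" for p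
      unfolding \<sigma>_def
    proof (rule subst_vars_cong_mod)
      show "(if x = y2 then con c * var y1 else var x) - var x \<in> ideal_of {l}" for x
        using ideal_gen.span_neg[OF ideal_gen.span_base[of l "{l}"]]
        by (auto simp: l_def ideal_gen.span_zero)
    qed simp
    have le: "ideal_of {l} \<subseteq> ideal_of (insert l (insert F G))"
      by (rule ideal_gen.span_mono) auto
    have "\<sigma> F \<in> ideal_of (insert l (insert F G))"
      using ideal_of_cong[of "\<sigma> F" F "insert l (insert F G)"] mod_l le
        ideal_gen.span_base[of F "insert l (insert F G)"] by blast
    then have "ideal_of (insert (\<sigma> F) G) \<subseteq> ideal_of (insert l (insert F G))"
      by (intro ideal_of_subset) (auto intro: ideal_gen.span_base)
    with \<sigma>h have "\<sigma> h \<in> ideal_of (insert l (insert F G))" by blast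
    then have "h \<in> ideal_of (insert l (insert F G))"
      using ideal_of_cong[of "\<sigma> h" h "insert l (insert F G)"] mod_l le by blast
    then show ?thesis by (auto simp: ideal_of_insert_iff I_def l_def mult.commute)
  qed
  have "h \<in> I" if "homog s h" "h \<in> rad I" for s h
    using that
  proof (induction s arbitrary: h rule: less_induct)
    case (less s)
    obtain Y where Y: "finite Y" "h \<in> vars_in Y" by (rule finite_vars)
    \<comment> \<open>\<open>\<kappa>\<close> fixes \<open>h\<close> and the generators and confines
      the cofactors to finitely many variables.\<close>
    define \<kappa> :: "'k xpoly \<Rightarrow> 'k xpoly" where "\<kappa> = subst_vars (\<lambda>x. if x \<in> X \<union> Y then var x else 0)"
    have \<kappa>: "ring_morph \<kappa>" unfolding \<kappa>_def by (rule ring_morph_subst)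
    have \<kappa>_in: "\<kappa> p \<in> vars_in (X \<union> Y)" for p
      unfolding \<kappa>_def by (rule subst_vars_in[OF vars_in_UNIV]) auto
    have \<kappa>_id: "\<kappa> p = p" if "p \<in> vars_in (X \<union> Y)" for p
      unfolding \<kappa>_def by (rule subst_vars_id[OF that]) auto
    have \<kappa>_I: "\<kappa> p \<in> I" if "p \<in> I" for p
      unfolding I_def
    proof (rule ring_morph_ideal_of[OF \<kappa> that[unfolded I_def]])
      fix g assume g: "g \<in> insert F G"
      then have "g \<in> vars_in (X \<union> Y)" using X(2) by (blast intro: vars_in_mono)
      with g show "\<kappa> g \<in> ideal_of (insert F G)" by (simp add: \<kappa>_id ideal_gen.span_base)
    qed
    \<comment> \<open>A multiple of a linear form has no component of degree 0, so for
      \<open>s = 0\<close> already \<open>h \<in> I\<close>; otherwise \<open>s - 1\<close> is a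
      genuine subtraction.\<close>
    have "\<exists>q. homog (s - 1) q \<and> q \<in> vars_in (X \<union> Y) \<and> 
        (if s = 0 then h \<in> I else h - (var y2 - con c * var y1) * q \<in> I)" for c
    proof -
      obtain q where q: "h - (var y2 - con c * var y1) * q \<in> I" using quotient[OF less.prems(2)] ..
      have l: "\<kappa> (var y2 - con c * var y1) = var y2 - con c * var y1"
        using X(2) by (intro \<kappa>_id vars_in_intros) (auto simp: subset_iff intro: vars_in_mono)
      have hl: "homog 1 (var y2 - con c * var y1)"
        using homog_mult[OF homog_con homog_var, of c y1] by (intro homog_diff homog_var) simp
      have "\<kappa> (h - (var y2 - con c * var y1) * q) = h - (var y2 - con c * var y1) * \<kappa> q"
        using l \<kappa>_id[of h] Y(2) vars_in_mono[of h Y "X \<union> Y"]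
        by (simp add: ring_morph_simps[OF \<kappa>])
      with \<kappa>_I[OF q] have "h - (var y2 - con c * var y1) * \<kappa> q \<in> ideal_of (insert F G)"
        by (simp add: I_def)
      from component_ideal_of[OF homI this, of s]
      have "h - component s ((var y2 - con c * var y1) * \<kappa> q) \<in> I"
        using component_of_homog[OF less.prems(1), of s] by (simp add: component_diff I_def)
      then have "if s = 0 then h \<in> I
          else h - (var y2 - con c * var y1) * component (s - 1) (\<kappa> q) \<in> I"
        unfolding component_homog_mult[OF hl] by (auto split: if_splits)
      with homog_component[of "s - 1" "\<kappa> q"] component_vars_in[OF \<kappa>_in] show ?thesis by blast
    qed
    then obtain q where q: "\<And>c. homog (s - 1) (q c)" "\<And>c. q c \<in> vars_in (X \<union> Y)"
      "\<And>c. if s = 0 then h \<in> I else h - (var y2 - con c * var y1) * q c \<in> I"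
      by metis
    show ?case
    proof (cases "s = 0")
      case True
      with q(3) show ?thesis by simp
    next
      case False
      define M :: "'k xpoly set" where "M = box_monomials (X \<union> Y) (s - 1)"
      obtain C :: "'k set" where C: "finite C" "card C = Suc (card M)"
        using infinite_arbitrarily_large[OF infK] by blast
      have ann: "(var y2 - con c * var y1) * q c \<in> rad I" for c
        using in_ideal_cong[OF R, of h] q(3)[of c] less.prems(2) False subset_rad[of I] by auto
      have "\<exists>c\<in>C. var y1 * q c \<in> rad I \<and> var y2 * q c \<in> rad I"
      proof (rule pencil_eigenvector[OF R _ ann])
        show "q c \<in> kspan M" for c
          unfolding M_def using X(1) Y(1) q(1,2) by (intro in_box_subset_kspan homog_in_box) auto
        show "finite M" using X(1) Y(1) by (simp add: M_def finite_box_monomials)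
      qed (use C power_in_rad in auto)
      then obtain c where c: "var y1 * q c \<in> rad I" "var y2 * q c \<in> rad I" by blast
      have "q c \<in> rad I"
        by (rule two_variables_regular_mod_rad[OF G y assms(6-8) radG _ c]) (simp add: I_def F_def)
      then have "q c \<in> I" using less.IH[of "s - 1"] q(1) False by simp
      then have "(var y2 - con c * var y1) * q c \<in> I" by (rule ideal_gen.subspace_scale[OF I])
      then show ?thesis using in_ideal_cong[OF I] q(3)[of c] False by simp
    qed
  qed
  then show "h \<in> ideal_of (insert F G)" if "homog s h" "h \<in> rad (ideal_of (insert F G))" for s h
    using that by (simp add: I_def)
qed

section \<open>Multilinear polynomials on forests\<close>

text \<open>\<open>multilin X e p\<close>: every monomial of \<open>p\<close> contains, for each \<open>i \<in> e\<close>, exactly one variable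
  with first index \<open>i\<close>, to the first power, and no others; only variables from \<open>X\<close> occur.\<close>

inductive multilin :: "(nat \<times> nat) set \<Rightarrow> nat set \<Rightarrow> 'k::field xpoly \<Rightarrow> bool" for X where
  con: "multilin X {} (con c)"
| zero: "multilin X e 0"
| add: "multilin X e p \<Longrightarrow> multilin X e q \<Longrightarrow> multilin X e (p + q)"
| var: "multilin X e p \<Longrightarrow> u \<notin> e \<Longrightarrow> (u, k) \<in> X \<Longrightarrow> multilin X (insert u e) (var (u, k) * p)"

lemma multilin_mono: "multilin X e p \<Longrightarrow> X \<inter> e \<times> UNIV \<subseteq> Y \<Longrightarrow> multilin Y e p"
  by (induction rule: multilin.induct) (auto intro: multilin.intros)

lemma multilin_vars_in: "multilin X e p \<Longrightarrow> p \<in> vars_in (X \<inter> e \<times> UNIV)"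
proof (induction rule: multilin.induct)
  case (var e p u k)
  then show ?case by (intro vars_in_mult) (auto elim: vars_in_mono)
qed (auto intro: vars_in_add)

lemma multilin_scale: "multilin X e p \<Longrightarrow> multilin X e (con c * p)"
proof (induction rule: multilin.induct)
  case (con c')
  show ?case using multilin.con[of X "c * c'"] by (simp add: con_mult)
next
  case (add e p q)
  then show ?case by (simp add: distrib_left multilin.add)
next
  case (var e p u k)
  then show ?case using multilin.var[of X e "con c * p" u k] by (simp add: mult_ac)
qed (simp add: multilin.zero)

lemma multilin_uminus: "multilin X e p \<Longrightarrow> multilin X e (- p)"
  using multilin_scale[of X e p "-1"] by (simp add: con_def single_uminus)

lemma multilin_mult:
  "multilin X e p \<Longrightarrow> multilin X e' q \<Longrightarrow> e \<inter> e' = {} \<Longrightarrow> multilin X (e \<union> e') (p * q)"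
proof (induction rule: multilin.induct)
  case (con c)
  then show ?case by (simp add: multilin_scale)
next
  case (add e p q)
  then show ?case by (simp add: distrib_right multilin.add)
next
  case (var e p u k)
  then show ?case using multilin.var[of X "e \<union> e'" "p * q" u k] by (simp add: mult_ac)
qed (simp add: multilin.zero)

lemma multilin_sum: "(\<And>i. i \<in> I \<Longrightarrow> multilin X e (f i)) \<Longrightarrow> multilin X e (\<Sum>i\<in>I. f i)"
  by (induction I rule: infinite_finite_induct) (auto intro: multilin.intros)

lemma homog_multilin: "multilin X e p \<Longrightarrow> finite e \<Longrightarrow> homog (card e) p"
proof (induction rule: multilin.induct)
  case (var e p u k)
  then show ?case using homog_mult[OF homog_var, of "card e" p "(u, k)"] by simp
qed (auto intro: homog_con homog_add)

text \<open>A variable of the vertex \<open>u\<close> must be replaced by a linear form at the same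
  \<open>u\<close>, so that each monomial keeps exactly one variable per vertex.\<close>

lemma multilin_subst:
  assumes "multilin X e p" "\<And>u k. u \<in> e \<Longrightarrow> (u, k) \<in> X \<Longrightarrow> multilin Y {u} (s (u, k))"
  shows "multilin Y e (subst_vars s p)"
  using assms
proof (induction rule: multilin.induct)
  case (var e p u k)
  have "multilin Y ({u} \<union> e) (s (u, k) * subst_vars s p)"
    using var by (intro multilin_mult) auto
  then show ?case by (simp add: subst_simps)
qed (auto simp: subst_simps intro: multilin.intros)

lemma multilin_split:
  assumes "multilin X e p" "u \<in> e"
  obtains a b where "p = var (u, k) * a + b" "multilin X (e - {u}) a"
    "multilin (X - {(u, k)}) e b"
proof -
  have "\<exists>a b. p = var (u, k) * a + b \<and> multilin X (e - {u}) a \<and> multilin (X - {(u, k)}) e b"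
    using assms
  proof (induction rule: multilin.induct)
    case (zero e)
    show ?case by (intro exI[of _ 0]) (simp add: multilin.zero)
  next
    case (add e p q)
    then obtain a b a' b' where "p = var (u, k) * a + b" "multilin X (e - {u}) a"
      "multilin (X - {(u, k)}) e b" "q = var (u, k) * a' + b'" "multilin X (e - {u}) a'"
      "multilin (X - {(u, k)}) e b'" by blast
    then show ?case
      by (intro exI[of _ "a + a'"] exI[of _ "b + b'"]) (simp add: multilin.add algebra_simps)
  next
    case (var e p v l)
    show ?case
    proof (cases "v = u")
      case True
      with var have e: "insert v e - {u} = e" "u \<notin> e" by auto
      have p: "multilin (X - {(u, k)}) e p" by (rule multilin_mono[OF var(1)]) (use e(2) in auto)
      show ?thesis
      proof (cases "l = k")
        case True
        then show ?thesis using \<open>v = u\<close> var(1) e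
          by (intro exI[of _ p] exI[of _ 0]) (simp add: multilin.zero)
      next
        case False
        then show ?thesis using \<open>v = u\<close> var e multilin.var[OF p, of v l]
          by (intro exI[of _ 0] exI[of _ "var (v, l) * p"]) (simp add: multilin.zero)
      qed
    next
      case False
      with var obtain a b where ab: "p = var (u, k) * a + b" "multilin X (e - {u}) a"
        "multilin (X - {(u, k)}) e b" by auto
      have "insert v e - {u} = insert v (e - {u})" using False by auto
      then show ?thesis
        using ab False var multilin.var[OF ab(2), of v l] multilin.var[OF ab(3), of v l]
        by (intro exI[of _ "var (v, l) * a"] exI[of _ "var (v, l) * b"]) (simp add: algebra_simps)
    qed
  qed auto
  then show thesis using that by blast
qed

lemma multilin_no_vars:
  assumes "multilin X e p" "u \<in> e" "\<And>k. (u, k) \<notin> X"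
  shows "p = 0"
  using assms by (induction rule: multilin.induct) auto

lemma multilin_empty: "multilin X e p \<Longrightarrow> e = {} \<Longrightarrow> \<exists>c. p = con c"
proof (induction rule: multilin.induct)
  case (add e p q)
  then show ?case by (metis con_add)
qed (auto intro: exI[of _ 0])

text \<open>Provides the pivot variable for solving \<open>l = 0\<close>.\<close>

lemma multilin_linear:
  assumes "finite X" "multilin X {v} l" "l \<noteq> 0"
  shows "\<exists>k c l'. l = con c * var (v, k) + l' \<and> c \<noteq> 0 \<and> multilin (X - {(v, k)}) {v} l'"
  using assms
proof (induction "card X" arbitrary: X rule: less_induct)
  case less
  from less.prems(2,3) obtain k where k: "(v, k) \<in> X" using multilin_no_vars[of X "{v}" l v] by blast
  obtain a b where ab: "l = var (v, k) * a + b" "multilin X {} a" "multilin (X - {(v, k)}) {v} b"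
    using multilin_split[OF less.prems(2), of v k] by auto
  obtain c where c: "a = con c" using multilin_empty[OF ab(2)] by blast
  show ?case
  proof (cases "c = 0")
    case True
    with ab c have "multilin (X - {(v, k)}) {v} l" by simp
    with less.hyps[of "X - {(v, k)}"] k less.prems(1,3) obtain k' c' l' where
      *: "l = con c' * var (v, k') + l'" "c' \<noteq> 0" "multilin (X - {(v, k)} - {(v, k')}) {v} l'"
      by (auto simp: card_Diff1_less simp del: card_Diff_insert)
    from *(3) have "multilin (X - {(v, k')}) {v} l'" by (rule multilin_mono) auto
    with * show ?thesis by blast
  next
    case False
    with ab c show ?thesis by (auto simp: mult.commute)
  qed
qed

text \<open>The value of \<open>h\<close> at \<open>y = 0\<close> lies in the ideal of
  \<open>G\<close>, so up to that ideal \<open>h\<close> is a multiple of \<open>var y\<close>.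
  Modulo \<open>insert a G\<close> the factor \<open>var y\<close> cancels and nilpotents vanish, so
  the cofactor is a multiple of \<open>a\<close> modulo \<open>G\<close>.\<close>

lemma radical_mult_var:
  fixes G :: "'k::field xpoly set"
  assumes G: "insert a G \<subseteq> vars_in (- {y})" and rad: "radical_set (ideal_of G)"
    "radical_set (ideal_of (insert a G))"
  shows "radical_set (ideal_of (insert (var y * a) G))"
  unfolding radical_set_def
proof (intro allI impI)
  fix h N assume N: "h ^ N \<in> ideal_of (insert (var y * a) G)"
  define \<sigma> :: "'k xpoly \<Rightarrow> 'k xpoly" where "\<sigma> = subst_vars (\<lambda>x. if x = y then 0 else var x)"
  have \<sigma>_id: "\<sigma> p = p" if "p \<in> vars_in (- {y})" for p
    unfolding \<sigma>_def by (rule subst_vars_id[OF that]) auto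
  have "\<sigma> (h ^ N) \<in> ideal_of G"
  proof (rule ring_morph_ideal_of[OF _ N])
    show "ring_morph \<sigma>" unfolding \<sigma>_def by (rule ring_morph_subst)
    show "\<sigma> g \<in> ideal_of G" if g: "g \<in> insert (var y * a) G" for g
    proof (cases "g = var y * a")
      case True
      then show ?thesis by (simp add: \<sigma>_def subst_simps ideal_gen.span_zero)
    next
      case False
      with g have "g \<in> G" by simp
      moreover from this have "\<sigma> g = g" using \<sigma>_id G by auto
      ultimately show ?thesis by (simp add: ideal_gen.span_base)
    qed
  qed
  then have \<sigma>h: "\<sigma> h \<in> ideal_of G"
    using radD[OF rad(1)] by (simp add: \<sigma>_def subst_simps)
  have "\<sigma> h - h \<in> ideal_of {var y}"
    unfolding \<sigma>_def
  proof (rule subst_vars_cong_mod)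
    show "(if x = y then 0 else var x) - var x \<in> ideal_of {var y}" for x
      using ideal_gen.span_neg[OF ideal_gen.span_base[of "var y" "{var y}"]]
      by (auto simp: ideal_gen.span_zero)
  qed simp
  then obtain q where q: "\<sigma> h - h = q * var y"
    by (auto simp: ideal_of_insert_iff)
  let ?I = "ideal_of (insert (var y * a) G)"
  have "\<sigma> h \<in> ?I" using \<sigma>h by (rule ideal_of_insertI)
  from power_diff_in_ideal[of ?I "\<sigma> h - h" "- h" N] this
  have "(\<sigma> h - h) ^ N - (- h) ^ N \<in> ?I" by simp
  moreover have "(- h) ^ N \<in> ?I"
    using ideal_gen.span_scale[OF N, of "(- 1) ^ N"] by (simp flip: power_mult_distrib)
  ultimately have "(q * var y) ^ N \<in> ?I"
    using ideal_of_cong[of "(\<sigma> h - h) ^ N" "(- h) ^ N"] q by simp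
  moreover have "?I \<subseteq> ideal_of (insert a G)"
    by (rule ideal_of_subset)
      (auto intro!: ideal_of_insert_self intro: ideal_gen.span_base)
  ultimately have "var y ^ N * q ^ N \<in> ideal_of (insert a G)"
    by (auto simp: power_mult_distrib mult.commute)
  then have "q ^ N \<in> ideal_of (insert a G)"
    by (rule regular_mod_power[OF var_regular[OF G]])
  then have "q \<in> ideal_of (insert a G)" by (rule radD[OF rad(2)])
  then obtain r where r: "q - r * a \<in> ideal_of G" by (auto simp: ideal_of_insert_iff)
  have "(q - r * a) * var y \<in> ?I" by (rule ideal_of_mult_right[OF ideal_of_insertI[OF r]])
  then have "q * var y - r * (var y * a) \<in> ?I" by (simp add: algebra_simps)
  from ideal_gen.span_add[OF this ideal_of_insert_self(1)[of r]] have "\<sigma> h - h \<in> ?I"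
    unfolding q by simp
  then show "h \<in> ?I" using \<open>\<sigma> h \<in> ?I\<close> ideal_of_cong by blast
qed

text \<open>\<open>U\<close> stands for the vertices that \<open>G\<close> does not touch,
  \<open>v\<close> for the shared vertex. At a vertex of \<open>U\<close>, two or more variables are
  reduced by specialisation, and a single one is split off as a factor. This ends with a constant or
  with a linear form at \<open>v\<close>, for which \<open>lin\<close> is assumed.\<close>

lemma radical_insert_multilin:
  fixes G :: "'k::field xpoly set"
  assumes infK: "infinite (UNIV :: 'k set)" and finG: "finite G"
    and homG: "\<And>g. g \<in> G \<Longrightarrow> \<exists>t. homog t g"
    and radG: "radical_set (ideal_of G)" and G: "G \<subseteq> vars_in ((- U) \<times> UNIV)"
    and lin: "\<And>X l. finite X \<Longrightarrow> multilin X {v} l \<Longrightarrow> radical_set (ideal_of (insert l G))"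
  shows "finite X \<Longrightarrow> finite e \<Longrightarrow> e - U \<subseteq> {v} \<Longrightarrow> multilin X e F \<Longrightarrow>
    radical_set (ideal_of (insert F G))"
proof (induction "card e + card X" arbitrary: e X F rule: less_induct)
  case less
  have F0: "radical_set (ideal_of (insert 0 G))"
    using radG by (simp add: ideal_of_insert_0)
  consider "e = {}" | "e = {v}" | u where "u \<in> e" "u \<noteq> v" by blast
  then show ?case
  proof cases
    case 1
    then obtain c where c: "F = con c" using multilin_empty[OF less.prems(4)] by blast
    show ?thesis
    proof (cases "c = 0")
      case True
      with c F0 show ?thesis by simp
    next
      case False
      then have "con (inverse c) * F = 1" by (simp add: c flip: con_mult)
      then have "1 \<in> ideal_of (insert F G)" using ideal_of_insert_self(1)[of "con (inverse c)" F G] by simp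
      then have "p \<in> ideal_of (insert F G)" for p using ideal_of_mult_right[of 1 _ p] by simp
      then show ?thesis by (simp add: radical_set_def)
    qed
  next
    case 2
    then show ?thesis using lin less.prems by blast
  next
    case 3
    then have u: "u \<in> U" "u \<in> e" using less.prems(3) by auto
    show ?thesis
    proof (cases "\<exists>k. (u, k) \<in> X")
      case False
      then have "F = 0" using multilin_no_vars[OF less.prems(4) u(2)] by blast
      with F0 show ?thesis by simp
    next
      case True
      then obtain k where k: "(u, k) \<in> X" by blast
      obtain a b where ab: "F = var (u, k) * a + b" "multilin X (e - {u}) a"
        "multilin (X - {(u, k)}) e b" using multilin_split[OF less.prems(4) u(2)] by blast
      have av: "a \<in> vars_in ((- {u}) \<times> UNIV)"
        by (rule vars_in_mono[OF multilin_vars_in[OF ab(2)]]) auto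
      have Gu: "G \<subseteq> vars_in ((- {u}) \<times> UNIV)" by (rule vars_in_Un_subset[OF G]) (use u in auto)
      have card_e: "card (e - {u}) < card e" using u less.prems(2) by (intro card_Diff1_less) auto
      show ?thesis
      proof (cases "\<exists>k'. (u, k') \<in> X - {(u, k)}")
        case False
        then have "b = 0" using multilin_no_vars[OF ab(3) u(2)] by blast
        moreover have "radical_set (ideal_of (insert (var (u, k) * a) G))"
        proof (rule radical_mult_var[OF _ radG])
          show "insert a G \<subseteq> vars_in (- {(u, k)})"
            using av Gu by (auto elim!: vars_in_mono)
          show "radical_set (ideal_of (insert a G))"
            using less.hyps[of "e - {u}" X a] card_e less.prems ab(2) by auto
        qed
        ultimately show ?thesis using ab(1) by simp
      next
        case True
        then obtain k' where k': "(u, k') \<in> X" "k' \<noteq> k" by blast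
        obtain a' b' where ab': "b = var (u, k') * a' + b'" "multilin (X - {(u, k)}) (e - {u}) a'"
          "multilin (X - {(u, k)} - {(u, k')}) e b'" using multilin_split[OF ab(3) u(2)] by blast
        have sub: "(- {u}) \<times> UNIV \<subseteq> - {(u, k), (u, k')}" by auto
        have av': "a' \<in> vars_in ((- {u}) \<times> UNIV)"
          by (rule vars_in_mono[OF multilin_vars_in[OF ab'(2)]]) auto
        have F: "F = var (u, k) * a + var (u, k') * a' + b'" using ab ab' by simp
        have "radical_set (ideal_of (insert (var (u, k) * a + var (u, k') * a' + b') G))"
        proof (rule radical_of_specializations[OF infK finG homG])
          show "G \<subseteq> vars_in (- {(u, k), (u, k')})" using vars_in_Un_subset[OF Gu sub] .
          show "a \<in> vars_in (- {(u, k), (u, k')})" "a' \<in> vars_in (- {(u, k), (u, k')})"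
            using av av' sub vars_in_mono by blast+
          show "b' \<in> vars_in (- {(u, k), (u, k')})"
            by (rule vars_in_mono[OF multilin_vars_in[OF ab'(3)]]) auto
          show "homog (card e) (var (u, k) * a + var (u, k') * a' + b')"
            using homog_multilin[OF less.prems(4,2)] F by simp
          fix c
          \<comment> \<open>Replacing \<open>(u, k')\<close> by a multiple of \<open>(u, k)\<close>
            removes it from \<open>X\<close>, which makes the induction measure drop.\<close>
          let ?X = "X - {(u, k')}"
          have "multilin ?X (e - {u}) a" "multilin ?X (e - {u}) a'"
            using multilin_mono[OF ab(2), of ?X] multilin_mono[OF ab'(2), of ?X] by auto
          then have "multilin ?X (insert u (e - {u})) (var (u, k) * (a + con c * a'))"
            using k k' by (intro multilin.intros multilin_scale) auto
          then have "multilin ?X e (var (u, k) * (a + con c * a'))"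
            using u by (simp add: insert_absorb)
          moreover have "multilin ?X e b'" by (rule multilin_mono[OF ab'(3)]) auto
          ultimately have "multilin ?X e (var (u, k) * (a + con c * a') + b')"
            by (rule multilin.add)
          moreover have "card ?X < card X" using k' less.prems(1) by (intro card_Diff1_less) auto
          ultimately show "radical_set (ideal_of (insert (var (u, k) * (a + con c * a') + b') G))"
            using less.hyps[of e ?X] less.prems by auto
        qed (use k' radG in auto)
        then show ?thesis using F by simp
      qed
    qed
  qed
qed

section \<open>Radicality of multilinear families on a forest\<close>

inductive forest_order :: "'v set list \<Rightarrow> bool" where
  Nil: "forest_order []"
| snoc: "forest_order es \<Longrightarrow> card (\<Union>(set es) \<inter> e) \<le> 1 \<Longrightarrow> finite e \<Longrightarrow> forest_order (es @ [e])"

text \<open>Since \<open>t\<close> is free of \<open>y\<close>, dividing by \<open>l\<close> gives a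
  polynomial ring without \<open>y\<close>, and \<open>\<tau>\<close> is the quotient map.\<close>

lemma radical_insert_linear:
  fixes G :: "'k::field xpoly set"
  assumes \<tau>: "\<tau> = subst_vars (\<lambda>x. if x = y then t else var x)"
    and l: "l = con c * (var y - t)" "c \<noteq> 0" and t: "t \<in> vars_in (- {y})"
    and rad: "radical_set (ideal_of (\<tau> ` G))"
  shows "radical_set (ideal_of (insert l G))"
  unfolding radical_set_def
proof (intro allI impI)
  fix p N assume N: "p ^ N \<in> ideal_of (insert l G)"
  have morph: "ring_morph \<tau>" unfolding \<tau> by (rule ring_morph_subst)
  have "\<tau> t = t" unfolding \<tau> by (rule subst_vars_id[OF t]) auto
  then have \<tau>l: "\<tau> l = 0" unfolding l by (simp add: \<tau> subst_simps)
  have "con (inverse c) * l = var y - t" using l(2) by (simp add: l(1) mult.assoc[symmetric] flip: con_mult)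
  then have yt: "var y - t \<in> ideal_of (insert l G)"
    using ideal_of_insert_self(1)[of "con (inverse c)" l G] by simp
  have cong: "\<tau> p - p \<in> ideal_of (insert l G)" for p
    unfolding \<tau>
  proof (rule subst_vars_cong_mod)
    show "(if x = y then t else var x) - var x \<in> ideal_of (insert l G)" for x
      using ideal_gen.span_neg[OF yt] by (auto simp: ideal_gen.span_zero)
  qed simp
  have "\<tau> (p ^ N) \<in> ideal_of (\<tau> ` G)"
    by (rule ring_morph_ideal_of[OF morph N])
      (auto simp: \<tau>l ideal_gen.span_zero intro: ideal_gen.span_base)
  then have "\<tau> p \<in> ideal_of (\<tau> ` G)" using radD[OF rad] by (simp add: ring_morph_power[OF morph])
  moreover have "\<tau> g \<in> ideal_of (insert l G)" if "g \<in> G" for g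
    using cong[of g] ideal_of_cong ideal_gen.span_base[of g "insert l G"] that by blast
  ultimately have "\<tau> p \<in> ideal_of (insert l G)" using ideal_of_subset[of "\<tau> ` G"] by blast
  then show "p \<in> ideal_of (insert l G)" using cong[of p] ideal_of_cong by blast
qed

text \<open>\<open>X\<close> and \<open>fs\<close> vary in the induction: dividing by a linear form
  at the shared vertex changes the earlier generators to others on the same edges, but in more
  variables.\<close>

theorem radical_multilin_forest:
  fixes fs :: "'k::field xpoly list"
  assumes infK: "infinite (UNIV :: 'k set)"
    and "forest_order es" "finite X" "list_all2 (multilin X) es fs"
  shows "radical_set (ideal_of (set fs))"
  using assms(2-)
proof (induction arbitrary: X fs rule: forest_order.induct)
  case Nil
  then show ?case by (simp add: radical_set_def)
next
  case (snoc es e)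
  from snoc.prems(2) obtain gs F where fs: "fs = gs @ [F]" and gs: "list_all2 (multilin X) es gs"
    and F: "multilin X e F" by (auto simp: list_all2_append1 list_all2_Cons1)
  define G where "G = set gs"
  have g: "\<exists>e\<in>set es. multilin X e g" if "g \<in> G" for g
    using gs that nth_mem by (fastforce simp: G_def list_all2_conv_all_nth in_set_conv_nth)
  have fin_es: "finite e" if "e \<in> set es" for e
    using snoc.hyps(1) that by (induction rule: forest_order.induct) auto
  obtain v where v: "e \<inter> \<Union>(set es) \<subseteq> {v}"
  proof -
    have "finite (e \<inter> \<Union>(set es))" using snoc.hyps by simp
    then have "e \<inter> \<Union>(set es) = {} \<or> (\<exists>v. e \<inter> \<Union>(set es) = {v})"
      using snoc.hyps(2) by (metis Int_commute One_nat_def card_1_singletonE card_eq_0_iff le_Suc_eq le_zero_eq)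
    then show thesis using that by blast
  qed
  have "radical_set (ideal_of (insert F G))"
  proof (rule radical_insert_multilin[OF infK, of G "- \<Union>(set es)" v X e F])
    show "finite G" by (simp add: G_def)
    show "\<exists>t. homog t h" if "h \<in> G" for h using g[OF that] homog_multilin fin_es by blast
    show "radical_set (ideal_of G)" using snoc.IH[OF snoc.prems(1) gs] by (simp add: G_def)
    show "G \<subseteq> vars_in ((- (- \<Union>(set es))) \<times> UNIV)"
    proof
      fix h assume "h \<in> G"
      then obtain e where "e \<in> set es" "multilin X e h" using g by blast
      from multilin_vars_in[OF this(2)] this(1) show "h \<in> vars_in ((- (- \<Union>(set es))) \<times> UNIV)"
        by (auto elim!: vars_in_mono)
    qed
    show "e - (- \<Union>(set es)) \<subseteq> {v}" using v by blast
    fix Y and l :: "'k xpoly" assume Y: "finite Y" "multilin Y {v} l"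
    show "radical_set (ideal_of (insert l G))"
    proof (cases "l = 0")
      case True
      then show ?thesis using \<open>radical_set (ideal_of G)\<close> by (simp add: ideal_of_insert_0)
    next
      case False
      from multilin_linear[OF Y this] obtain k c l' where
        l: "l = con c * var (v, k) + l'" "c \<noteq> 0" "multilin (Y - {(v, k)}) {v} l'" by blast
      \<comment> \<open>The solution of \<open>l = 0\<close> for the pivot variable
        \<open>(v, k)\<close>.\<close>
      define t where "t = - (con (inverse c) * l')"
      have t: "multilin (Y - {(v, k)}) {v} t"
        unfolding t_def by (intro multilin_uminus multilin_scale l)
      define \<tau> :: "'k xpoly \<Rightarrow> 'k xpoly" where "\<tau> = subst_vars (\<lambda>x. if x = (v, k) then t else var x)"
      show ?thesis
      proof (rule radical_insert_linear[OF \<tau>_def _ l(2)])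
        show "l = con c * (var (v, k) - t)"
          using l(2) by (simp add: l(1) t_def distrib_left mult.assoc[symmetric] flip: con_mult)
        show "t \<in> vars_in (- {(v, k)})"
          by (rule vars_in_mono[OF multilin_vars_in[OF t]]) auto
        have "multilin (X \<union> Y) e (\<tau> h)" if "multilin X e h" for e h
          unfolding \<tau>_def
        proof (rule multilin_subst[OF that])
          fix u j assume "u \<in> e" "(u, j) \<in> X"
          then show "multilin (X \<union> Y) {u} (if (u, j) = (v, k) then t else var (u, j))"
            using multilin_mono[OF t, of "X \<union> Y"] multilin.var[OF multilin.con[of "X \<union> Y" 1], of u j]
            by auto
        qed
        then have "list_all2 (multilin (X \<union> Y)) es (map \<tau> gs)"
          using gs by (auto simp: list_all2_map2 elim: list_all2_mono)
        from snoc.IH[OF _ this] snoc.prems(1) Y(1) show "radical_set (ideal_of (\<tau> ` G))"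
          by (simp add: G_def)
      qed
    qed
  qed (use snoc F in auto)
  then show ?case by (simp add: fs G_def)
qed

section \<open>Regular sequences from proper edge colourings\<close>

text \<open>The polynomial $f_e^{(d)}$ with the variables in \<open>Z\<close> set to zero.\<close>

definition edge_poly :: "nat \<Rightarrow> (nat \<times> nat) set \<Rightarrow> nat set \<Rightarrow> 'k::field xpoly" where
  "edge_poly d Z e = (\<Sum>j\<in>{1..d}. \<Prod>i\<in>e. if (i, j) \<in> Z then 0 else var (i, j))"

text \<open>Together with a colouring, this is all that the arguments on regularity and primality
  use of a forest.\<close>

inductive fresh_order :: "'v set list \<Rightarrow> bool" where
  Nil: "fresh_order []"
| snoc: "fresh_order es \<Longrightarrow> u \<in> e \<Longrightarrow> u \<notin> \<Union>(set es) \<Longrightarrow> finite e \<Longrightarrow> fresh_order (es @ [e])"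

text \<open>Colours are second indices: \<open>col e\<close> singles out, in the polynomial of
  \<open>e\<close>, the product of the variables \<open>(i, col e)\<close>. Properness says that the
  products singled out for different edges share no variable.\<close>

definition proper_colouring :: "nat \<Rightarrow> (nat set \<Rightarrow> nat) \<Rightarrow> nat set set \<Rightarrow> bool" where
  "proper_colouring d col E \<longleftrightarrow> (\<forall>e\<in>E. col e \<in> {1..d}) \<and>
     (\<forall>e\<in>E. \<forall>e'\<in>E. e \<noteq> e' \<longrightarrow> e \<inter> e' \<noteq> {} \<longrightarrow> col e \<noteq> col e')"

lemma proper_colouring_subset: "proper_colouring d col E \<Longrightarrow> E' \<subseteq> E \<Longrightarrow> proper_colouring d col E'"
  unfolding proper_colouring_def by blast

lemma proper_colouring_unused:
  assumes "proper_colouring d col (insert e E)" "e \<notin> E" "i \<in> e" "e' \<in> E" "i \<in> e'"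
  shows "col e' \<noteq> col e"
  using assms unfolding proper_colouring_def by (metis IntI empty_iff insertCI)

lemma edge_poly_vars_in: "edge_poly d Z e \<in> vars_in (e \<times> {1..d} - Z)"
  unfolding edge_poly_def by (intro vars_in_sum vars_in_prod) auto

lemma edge_poly_split:
  assumes e: "finite e" "u \<in> e" and c: "c \<in> {1..d}" "\<And>i. i \<in> e \<Longrightarrow> (i, c) \<notin> Z"
  obtains b where "edge_poly d Z e = var (u, c) * (\<Prod>i\<in>e - {u}. var (i, c)) + b"
    "b \<in> vars_in (- {(u, c)})"
proof
  let ?t = "\<lambda>j. \<Prod>i\<in>e. if (i, j) \<in> Z then 0 else (var (i, j) :: 'a xpoly)"
  have "?t c = (\<Prod>i\<in>e. var (i, c))" by (rule prod.cong) (use c in auto)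
  also have "\<dots> = var (u, c) * (\<Prod>i\<in>e - {u}. var (i, c))" using e by (simp add: prod.remove)
  finally show "edge_poly d Z e = var (u, c) * (\<Prod>i\<in>e - {u}. var (i, c)) + (\<Sum>j\<in>{1..d} - {c}. ?t j)"
    using c by (simp add: edge_poly_def sum.remove)
  show "(\<Sum>j\<in>{1..d} - {c}. ?t j) \<in> vars_in (- {(u, c)})"
    by (intro vars_in_sum vars_in_prod) auto
qed

lemma prod_vars_in: "(\<Prod>i\<in>e - {u}. var (i, c)) \<in> vars_in (- {(u, c)})"
  by (intro vars_in_prod) auto

lemma kill_var:
  fixes \<kappa> :: "'k::field xpoly \<Rightarrow> 'k xpoly" and x :: "nat \<times> nat"
  defines "\<kappa> \<equiv> subst_vars (\<lambda>y. if y = x then 0 else var y)"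
  shows "\<kappa> p - p \<in> ideal_of {var x}" "\<kappa> (edge_poly d Z e) = edge_poly d (insert x Z) e"
proof -
  show "\<kappa> p - p \<in> ideal_of {var x}"
    unfolding \<kappa>_def
  proof (rule subst_vars_cong_mod)
    show "(if y = x then 0 else var y) - var y \<in> ideal_of {var x}" for y
      using ideal_gen.span_neg[OF ideal_gen.span_base[of "var x" "{var x}"]]
      by (auto simp: ideal_gen.span_zero)
  qed simp
  show "\<kappa> (edge_poly d Z e) = edge_poly d (insert x Z) e"
    unfolding \<kappa>_def edge_poly_def subst_simps
    by (intro sum.cong prod.cong refl) (auto simp: subst_simps)
qed

text \<open>The ideal of \<open>es\<close> with further variables killed is of the same kind, which is why the
  statement is quantified over all \<open>Z\<close>.\<close>

definition unused_vars_regular :: "'k::field itself \<Rightarrow> nat \<Rightarrow> (nat set \<Rightarrow> nat) \<Rightarrow> nat set list \<Rightarrow> bool" where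
  "unused_vars_regular k d col es \<longleftrightarrow>
     (\<forall>Z v c. (\<forall>e\<in>set es. \<forall>i\<in>e. (i, col e) \<notin> Z) \<longrightarrow> (\<forall>e\<in>set es. v \<in> e \<longrightarrow> col e \<noteq> c) \<longrightarrow>
        (v, c) \<notin> Z \<longrightarrow> regular_mod (ideal_of (edge_poly d Z ` set es)) (var (v, c) :: 'k xpoly))"

lemma unused_vars_regularD:
  assumes "unused_vars_regular TYPE('k::field) d col es"
    and "\<And>e i. e \<in> set es \<Longrightarrow> i \<in> e \<Longrightarrow> (i, col e) \<notin> Z"
    and "\<And>e. e \<in> set es \<Longrightarrow> v \<in> e \<Longrightarrow> col e \<noteq> c" and "(v, c) \<notin> Z"
  shows "regular_mod (ideal_of (edge_poly d Z ` set es)) (var (v, c) :: 'k xpoly)"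
  using assms unfolding unused_vars_regular_def by blast

lemma fresh_order_edges: "fresh_order es \<Longrightarrow> e \<in> set es \<Longrightarrow> finite e \<and> e \<noteq> {}"
  by (induction rule: fresh_order.induct) auto

lemma edge_poly_regular:
  assumes N: "unused_vars_regular TYPE('k::field) d col es"
    and e: "finite e" "u \<in> e" "u \<notin> \<Union>(set es)"
    and col: "proper_colouring d col (insert e (set es))"
    and Z: "\<forall>e\<in>insert e (set es). \<forall>i\<in>e. (i, col e) \<notin> Z"
  shows "regular_mod (ideal_of (edge_poly d Z ` set es)) (edge_poly d Z e :: 'k xpoly)"
proof -
  let ?c = "col e"
  have c: "?c \<in> {1..d}" using col by (auto simp: proper_colouring_def)
  obtain b where b: "edge_poly d Z e = var (u, ?c) * (\<Prod>i\<in>e - {u}. var (i, ?c)) + (b :: 'k xpoly)"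
    "b \<in> vars_in (- {(u, ?c)})" using edge_poly_split[OF e(1,2) c, of Z] Z by blast
  have "edge_poly d Z ` set es \<subseteq> (vars_in (- {(u, ?c)}) :: 'k xpoly set)"
    using e(3) by (auto intro!: vars_in_mono[OF edge_poly_vars_in])
  moreover have "regular_mod (ideal_of (edge_poly d Z ` set es)) (\<Prod>i\<in>e - {u}. var (i, ?c) :: 'k xpoly)"
  proof (rule regular_mod_prod)
    fix i assume i: "i \<in> e - {u}"
    have "e \<notin> set es" using e by auto
    with i show "regular_mod (ideal_of (edge_poly d Z ` set es)) (var (i, ?c) :: 'k xpoly)"
      using Z proper_colouring_unused[OF col, of i] by (intro unused_vars_regularD[OF N]) auto
  qed
  ultimately show ?thesis unfolding b(1) by (intro linear_regular prod_vars_in b(2))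
qed

text \<open>An exchange argument: let \<open>x * p\<close> be congruent to \<open>q * F\<close>
  modulo \<open>G\<close>. Setting \<open>x\<close> to 0 leaves \<open>F\<close> regular modulo
  \<open>G\<close>, by the same statement for a larger \<open>Z\<close>, so \<open>q\<close> is
  congruent to a multiple \<open>r * x\<close>. Then \<open>x\<close> cancels from
  \<open>x * (p - r * F)\<close>.\<close>

lemma unused_vars_regular:
  assumes "fresh_order es" "proper_colouring d col (set es)"
  shows "unused_vars_regular TYPE('k::field) d col es"
  using assms
proof (induction rule: fresh_order.induct)
  case Nil
  show ?case using var_regular[of "{} :: 'k xpoly set"] by (simp add: unused_vars_regular_def)
next
  case (snoc es u e)
  have col: "proper_colouring d col (insert e (set es))" using snoc.prems by simp
  from snoc.IH proper_colouring_subset[OF col] have N: "unused_vars_regular TYPE('k) d col es" by auto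
  note reg = edge_poly_regular[OF N snoc.hyps(4,2,3) col]
  show ?case
    unfolding unused_vars_regular_def
  proof (intro allI impI)
    fix Z v c
    assume Z: "\<forall>e\<in>set (es @ [e]). \<forall>i\<in>e. (i, col e) \<notin> Z"
      and unused: "\<forall>e\<in>set (es @ [e]). v \<in> e \<longrightarrow> col e \<noteq> c" and vc: "(v, c) \<notin> Z"
    define x :: "'k xpoly" where "x = var (v, c)"
    define G :: "'k xpoly set" where "G = edge_poly d Z ` set es"
    define F :: "'k xpoly" where "F = edge_poly d Z e"
    define \<kappa> :: "'k xpoly \<Rightarrow> 'k xpoly" where "\<kappa> = subst_vars (\<lambda>y. if y = (v, c) then 0 else var y)"
    have morph: "ring_morph \<kappa>" unfolding \<kappa>_def by (rule ring_morph_subst)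
    have \<kappa>: "\<kappa> p - p \<in> ideal_of (insert x G)" for p
      using kill_var(1)[of "(v, c)" p] ideal_gen.span_mono[of "{x}" "insert x G"]
      by (auto simp: \<kappa>_def x_def)
    have \<kappa>_edge: "\<kappa> (edge_poly d Z e) = edge_poly d (insert (v, c) Z) e" for e
      unfolding \<kappa>_def by (rule kill_var(2))
    have regx: "regular_mod (ideal_of G) x"
      unfolding x_def G_def using Z unused vc by (intro unused_vars_regularD[OF N]) auto
    have regF: "regular_mod (ideal_of (\<kappa> ` G)) (\<kappa> F)"
      using reg[of "insert (v, c) Z"] Z unused by (auto simp: G_def F_def \<kappa>_edge image_image)
    have "regular_mod (ideal_of (insert F G)) x"
      unfolding regular_mod_def
    proof (intro allI impI)
      fix p assume "x * p \<in> ideal_of (insert F G)"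
      then obtain q where q: "x * p - q * F \<in> ideal_of G" by (auto simp: ideal_of_insert_iff)
      have "\<kappa> (x * p - q * F) \<in> ideal_of (\<kappa> ` G)"
        by (rule ring_morph_ideal_of[OF morph q]) (auto intro: ideal_gen.span_base)
      moreover have "\<kappa> x = 0" by (simp add: \<kappa>_def x_def subst_simps)
      ultimately have "- (\<kappa> F * \<kappa> q) \<in> ideal_of (\<kappa> ` G)"
        by (simp add: ring_morph_simps[OF morph] mult.commute)
      from ideal_gen.span_neg[OF this] have "\<kappa> q \<in> ideal_of (\<kappa> ` G)"
        using regular_modD[OF regF] by simp
      moreover have "\<kappa> ` G \<subseteq> ideal_of (insert x G)"
        using \<kappa> ideal_of_cong ideal_gen.span_base[of _ "insert x G"] by blast
      ultimately have "\<kappa> q \<in> ideal_of (insert x G)" using ideal_of_subset by blast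
      then have "q \<in> ideal_of (insert x G)" using ideal_of_cong \<kappa> by blast
      then obtain r where r: "q - r * x \<in> ideal_of G" by (auto simp: ideal_of_insert_iff)
      from ideal_gen.span_add[OF q ideal_of_mult_right[OF r, of F]]
      have "x * (p - r * F) \<in> ideal_of G" by (simp add: algebra_simps)
      then have "p - r * F \<in> ideal_of G" by (rule regular_modD[OF regx])
      then show "p \<in> ideal_of (insert F G)" by (auto simp: ideal_of_insert_iff)
    qed
    then show "regular_mod (ideal_of (edge_poly d Z ` set (es @ [e]))) (var (v, c) :: 'k xpoly)"
      by (simp add: F_def G_def x_def)
  qed
qed

text \<open>\<open>Y\<close> collects one variable \<open>(u, col e)\<close> per edge, where
  \<open>u\<close> is its fresh vertex. Eliminating them one by one leaves no relation among the
  others, so the quotient still has at least as many algebraically independent elements as there are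
  variables outside \<open>Y\<close>.\<close>

lemma edge_polys_independent_of_vars:
  assumes "fresh_order es" "proper_colouring d col (set es)"
  shows "\<exists>Y. finite Y \<and> card Y \<le> length es \<and> Y \<subseteq> \<Union>(set es) \<times> {1..d} \<and>
    (\<forall>p\<in>vars_in (- Y). p \<in> ideal_of (edge_poly d {} ` set es) \<longrightarrow> p = (0 :: 'k::field xpoly))"
  using assms
proof (induction rule: fresh_order.induct)
  case Nil
  then show ?case by (intro exI[of _ "{}"]) simp
next
  case (snoc es u e)
  have col: "proper_colouring d col (insert e (set es))" using snoc.prems by simp
  from proper_colouring_subset[OF col] have col': "proper_colouring d col (set es)" by auto
  obtain Y where Y: "finite Y" "card Y \<le> length es" "Y \<subseteq> \<Union>(set es) \<times> {1..d}"
    "\<forall>p\<in>vars_in (- Y). p \<in> ideal_of (edge_poly d {} ` set es) \<longrightarrow> p = (0 :: 'k xpoly)"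
    using snoc.IH[OF col'] by blast
  let ?c = "col e" and ?y = "(u, col e)"
  have c: "?c \<in> {1..d}" using col by (auto simp: proper_colouring_def)
  obtain b where b: "edge_poly d {} e = var ?y * (\<Prod>i\<in>e - {u}. var (i, ?c)) + (b :: 'k xpoly)"
    "b \<in> vars_in (- {?y})" using edge_poly_split[OF snoc.hyps(4,2) c, of "{}"] by blast
  have G: "edge_poly d {} ` set es \<subseteq> (vars_in (- {?y}) :: 'k xpoly set)"
    using snoc.hyps(3) by (auto intro!: vars_in_mono[OF edge_poly_vars_in])
  have reg: "regular_mod (ideal_of (edge_poly d {} ` set es)) (\<Prod>i\<in>e - {u}. var (i, ?c) :: 'k xpoly)"
  proof (rule regular_mod_prod)
    fix i assume i: "i \<in> e - {u}"
    have "e \<notin> set es" using snoc.hyps by auto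
    with i show "regular_mod (ideal_of (edge_poly d {} ` set es)) (var (i, ?c) :: 'k xpoly)"
      using proper_colouring_unused[OF col, of i]
      by (intro unused_vars_regularD[OF unused_vars_regular[OF snoc.hyps(1) col']]) auto
  qed
  have "p = 0" if p: "p \<in> vars_in (- insert ?y Y)" "p \<in> ideal_of (edge_poly d {} ` set (es @ [e]))"
    for p :: "'k xpoly"
  proof -
    have py: "p \<in> vars_in (- {?y})" by (rule vars_in_mono[OF p(1)]) auto
    have "p \<in> ideal_of (insert (var ?y * (\<Prod>i\<in>e - {u}. var (i, ?c)) + b) (edge_poly d {} ` set es))"
      using p(2) by (simp add: b(1))
    then obtain M where "(\<Prod>i\<in>e - {u}. var (i, ?c)) ^ M * p \<in> ideal_of (edge_poly d {} ` set es)"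
      using linear_elimination[OF G prod_vars_in b(2) py] by blast
    then have "p \<in> ideal_of (edge_poly d {} ` set es)" by (rule regular_mod_power[OF reg])
    moreover have "p \<in> vars_in (- Y)" by (rule vars_in_mono[OF p(1)]) auto
    ultimately show ?thesis using Y(4) by blast
  qed
  then show ?case
    using Y(1-3) snoc.hyps(2) c
    by (intro exI[of _ "insert ?y Y"]) (auto simp: card_insert_if)
qed

section \<open>Primality in the presence of a spare colour\<close>

definition prime_set :: "'a::comm_ring_1 set \<Rightarrow> bool" where
  "prime_set I \<longleftrightarrow> 1 \<notin> I \<and> (\<forall>p q. p * q \<in> I \<longrightarrow> p \<in> I \<or> q \<in> I)"

text \<open>All these polynomials vanish at the origin, as every edge has a vertex.\<close>

lemma one_notin_ideal_of_edge_polys: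
  assumes "\<And>e. e \<in> E \<Longrightarrow> finite e \<and> e \<noteq> {}"
  shows "1 \<notin> ideal_of (edge_poly d Z ` E :: 'k::field xpoly set)"
proof
  assume one: "1 \<in> ideal_of (edge_poly d Z ` E :: 'k xpoly set)"
  have *: "subst_vars (\<lambda>_. 0) (edge_poly d Z e) = (0 :: 'k xpoly)" if "e \<in> E" for e
    using assms[OF that]
    by (auto simp: edge_poly_def subst_simps if_distrib[of "subst_vars (\<lambda>_. 0)"] cong: if_cong)
  have "subst_vars (\<lambda>_. 0) (1 :: 'k xpoly) \<in> ideal_of {}"
    by (rule ring_morph_ideal_of[OF ring_morph_subst one]) (auto simp: *)
  then show False by (simp add: subst_simps)
qed

text \<open>Inverting \<open>a\<close> eliminates the variable \<open>(u, col e)\<close> and leaves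
  a localisation of the quotient by \<open>G\<close>, a domain by induction. Nothing is lost on the
  way because \<open>a\<close> is regular modulo \<open>insert F G\<close> too, and this is what the
  spare colour is for.\<close>

lemma prime_edge_polys:
  assumes "fresh_order es" "proper_colouring d col (set es)"
    and c0: "c0 \<in> {1..d}" "\<And>e. e \<in> set es \<Longrightarrow> col e \<noteq> c0"
  shows "prime_set (ideal_of (edge_poly d {} ` set es) :: 'k::field xpoly set)"
  using assms
proof (induction rule: fresh_order.induct)
  case Nil
  then show ?case by (simp add: prime_set_def)
next
  case (snoc es u e)
  have col: "proper_colouring d col (insert e (set es))" using snoc.prems by simp
  from proper_colouring_subset[OF col] have col': "proper_colouring d col (set es)" by auto
  define G :: "'k xpoly set" where "G = edge_poly d {} ` set es"
  define F :: "'k xpoly" where "F = edge_poly d {} e"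
  have prime: "prime_set (ideal_of G)" using snoc.IH[OF col'] snoc.prems by (simp add: G_def)
  have e: "e \<notin> set es" using snoc.hyps by auto
  have fresh: "fresh_order (es @ [e])" by (rule fresh_order.snoc) fact+
  let ?c = "col e" and ?y = "(u, col e)"
  define a :: "'k xpoly" where "a = (\<Prod>i\<in>e - {u}. var (i, ?c))"
  have c: "?c \<in> {1..d}" using col by (auto simp: proper_colouring_def)
  obtain b where b: "F = var ?y * a + b" "b \<in> vars_in (- {?y})"
    using edge_poly_split[OF snoc.hyps(4,2) c, of "{}"] by (auto simp: F_def a_def)
  have av: "a \<in> vars_in (- {?y})" unfolding a_def by (rule prod_vars_in)
  have Gv: "G \<subseteq> vars_in (- {?y})"
    using snoc.hyps(3) by (auto simp: G_def intro!: vars_in_mono[OF edge_poly_vars_in])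
  have reg: "regular_mod (ideal_of G) a"
    unfolding a_def
  proof (rule regular_mod_prod)
    fix i assume i: "i \<in> e - {u}"
    then show "regular_mod (ideal_of G) (var (i, ?c) :: 'k xpoly)"
      unfolding G_def using proper_colouring_unused[OF col e, of i]
      by (intro unused_vars_regularD[OF unused_vars_regular[OF snoc.hyps(1) col']]) auto
  qed
  have regF: "regular_mod (ideal_of (insert F G)) a"
    unfolding a_def
  proof (rule regular_mod_prod)
    fix i assume i: "i \<in> e - {u}"
    \<comment> \<open>Recolouring \<open>e\<close> with the spare colour makes \<open>col e\<close> unused at \<open>i\<close>.\<close>
    let ?col = "col(e := c0)"
    have ne: "?col e \<noteq> ?col e'" if "e' \<in> set es" for e'
      using that e snoc.prems(3)[of e'] by auto
    have "proper_colouring d ?col (set (es @ [e]))"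
      unfolding proper_colouring_def
    proof (intro conjI ballI impI)
      show "?col e' \<in> {1..d}" if "e' \<in> set (es @ [e])" for e'
        using that col c0(1) by (auto simp: proper_colouring_def)
      show "?col e1 \<noteq> ?col e2"
        if "e1 \<in> set (es @ [e])" "e2 \<in> set (es @ [e])" "e1 \<noteq> e2" "e1 \<inter> e2 \<noteq> {}" for e1 e2
      proof (cases "e1 = e \<or> e2 = e")
        case True
        then show ?thesis using ne[of e1] ne[of e2] that by auto
      next
        case False
        then show ?thesis using that col unfolding proper_colouring_def by auto
      qed
    qed
    note N = unused_vars_regular[OF fresh this]
    have "regular_mod (ideal_of (edge_poly d {} ` set (es @ [e]))) (var (i, ?c) :: 'k xpoly)"
      using i snoc.prems(3)[of e] proper_colouring_unused[OF col e, of i] e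
      by (intro unused_vars_regularD[OF N]) auto
    then show "regular_mod (ideal_of (insert F G)) (var (i, ?c))" by (simp add: F_def G_def)
  qed
  have elim: "p \<in> ideal_of G" if "p \<in> vars_in (- {?y})" "p \<in> ideal_of (insert F G)" for p
    using linear_elimination[OF Gv av b(2) that(1)] that(2) regular_mod_power[OF reg]
    unfolding b(1) by blast
  have "p \<in> ideal_of (insert F G) \<or> q \<in> ideal_of (insert F G)"
    if pq: "p * q \<in> ideal_of (insert F G)" for p q
  proof -
    have sub: "ideal_of {F} \<subseteq> ideal_of (insert F G)" by (rule ideal_gen.span_mono) auto
    obtain N p' where p': "p' \<in> vars_in (- {?y})" "a ^ N * p - p' \<in> ideal_of (insert F G)"
      using pseudo_division[OF av b(2), of p] sub b(1) by auto
    obtain M q' where q': "q' \<in> vars_in (- {?y})" "a ^ M * q - q' \<in> ideal_of (insert F G)"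
      using pseudo_division[OF av b(2), of q] sub b(1) by auto
    have "a ^ M * q * (a ^ N * p - p') + p' * (a ^ M * q - q') \<in> ideal_of (insert F G)"
      by (intro ideal_gen.span_add ideal_gen.span_scale p' q')
    then have "a ^ N * a ^ M * (p * q) - p' * q' \<in> ideal_of (insert F G)" by (simp add: algebra_simps)
    with ideal_gen.span_scale[OF pq] have "p' * q' \<in> ideal_of (insert F G)"
      using ideal_of_cong by blast
    then have "p' * q' \<in> ideal_of G" using elim vars_in_mult[OF p'(1) q'(1)] by blast
    then have "p' \<in> ideal_of G \<or> q' \<in> ideal_of G" using prime by (auto simp: prime_set_def)
    then have "p' \<in> ideal_of (insert F G) \<or> q' \<in> ideal_of (insert F G)"
      using ideal_of_insertI by blast
    then have "a ^ N * p \<in> ideal_of (insert F G) \<or> a ^ M * q \<in> ideal_of (insert F G)"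
      using ideal_of_cong p'(2) q'(2) by blast
    then show ?thesis using regular_mod_power[OF regF] by blast
  qed
  moreover have "1 \<notin> ideal_of (insert F G)"
    using one_notin_ideal_of_edge_polys[of "set (es @ [e])" d "{}", OF fresh_order_edges[OF fresh]] by (simp add: F_def G_def)
  ultimately show ?case by (simp add: prime_set_def F_def G_def)
qed

section \<open>Chains of primes in a subring\<close>

text \<open>Chains of primes have to be formed in the ring of finitely many variables, which is a
  proper subset of the type; hence notions relative to a subring \<open>A\<close>.\<close>

definition subring_set :: "'a::comm_ring_1 set \<Rightarrow> bool" where
  "subring_set A \<longleftrightarrow> 1 \<in> A \<and> (\<forall>x\<in>A. \<forall>y\<in>A. x - y \<in> A \<and> x * y \<in> A)"

lemma
  assumes "subring_set A"
  shows subring_set_1: "1 \<in> A" and subring_set_0: "0 \<in> A"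
    and subring_set_add: "x \<in> A \<Longrightarrow> y \<in> A \<Longrightarrow> x + y \<in> A"
    and subring_set_mult: "x \<in> A \<Longrightarrow> y \<in> A \<Longrightarrow> x * y \<in> A"
    and subring_set_power: "x \<in> A \<Longrightarrow> x ^ k \<in> A"
proof -
  have d: "\<And>x y. x \<in> A \<Longrightarrow> y \<in> A \<Longrightarrow> x - y \<in> A"
    using assms by (auto simp: subring_set_def)
  show 1: "1 \<in> A" and m: "\<And>x y. x \<in> A \<Longrightarrow> y \<in> A \<Longrightarrow> x * y \<in> A"
    using assms by (auto simp: subring_set_def)
  show 0: "0 \<in> A" using d[OF 1 1] by simp
  show "x \<in> A \<Longrightarrow> y \<in> A \<Longrightarrow> x + y \<in> A" using d[OF _ d[OF 0], of x y] by simp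
  show "x \<in> A \<Longrightarrow> x ^ k \<in> A" by (induction k) (auto intro: 1 m)
qed

lemma subring_set_vars_in: "subring_set (vars_in X)"
  by (auto simp: subring_set_def intro: vars_in_diff vars_in_mult)

definition ideal_in :: "'a::comm_ring_1 set \<Rightarrow> 'a set \<Rightarrow> bool" where
  "ideal_in A I \<longleftrightarrow> I \<subseteq> A \<and> 0 \<in> I \<and> (\<forall>x\<in>I. \<forall>y\<in>I. x + y \<in> I) \<and> (\<forall>a\<in>A. \<forall>x\<in>I. a * x \<in> I)"

definition prime_in :: "'a::comm_ring_1 set \<Rightarrow> 'a set \<Rightarrow> bool" where
  "prime_in A P \<longleftrightarrow> ideal_in A P \<and> 1 \<notin> P \<and> (\<forall>x\<in>A. \<forall>y\<in>A. x * y \<in> P \<longrightarrow> x \<in> P \<or> y \<in> P)"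

lemma
  assumes "ideal_in A I"
  shows ideal_in_subset: "I \<subseteq> A" and ideal_in_0: "0 \<in> I"
    and ideal_in_add: "x \<in> I \<Longrightarrow> y \<in> I \<Longrightarrow> x + y \<in> I"
    and ideal_in_mult: "a \<in> A \<Longrightarrow> x \<in> I \<Longrightarrow> a * x \<in> I"
  using assms by (auto simp: ideal_in_def)

lemma
  assumes "prime_in A P"
  shows prime_in_ideal_in: "ideal_in A P" and prime_in_1: "1 \<notin> P"
    and prime_inD: "x \<in> A \<Longrightarrow> y \<in> A \<Longrightarrow> x * y \<in> P \<Longrightarrow> x \<in> P \<or> y \<in> P"
  using assms by (auto simp: prime_in_def)

lemma prime_in_power:
  assumes "subring_set A" "prime_in A P" "g \<in> A" "g \<notin> P" "x \<in> A" "g ^ k * x \<in> P"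
  shows "x \<in> P"
  using assms(6)
proof (induction k)
  case (Suc k)
  then have "g * (g ^ k * x) \<in> P" by (simp add: mult.assoc)
  with prime_inD[OF assms(2,3)] assms(1,3,4,5) have "g ^ k * x \<in> P"
    by (auto intro: subring_set_power subring_set_mult)
  then show ?case by (rule Suc.IH)
qed simp

text \<open>By Zorn's lemma there is an ideal that is maximal among those containing
  \<open>I\<close> and disjoint from \<open>T\<close>, and maximality makes it prime.\<close>

lemma prime_avoiding_multiplicative_set:
  fixes A :: "'a::comm_ring_1 set"
  assumes A: "subring_set A" and I: "ideal_in A I"
    and T: "1 \<in> T" "T \<subseteq> A" "\<And>x y. x \<in> T \<Longrightarrow> y \<in> T \<Longrightarrow> x * y \<in> T" and IT: "I \<inter> T = {}"
  shows "\<exists>P. prime_in A P \<and> I \<subseteq> P \<and> P \<inter> T = {}"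
proof -
  define J where "J = {P. ideal_in A P \<and> I \<subseteq> P \<and> P \<inter> T = {}}"
  have "\<exists>M\<in>J. \<forall>X\<in>J. M \<subseteq> X \<longrightarrow> X = M"
  proof (rule subset_Zorn)
    fix C assume C: "subset.chain J C"
    show "\<exists>U\<in>J. \<forall>X\<in>C. X \<subseteq> U"
    proof (cases "C = {}")
      case True
      with I IT show ?thesis by (auto simp: J_def)
    next
      case False
      have CJ: "X \<in> J" if "X \<in> C" for X using C that by (auto simp: subset.chain_def)
      have lin: "X \<subseteq> Y \<or> Y \<subseteq> X" if "X \<in> C" "Y \<in> C" for X Y
        using C that by (auto simp: subset_chain_def)
      have "ideal_in A (\<Union>C)"
        unfolding ideal_in_def
      proof (intro conjI ballI)
        show "\<Union>C \<subseteq> A" using CJ unfolding J_def ideal_in_def by blast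
        show "0 \<in> \<Union>C" using False CJ by (auto simp: J_def ideal_in_def)
        show "x + y \<in> \<Union>C" if xy: "x \<in> \<Union>C" "y \<in> \<Union>C" for x y
        proof -
          obtain X Y where XY: "X \<in> C" "x \<in> X" "Y \<in> C" "y \<in> Y" using xy by blast
          then obtain Z where "Z \<in> C" "x \<in> Z" "y \<in> Z" using lin[of X Y] by blast
          with CJ[of Z] ideal_in_add[of A Z x y] show ?thesis by (auto simp: J_def)
        qed
        show "a * x \<in> \<Union>C" if ax: "a \<in> A" "x \<in> \<Union>C" for a x
        proof -
          obtain X where X: "X \<in> C" "x \<in> X" using ax by blast
          then have "ideal_in A X" using CJ by (auto simp: J_def)
          from ideal_in_mult[OF this ax(1) X(2)] X(1) show ?thesis by blast
        qed
      qed
      moreover have "I \<subseteq> \<Union>C" "\<Union>C \<inter> T = {}" using False CJ by (auto simp: J_def)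
      ultimately show ?thesis by (intro bexI[of _ "\<Union>C"]) (auto simp: J_def)
    qed
  qed
  then obtain M where M: "ideal_in A M" "I \<subseteq> M" "M \<inter> T = {}"
    and max: "\<And>X. ideal_in A X \<Longrightarrow> I \<subseteq> X \<Longrightarrow> X \<inter> T = {} \<Longrightarrow> M \<subseteq> X \<Longrightarrow> X = M"
    by (auto simp: J_def)
  have meets: "\<exists>m\<in>M. \<exists>r\<in>A. m + r * x \<in> T" if x: "x \<in> A" "x \<notin> M" for x
  proof -
    define X where "X = {m + r * x | m r. m \<in> M \<and> r \<in> A}"
    have MX: "M \<subseteq> X"
    proof
      fix m assume "m \<in> M"
      then have "m = m + 0 * x \<and> m \<in> M \<and> 0 \<in> A" using subring_set_0[OF A] by simp
      then show "m \<in> X" unfolding X_def by blast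
    qed
    have "x = 0 + 1 * x \<and> 0 \<in> M \<and> 1 \<in> A"
      using ideal_in_0[OF M(1)] subring_set_1[OF A] by simp
    then have "x \<in> X" unfolding X_def by blast
    have "ideal_in A X"
      unfolding ideal_in_def
    proof (intro conjI ballI)
      show "X \<subseteq> A" using M(1) x(1) A
        by (auto simp: X_def ideal_in_def intro!: subring_set_add subring_set_mult)
      show "0 \<in> X" using MX ideal_in_0[OF M(1)] by blast
      show "y + z \<in> X" if yz: "y \<in> X" "z \<in> X" for y z
      proof -
        obtain m r m' r' where "y = m + r * x" "m \<in> M" "r \<in> A" "z = m' + r' * x" "m' \<in> M" "r' \<in> A"
          using yz by (auto simp: X_def)
        then have "y + z = (m + m') + (r + r') * x \<and> m + m' \<in> M \<and> r + r' \<in> A"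
          using ideal_in_add[OF M(1)] subring_set_add[OF A] by (simp add: algebra_simps)
        then show ?thesis unfolding X_def by blast
      qed
      show "a * y \<in> X" if ay: "a \<in> A" "y \<in> X" for a y
      proof -
        obtain m r where "y = m + r * x" "m \<in> M" "r \<in> A" using ay by (auto simp: X_def)
        moreover from this have "a * m \<in> M" "a * r \<in> A"
          using ideal_in_mult[OF M(1) ay(1)] subring_set_mult[OF A ay(1)] by blast+
        ultimately have "a * y = a * m + (a * r) * x \<and> a * m \<in> M \<and> a * r \<in> A"
          by (simp add: distrib_left mult.assoc)
        then show ?thesis unfolding X_def by blast
      qed
    qed
    moreover have "X \<noteq> M" using \<open>x \<in> X\<close> x by blast
    ultimately have "X \<inter> T \<noteq> {}" using max[of X] MX M(2) by blast
    then show ?thesis by (auto simp: X_def)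
  qed
  have "prime_in A M"
    unfolding prime_in_def
  proof (intro conjI ballI impI)
    show "ideal_in A M" "1 \<notin> M" using M T(1) by auto
    fix x y assume xy: "x \<in> A" "y \<in> A" "x * y \<in> M"
    show "x \<in> M \<or> y \<in> M"
    proof (rule ccontr)
      assume "\<not> (x \<in> M \<or> y \<in> M)"
      then obtain m r m' r' where m: "m \<in> M" "r \<in> A" "m + r * x \<in> T" "m' \<in> M" "r' \<in> A" "m' + r' * y \<in> T"
        using meets[OF xy(1)] meets[OF xy(2)] by blast
      have "m' + r' * y \<in> A" "r * x \<in> A" "r * r' \<in> A"
        using m T(2) xy(1) subring_set_mult[OF A] by blast+
      \<comment> \<open>These are the terms of the product of two elements of \<open>T\<close>,
        which would therefore lie in both \<open>M\<close> and \<open>T\<close>.\<close>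
      then have "(m' + r' * y) * m + (r * x) * m' + (r * r') * (x * y) \<in> M"
        by (intro ideal_in_add[OF M(1)] ideal_in_mult[OF M(1)] m xy)
      then have "(m + r * x) * (m' + r' * y) \<in> M" by (simp add: algebra_simps)
      with T(3)[OF m(3,6)] M(3) show False by blast
    qed
  qed
  with M show ?thesis by blast
qed

text \<open>A prime disjoint from all products of a power of \<open>f\<close> with an element
  outside \<open>P\<close> is contained in \<open>P\<close> and misses \<open>f\<close>. Such a
  prime above \<open>I\<close> exists, since regularity of \<open>f\<close> would force the other
  factor into \<open>I\<close>, hence into \<open>P\<close>.\<close>

lemma smaller_prime:
  assumes A: "subring_set A" and P: "prime_in A P" and I: "ideal_in A I" "I \<subseteq> P"
    and f: "f \<in> P" and reg: "\<And>q. q \<in> A \<Longrightarrow> f * q \<in> I \<Longrightarrow> q \<in> I"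
  shows "\<exists>Q. prime_in A Q \<and> I \<subseteq> Q \<and> Q \<subset> P"
proof -
  have fA: "f \<in> A" using f ideal_in_subset[OF prime_in_ideal_in[OF P]] by blast
  define T where "T = {s * f ^ k | s k. s \<in> A \<and> s \<notin> P}"
  have TI: "s * f ^ k \<in> T" if "s \<in> A" "s \<notin> P" for s k using that by (auto simp: T_def)
  have reg': "s \<in> I" if "s \<in> A" "s * f ^ k \<in> I" for s k
    using that(2)
  proof (induction k)
    case (Suc k)
    then have "f * (s * f ^ k) \<in> I" by (simp add: mult_ac)
    with reg show ?case using Suc.IH that(1) fA A by (auto intro: subring_set_mult subring_set_power)
  qed simp
  have "\<exists>Q. prime_in A Q \<and> I \<subseteq> Q \<and> Q \<inter> T = {}"
  proof (rule prime_avoiding_multiplicative_set[OF A I(1)])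
    show "1 \<in> T" using TI[OF subring_set_1[OF A] prime_in_1[OF P], of 0] by simp
    show "T \<subseteq> A" using A fA by (auto simp: T_def intro: subring_set_mult subring_set_power)
    show "x * y \<in> T" if xy: "x \<in> T" "y \<in> T" for x y
    proof -
      obtain s k s' k' where s: "x = s * f ^ k" "s \<in> A" "s \<notin> P" "y = s' * f ^ k'" "s' \<in> A" "s' \<notin> P"
        using xy by (auto simp: T_def)
      then have "s * s' \<in> A" "s * s' \<notin> P" using prime_inD[OF P] subring_set_mult[OF A] by blast+
      from TI[OF this, of "k + k'"] s show ?thesis by (simp add: power_add mult_ac)
    qed
    show "I \<inter> T = {}" using reg' I(2) by (auto simp: T_def)
  qed
  then obtain Q where Q: "prime_in A Q" "I \<subseteq> Q" "Q \<inter> T = {}" by blast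
  have "Q \<subseteq> P"
  proof
    fix x assume x: "x \<in> Q"
    then have "x \<in> A" using ideal_in_subset[OF prime_in_ideal_in[OF Q(1)]] by blast
    then show "x \<in> P" using TI[of x 0] x Q(3) by auto
  qed
  moreover have "f \<notin> Q" using TI[OF subring_set_1[OF A] prime_in_1[OF P], of 1] Q(3) by auto
  ultimately show ?thesis using Q f by blast
qed

definition prime_chain :: "'a::comm_ring_1 set \<Rightarrow> (nat \<Rightarrow> 'a set) \<Rightarrow> nat \<Rightarrow> 'a set \<Rightarrow> bool" where
  "prime_chain A C k P \<longleftrightarrow> (\<forall>i\<le>k. prime_in A (C i)) \<and> (\<forall>i<k. C i \<subset> C (Suc i)) \<and> C k = P"

lemma ideal_in_ideal_of: "ideal_in (vars_in X) (ideal_of G \<inter> vars_in X)"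
  by (auto simp: ideal_in_def intro: ideal_gen.span_add ideal_gen.span_scale ideal_gen.span_zero
      vars_in_intros)

text \<open>Setting the variables outside \<open>X\<close> to 0 is a retraction onto
  \<open>vars_in X\<close> that turns arbitrary coefficients into coefficients from this
  subring.\<close>

lemma ideal_of_inter_subset:
  assumes I: "ideal_in (vars_in X) I" and G: "G \<subseteq> I"
  shows "ideal_of G \<inter> vars_in X \<subseteq> (I :: 'k::field xpoly set)"
proof
  fix p assume p: "p \<in> ideal_of G \<inter> vars_in X"
  define \<kappa> :: "'k xpoly \<Rightarrow> 'k xpoly" where "\<kappa> = subst_vars (\<lambda>x. if x \<in> X then var x else 0)"
  have \<kappa>: "ring_morph \<kappa>" unfolding \<kappa>_def by (rule ring_morph_subst)
  have \<kappa>_in: "\<kappa> q \<in> vars_in X" for q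
    unfolding \<kappa>_def by (rule subst_vars_in[OF vars_in_UNIV]) auto
  have \<kappa>_id: "\<kappa> q = q" if "q \<in> vars_in X" for q
    unfolding \<kappa>_def by (rule subst_vars_id[OF that]) auto
  have "\<kappa> q \<in> I" if "q \<in> ideal_of G" for q
    using that
  proof (induction rule: ideal_gen.span_induct_alt)
    case base
    then show ?case using ideal_in_0[OF I] by (simp add: ring_morph_zero[OF \<kappa>])
  next
    case (step c x y)
    then have "x \<in> I" "\<kappa> x = x" using G ideal_in_subset[OF I] by (auto intro!: \<kappa>_id)
    with step show ?case
      by (auto simp: ring_morph_simps[OF \<kappa>] intro!: ideal_in_add[OF I] ideal_in_mult[OF I] \<kappa>_in)
  qed
  from this[of p] p \<kappa>_id[of p] show "p \<in> I" by simp
qed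

text \<open>The last polynomial is regular modulo the earlier ones, so \<open>smaller_prime\<close>
  yields a prime strictly below \<open>P\<close> that still contains these.\<close>

lemma prime_chain_below:
  assumes "fresh_order es" "proper_colouring d col (set es)"
    and "\<Union>(set es) \<times> {1..d} \<subseteq> X"
    and "prime_in (vars_in X) P" "edge_poly d {} ` set es \<subseteq> P"
  shows "\<exists>C. prime_chain (vars_in X) C (length es) (P :: 'k::field xpoly set)"
  using assms
proof (induction arbitrary: P rule: fresh_order.induct)
  case Nil
  then show ?case by (intro exI[of _ "\<lambda>_. P"]) (auto simp: prime_chain_def)
next
  case (snoc es u e)
  define I :: "'k xpoly set" where "I = ideal_of (edge_poly d {} ` set es) \<inter> vars_in X"
  have col: "proper_colouring d col (insert e (set es))" using snoc.prems by simp
  from proper_colouring_subset[OF col] have col': "proper_colouring d col (set es)" by auto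
  have I: "ideal_in (vars_in X) I" unfolding I_def by (rule ideal_in_ideal_of)
  have mem: "edge_poly d {} e' \<in> (vars_in X :: 'k xpoly set)" if "e' \<in> insert e (set es)" for e'
    by (rule vars_in_mono[OF edge_poly_vars_in]) (use that snoc.prems(2) in auto)
  have IP: "I \<subseteq> P"
    unfolding I_def
    by (rule ideal_of_inter_subset[OF prime_in_ideal_in[OF snoc.prems(3)]]) (use snoc.prems in auto)
  have "\<exists>Q. prime_in (vars_in X) Q \<and> I \<subseteq> Q \<and> Q \<subset> P"
  proof (rule smaller_prime[OF subring_set_vars_in snoc.prems(3) I IP])
    show "edge_poly d {} e \<in> P" using snoc.prems(4) by simp
    show "q \<in> I" if "q \<in> vars_in X" "edge_poly d {} e * q \<in> I" for q
      using edge_poly_regular[OF unused_vars_regular[OF snoc.hyps(1) col'] snoc.hyps(4,2,3) col, of "{}"]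
        that by (auto simp: I_def dest: regular_modD)
  qed
  then obtain Q where Q: "prime_in (vars_in X) Q" "I \<subseteq> Q" "Q \<subset> P" by blast
  have "edge_poly d {} ` set es \<subseteq> I"
    using mem by (auto simp: I_def intro: ideal_gen.span_base)
  then have "edge_poly d {} ` set es \<subseteq> Q" using Q(2) by (rule order.trans)
  moreover have "\<Union>(set es) \<times> {1..d} \<subseteq> X" using snoc.prems(2) by auto
  ultimately obtain C where C: "prime_chain (vars_in X) C (length es) Q"
    using snoc.IH[OF col' _ Q(1)] by blast
  define C' where "C' = C(Suc (length es) := P)"
  have "prime_chain (vars_in X) C' (Suc (length es)) P"
    unfolding prime_chain_def
  proof (intro conjI allI impI)
    show "prime_in (vars_in X) (C' i)" if "i \<le> Suc (length es)" for i
      using that C snoc.prems(3) by (auto simp: C'_def prime_chain_def le_Suc_eq)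
    show "C' i \<subset> C' (Suc i)" if "i < Suc (length es)" for i
      using that C Q(3) by (auto simp: C'_def prime_chain_def less_Suc_eq)
  qed (simp add: C'_def)
  then show ?case by auto
qed

section \<open>Counting monomials bounds the height\<close>

definition kindep :: "'k::field xpoly set \<Rightarrow> 'k xpoly set \<Rightarrow> bool" where
  "kindep P B \<longleftrightarrow> (\<forall>u. (\<Sum>b\<in>B. con (u b) * b) \<in> P \<longrightarrow> (\<forall>b\<in>B. u b = 0))"

lemma in_box_mult:
  assumes "p \<in> in_box X a" "q \<in> in_box X b"
  shows "p * q \<in> in_box X (a + b)"
proof -
  have "Poly_Mapping.keys m \<subseteq> X \<and> (\<forall>x. Poly_Mapping.lookup m x \<le> a + b)"
    if m: "m \<in> Poly_Mapping.keys (p * q)" for m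
  proof -
    obtain s t where st: "m = s + t" "s \<in> Poly_Mapping.keys p" "t \<in> Poly_Mapping.keys q"
      using m keys_mult[of p q] by blast
    then have "Poly_Mapping.keys s \<subseteq> X" "\<forall>x. Poly_Mapping.lookup s x \<le> a"
      "Poly_Mapping.keys t \<subseteq> X" "\<forall>x. Poly_Mapping.lookup t x \<le> b"
      using assms by (auto simp: in_box_def)
    with st(1) keys_add[of s t] show ?thesis by (auto simp: lookup_add add_mono)
  qed
  then show ?thesis by (simp add: in_box_def)
qed

lemma in_box_mono: "p \<in> in_box X a \<Longrightarrow> X \<subseteq> Y \<Longrightarrow> a \<le> b \<Longrightarrow> p \<in> in_box Y b"
  unfolding in_box_def by (blast intro: order_trans)

lemma in_box_power: "p \<in> in_box X a \<Longrightarrow> p ^ k \<in> in_box X (k * a)"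
proof (induction k)
  case 0
  show ?case by (simp add: in_box_def)
qed (auto simp: in_box_mult)

lemma in_box_exists:
  assumes "p \<in> vars_in X"
  shows "\<exists>a. p \<in> in_box X a"
proof -
  have "\<exists>a. \<forall>m\<in>Poly_Mapping.keys p. \<forall>x. Poly_Mapping.lookup m x \<le> a"
  proof (intro exI ballI allI)
    fix m x assume m: "m \<in> Poly_Mapping.keys p"
    have "Poly_Mapping.lookup m x \<le> (\<Sum>x\<in>Poly_Mapping.keys m. Poly_Mapping.lookup m x)"
      by (cases "x \<in> Poly_Mapping.keys m") (auto intro: member_le_sum simp: in_keys_iff)
    also have "\<dots> \<le> (\<Sum>m\<in>Poly_Mapping.keys p. \<Sum>x\<in>Poly_Mapping.keys m. Poly_Mapping.lookup m x)"
      using m by (intro member_le_sum) auto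
    finally show "Poly_Mapping.lookup m x \<le> \<dots>" .
  qed
  with assms show ?thesis by (auto simp: in_box_def vars_in_def)
qed

text \<open>Powers of an element of \<open>Q - P\<close> are linearly independent modulo \<open>P\<close> over a space that meets
  \<open>Q\<close> trivially; this is how the transcendence degree grows along a chain of primes.\<close>

lemma kindep_powers:
  assumes P: "prime_in (vars_in X) P" and Q: "ideal_in (vars_in X) Q" and PQ: "P \<subseteq> Q"
    and g: "g \<in> Q" "g \<notin> P"
    and B: "finite B" "B \<subseteq> vars_in X" "kindep Q B"
  shows "\<exists>B'. finite B' \<and> card B' = (D + 1) * card B \<and> kindep P B' \<and>
    B' \<subseteq> (\<lambda>(j, b). g ^ j * b) ` ({..D} \<times> B)"
proof -
  note A = subring_set_vars_in[of X]
  have gA: "g \<in> vars_in X" using ideal_in_subset[OF Q] g(1) by blast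
  have lc: "(\<Sum>b\<in>B. con (u b) * b) \<in> vars_in X" for u
    using B(2) by (intro vars_in_sum vars_in_mult) auto
  \<comment> \<open>Modulo \<open>Q\<close> only the term with \<open>j = 0\<close> survives, so its
    coefficients vanish; then one factor \<open>g\<close> cancels modulo \<open>P\<close>.\<close>
  have main: "(\<Sum>j\<le>D. g ^ j * (\<Sum>b\<in>B. con (u j b) * b)) \<in> P \<Longrightarrow> \<forall>j\<le>D. \<forall>b\<in>B. u j b = 0" for D u
  proof (induction D arbitrary: u)
    case 0
    then have "(\<Sum>b\<in>B. con (u 0 b) * b) \<in> Q" using PQ by auto
    with B(3) show ?case unfolding kindep_def by blast
  next
    case (Suc D)
    let ?S = "\<Sum>j\<le>D. g ^ j * (\<Sum>b\<in>B. con (u (Suc j) b) * b)"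
    have SA: "?S \<in> vars_in X" by (intro vars_in_sum vars_in_mult[OF vars_in_power[OF gA] lc])
    have eq: "(\<Sum>j\<le>Suc D. g ^ j * (\<Sum>b\<in>B. con (u j b) * b)) = (\<Sum>b\<in>B. con (u 0 b) * b) + g * ?S"
      by (simp add: sum.atMost_Suc_shift sum_distrib_left mult.assoc del: sum.atMost_Suc)
    have "(- 1) * (?S * g) \<in> Q"
      by (rule ideal_in_mult[OF Q vars_in_uminus[OF vars_in_1] ideal_in_mult[OF Q SA g(1)]])
    moreover have "(\<Sum>b\<in>B. con (u 0 b) * b) + g * ?S \<in> Q"
      using Suc.prems PQ unfolding eq by blast
    ultimately have "(- 1) * (?S * g) + ((\<Sum>b\<in>B. con (u 0 b) * b) + g * ?S) \<in> Q"
      by (rule ideal_in_add[OF Q])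
    then have "(\<Sum>b\<in>B. con (u 0 b) * b) \<in> Q" by (simp add: mult.commute)
    then have u0: "\<forall>b\<in>B. u 0 b = 0" using B(3) unfolding kindep_def by blast
    then have "g * ?S \<in> P" using Suc.prems unfolding eq by simp
    then have "?S \<in> P" using prime_inD[OF P gA SA] g(2) by blast
    from Suc.IH[OF this] have "u (Suc j) b = 0" if "j \<le> D" "b \<in> B" for j b using that by blast
    with u0 show ?case by (metis Suc_le_mono not0_implies_Suc)
  qed
  define B' where "B' = (\<lambda>(j, b). g ^ j * b) ` ({..D} \<times> B)"
  have nonmem: "b \<notin> Q" if "b \<in> B" for b
  proof
    assume "b \<in> Q"
    moreover have "(\<Sum>b'\<in>B. con (if b' = b then 1 else 0) * b') = b"
      using that B(1) by (simp add: if_distrib[of con] if_distrib[of "\<lambda>x. x * _"] cong: if_cong)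
    ultimately have "(\<Sum>b'\<in>B. con (if b' = b then 1 else 0) * b') \<in> Q" by simp
    from B(3)[unfolded kindep_def, rule_format, OF this that] show False by simp
  qed
  have diff: "b = b'" if "b \<in> B" "b' \<in> B" "b - b' \<in> Q" for b b'
  proof (rule ccontr)
    assume ne: "b \<noteq> b'"
    define u :: "'a xpoly \<Rightarrow> 'a" where "u x = (if x = b then 1 else if x = b' then -1 else 0)" for x
    have "(\<Sum>x\<in>B. con (u x) * x) = (\<Sum>x\<in>{b, b'}. con (u x) * x)"
      using that B(1) by (intro sum.mono_neutral_right) (auto simp: u_def)
    also have "\<dots> = b - b'" using ne by (simp add: u_def con_def single_uminus)
    finally have "(\<Sum>x\<in>B. con (u x) * x) \<in> Q" using that by simp
    with B(3) have "u b = 0" using that unfolding kindep_def by blast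
    then show False by (simp add: u_def)
  qed
  \<comment> \<open>Needed for the exact cardinality: if two different powers gave the same product,
    cancelling the smaller one modulo \<open>P\<close> would put \<open>b\<close> into
    \<open>Q\<close>.\<close>
  have less: False if "j < j'" "b \<in> B" "b' \<in> B" "g ^ j * b = g ^ j' * b'" for j j' b b'
  proof -
    have bA: "b \<in> vars_in X" "b' \<in> vars_in X" using that B(2) by auto
    have "g ^ j * (b - g ^ (j' - j) * b') = 0"
      using that by (simp add: right_diff_distrib mult.assoc[symmetric] flip: power_add)
    then have "g ^ j * (b - g ^ (j' - j) * b') \<in> P"
      using ideal_in_0[OF prime_in_ideal_in[OF P]] by (simp only:)
    then have "b - g ^ (j' - j) * b' \<in> P"
      by (rule prime_in_power[OF A P gA g(2), rotated]) (intro vars_in_intros gA bA)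
    then have 1: "b - g ^ (j' - j) * b' \<in> Q" using PQ by blast
    have "(g ^ (j' - j - 1) * b') * g \<in> Q"
      by (intro ideal_in_mult[OF Q] vars_in_intros gA bA g)
    moreover have "g ^ (j' - j) = g ^ (j' - j - 1) * g"
      using that(1) by (cases "j' - j") simp_all
    ultimately have "g ^ (j' - j) * b' \<in> Q" by (simp add: mult_ac)
    from ideal_in_add[OF Q 1 this] have "b \<in> Q" by simp
    with nonmem that show False by blast
  qed
  have inj: "inj_on (\<lambda>(j, b). g ^ j * b) ({..D} \<times> B)"
  proof (rule inj_onI, clarify)
    fix j b j' b' assume *: "b \<in> B" "b' \<in> B" "g ^ j * b = g ^ j' * b'"
    have "j = j'" using less[of j j' b b'] less[of j' j b' b] * by (cases j j' rule: linorder_cases) auto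
    moreover have "b = b'"
    proof (rule diff)
      have "g ^ j * (b - b') = 0" using * \<open>j = j'\<close> by (simp add: right_diff_distrib)
      then have "g ^ j * (b - b') \<in> P" using ideal_in_0[OF prime_in_ideal_in[OF P]] by (simp only:)
      then have "b - b' \<in> P"
        by (rule prime_in_power[OF A P gA g(2), rotated]) (use B(2) * in \<open>auto intro!: vars_in_intros\<close>)
      then show "b - b' \<in> Q" using PQ by blast
    qed (use * in auto)
    ultimately show "j = j' \<and> b = b'" by simp
  qed
  have "kindep P B'"
    unfolding kindep_def
  proof (intro allI impI)
    fix u assume u: "(\<Sum>x\<in>B'. con (u x) * x) \<in> P"
    have "(\<Sum>x\<in>B'. con (u x) * x) = (\<Sum>(j, b)\<in>{..D} \<times> B. con (u (g ^ j * b)) * (g ^ j * b))"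
      unfolding B'_def by (subst sum.reindex[OF inj]) (simp add: case_prod_unfold)
    also have "\<dots> = (\<Sum>j\<le>D. g ^ j * (\<Sum>b\<in>B. con (u (g ^ j * b)) * b))"
      by (simp add: sum.cartesian_product[symmetric] sum_distrib_left mult_ac)
    finally have "\<forall>j\<le>D. \<forall>b\<in>B. u (g ^ j * b) = 0" using main[of "\<lambda>j b. u (g ^ j * b)" D] u by simp
    then show "\<forall>x\<in>B'. u x = 0" by (auto simp: B'_def)
  qed
  moreover have "card B' = (D + 1) * card B"
    unfolding B'_def using card_image[OF inj] by (simp add: card_cartesian_product)
  ultimately show ?thesis using B(1) by (intro exI[of _ B']) (auto simp: B'_def)
qed

text \<open>Each link contributes the powers of \<open>g i\<close> up to \<open>D\<close>: a factor
  \<open>D + 1\<close> in number for at most \<open>D * c\<close> in the exponents.\<close>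

lemma kindep_along_chain:
  assumes "prime_chain (vars_in X) C k P"
    and "\<And>i. i < k \<Longrightarrow> g i \<in> C (Suc i) - C i" "\<And>i. i < k \<Longrightarrow> g i \<in> in_box X c"
    and "finite B" "B \<subseteq> in_box X a" "kindep P B"
  shows "\<exists>B'. finite B' \<and> card B' = (D + 1) ^ k * card B \<and> kindep (C 0) B' \<and>
    B' \<subseteq> in_box X (a + k * (D * c))"
  using assms
proof (induction k arbitrary: P B a)
  case 0
  then show ?case by (intro exI[of _ B]) (auto simp: prime_chain_def)
next
  case (Suc k)
  have box: "in_box X s \<subseteq> (vars_in X :: 'a xpoly set)" for s by (auto simp: in_box_def vars_in_def)
  have C: "prime_chain (vars_in X) C k (C k)" "prime_in (vars_in X) (C k)" "ideal_in (vars_in X) P"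
    "C k \<subseteq> P" "C (Suc k) = P"
    using Suc.prems(1) by (auto simp: prime_chain_def prime_in_def)
  obtain B1 where B1: "finite B1" "card B1 = (D + 1) * card B" "kindep (C k) B1"
    "B1 \<subseteq> (\<lambda>(j, b). g k ^ j * b) ` ({..D} \<times> B)"
    using kindep_powers[OF C(2-4), of "g k" B D] Suc.prems(2)[of k] Suc.prems(4,5,6) box C(5) by auto
  have "B1 \<subseteq> in_box X (D * c + a)"
  proof
    fix x assume "x \<in> B1"
    then obtain j b where jb: "x = g k ^ j * b" "j \<le> D" "b \<in> B" using B1(4) by auto
    have "g k ^ j * b \<in> in_box X (j * c + a)"
      using Suc.prems(3)[of k] Suc.prems(5) jb by (intro in_box_mult in_box_power) auto
    then show "x \<in> in_box X (D * c + a)" unfolding jb(1) by (rule in_box_mono) (use jb in auto)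
  qed
  from Suc.IH[OF C(1) Suc.prems(2,3)[OF less_SucI] B1(1) this B1(3)] obtain B' where
    "finite B'" "card B' = (D + 1) ^ k * card B1" "kindep (C 0) B'"
    "B' \<subseteq> in_box X (D * c + a + k * (D * c))" by blast
  then show ?case using B1(2) by (intro exI[of _ B']) (auto simp: algebra_simps)
qed

lemma kindep_box_monomials:
  assumes X: "finite X" and P: "\<And>p. p \<in> vars_in X \<Longrightarrow> p \<in> P \<Longrightarrow> p = 0"
  shows "kindep P (box_monomials X D)"
  unfolding kindep_def
proof (intro allI impI ballI)
  fix u :: "'a xpoly \<Rightarrow> 'a" and b :: "'a xpoly"
  assume u: "(\<Sum>b\<in>box_monomials X D. con (u b) * b) \<in> P" and b: "b \<in> box_monomials X D"
  let ?m = "\<lambda>f. \<Sum>x\<in>X. Poly_Mapping.single x (f x) :: monomial"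
  have keys: "Poly_Mapping.keys (?m f) \<subseteq> X" for f
    by (auto simp: in_keys_iff lookup_box[OF X] split: if_splits)
  have "b \<in> vars_in X" if b: "b \<in> box_monomials X D" for b :: "'a xpoly"
  proof -
    obtain f where "b = box_monomial X f" using b by (auto simp: box_monomials_def)
    with keys[of f] show ?thesis by (simp add: box_monomial_def vars_in_def)
  qed
  then have "(\<Sum>b\<in>box_monomials X D. con (u b) * b) \<in> vars_in X"
    by (intro vars_in_sum vars_in_mult vars_in_con)
  from P[OF this u] have zero: "(\<Sum>b\<in>box_monomials X D. con (u b) * b) = 0" .
  obtain f where f: "b = box_monomial X f" using b by (auto simp: box_monomials_def)
  have "Poly_Mapping.lookup (con (u b') * b') (?m f) = (if b' = b then u b else 0)"
    if "b' \<in> box_monomials X D" for b'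
    using that by (auto simp: f box_monomials_def box_monomial_def con_def mult_single lookup_single when_def)
  then have "Poly_Mapping.lookup (\<Sum>b\<in>box_monomials X D. con (u b) * b) (?m f) =
      (\<Sum>b'\<in>box_monomials X D. if b' = b then u b else 0)"
    by (simp add: lookup_sum)
  also have "\<dots> = u b" using b by (simp add: finite_box_monomials[OF X])
  finally show "u b = 0" unfolding zero by simp
qed

text \<open>For every D there are (D + 1)^(k + card X') elements independent modulo
  \<open>C 0\<close>, in a box whose exponents are at most a constant multiple of D and whose
  dimension therefore grows like D^(card X). Comparing the growth in D gives the bound.\<close>

lemma prime_chain_length:
  fixes P :: "'k::field xpoly set"
  assumes X: "finite X" "X' \<subseteq> X" and P: "\<And>p. p \<in> vars_in X' \<Longrightarrow> p \<in> P \<Longrightarrow> p = 0"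
    and C: "prime_chain (vars_in X) C k P"
  shows "k + card X' \<le> card X"
proof (rule ccontr)
  assume "\<not> k + card X' \<le> card X"
  then have big: "card X + 1 \<le> k + card X'" by simp
  have X': "finite X'" using X finite_subset by blast
  have "\<forall>i. \<exists>x. i < k \<longrightarrow> x \<in> C (Suc i) - C i" using C unfolding prime_chain_def by blast
  then obtain g where g: "\<And>i. i < k \<Longrightarrow> g i \<in> C (Suc i) - C i" by metis
  have "\<forall>i. \<exists>a. i < k \<longrightarrow> g i \<in> in_box X a"
  proof (intro allI)
    fix i
    show "\<exists>a. i < k \<longrightarrow> g i \<in> in_box X a"
    proof (cases "i < k")
      case True
      then have "prime_in (vars_in X) (C (Suc i))" using C by (auto simp: prime_chain_def)
      with g[OF True] have "g i \<in> vars_in X" by (auto simp: prime_in_def ideal_in_def)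
      then show ?thesis using in_box_exists by blast
    qed simp
  qed
  then obtain cc where cc: "\<And>i. i < k \<Longrightarrow> g i \<in> in_box X (cc i)" by metis
  define c where "c = (\<Sum>i<k. cc i)"
  have c: "g i \<in> in_box X c" if "i < k" for i
    by (rule in_box_mono[OF cc[OF that] order_refl]) (use that in \<open>auto simp: c_def intro!: member_le_sum\<close>)
  \<comment> \<open>The constant by which the dimension of the box may exceed (D + 1)^(card X);
    being less than \<open>D + 1\<close>, it is beaten by one further factor
    \<open>D + 1\<close>.\<close>
  define D where "D = (1 + k * c) ^ card X"
  have sub: "box_monomials X' D \<subseteq> (in_box X D :: 'k xpoly set)"
  proof
    fix b :: "'k xpoly" assume "b \<in> box_monomials X' D"
    then obtain f where f: "f \<in> X' \<rightarrow>\<^sub>E {..D}" "b = box_monomial X' f" by (auto simp: box_monomials_def)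
    then show "b \<in> in_box X D"
      using X(2) by (auto simp: in_box_def box_monomial_def lookup_box[OF X'] in_keys_iff split: if_splits)
  qed
  obtain B where B: "finite B" "card B = (D + 1) ^ k * card (box_monomials X' D :: 'k xpoly set)"
    "kindep (C 0) B" "B \<subseteq> in_box X (D + k * (D * c))"
    using kindep_along_chain[OF C g c finite_box_monomials[OF X'] sub kindep_box_monomials[OF X' P]]
    by blast
  have "0 \<in> C 0" using C by (auto simp: prime_chain_def prime_in_def ideal_in_def)
  have "\<not> kdependent B"
    using B(3) \<open>0 \<in> C 0\<close> by (auto simp: kvs.dependent_finite[OF B(1)] kindep_def)
  moreover have "B \<subseteq> kspan (box_monomials X (D + k * (D * c)))"
    using in_box_subset_kspan[OF X(1)] B(4) by blast
  ultimately have "card B \<le> card (box_monomials X (D + k * (D * c)) :: 'k xpoly set)"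
    using kvs.independent_span_bound[OF finite_box_monomials[OF X(1)]] by blast
  then have "(D + 1) ^ (k + card X') \<le> (D + k * (D * c) + 1) ^ card X"
    using card_box_monomials[OF X', of D, where 'k = 'k]
      card_box_monomials[OF X(1), of "D + k * (D * c)", where 'k = 'k] B(2)
    by (simp add: power_add)
  also have "\<dots> \<le> ((1 + k * c) * (D + 1)) ^ card X"
    by (intro power_mono) (simp_all add: algebra_simps)
  also have "\<dots> = D * (D + 1) ^ card X" by (simp only: D_def power_mult_distrib)
  also have "\<dots> < (D + 1) ^ (card X + 1)" by simp
  also have "\<dots> \<le> (D + 1) ^ (k + card X')" by (rule power_increasing[OF big]) simp
  finally show False by simp
qed

section \<open>The ring of LSS ideals\<close>

abbreviation grid :: "nat \<Rightarrow> nat \<Rightarrow> (nat \<times> nat) set" where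
  "grid n d \<equiv> {1..n} \<times> {1..d}"

lemma lss_ring_simps [simp]:
  "carrier (lss_ring n d :: 'k::field xpoly ring) = vars_in (grid n d)"
  "x \<oplus>\<^bsub>lss_ring n d\<^esub> y = (x + y :: 'k xpoly)" "x \<otimes>\<^bsub>lss_ring n d\<^esub> y = (x * y :: 'k xpoly)"
  "\<zero>\<^bsub>lss_ring n d\<^esub> = (0 :: 'k xpoly)" "\<one>\<^bsub>lss_ring n d\<^esub> = (1 :: 'k xpoly)"
  by (auto simp: lss_ring_def vars_in_def)

lemma lss_poly_eq_edge_poly: "lss_poly d e = edge_poly d {} e"
  by (simp add: lss_poly_def edge_poly_def xvar_def var_def)

lemma pow_lss_ring: "x [^]\<^bsub>lss_ring n d\<^esub> (k::nat) = (x ^ k :: 'k::field xpoly)"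
proof -
  interpret cring "lss_ring n d :: 'k xpoly ring" by (rule cring_lss_ring)
  show ?thesis by (induction k) (simp_all add: mult.commute)
qed

lemma ideal_lss_ring_iff:
  "ideal I (lss_ring n d) \<longleftrightarrow> ideal_in (vars_in (grid n d)) (I :: 'k::field xpoly set)"
proof
  interpret cring "lss_ring n d :: 'k xpoly ring" by (rule cring_lss_ring)
  assume "ideal I (lss_ring n d)"
  then interpret ideal I "lss_ring n d :: 'k xpoly ring" .
  show "ideal_in (vars_in (grid n d)) I"
    unfolding ideal_in_def using a_subset I_l_closed a_closed zero_closed by auto
next
  interpret cring "lss_ring n d :: 'k xpoly ring" by (rule cring_lss_ring)
  assume I: "ideal_in (vars_in (grid n d)) I"
  have neg: "\<ominus>\<^bsub>lss_ring n d\<^esub> x = - x" if "x \<in> vars_in (grid n d)" for x :: "'k xpoly"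
    by (rule minus_equality) (use that vars_in_uminus in auto)
  show "ideal I (lss_ring n d)"
  proof (rule idealI)
    show "subgroup I (add_monoid (lss_ring n d :: 'k xpoly ring))"
    proof (rule group.subgroupI)
      show "Group.group (add_monoid (lss_ring n d :: 'k xpoly ring))" by (rule a_group)
      show "I \<subseteq> carrier (add_monoid (lss_ring n d))" using ideal_in_subset[OF I] by simp
      show "I \<noteq> {}" using ideal_in_0[OF I] by blast
      show "inv\<^bsub>add_monoid (lss_ring n d)\<^esub> a \<in> I" if "a \<in> I" for a
        using neg[of a] that ideal_in_subset[OF I]
          ideal_in_mult[OF I vars_in_uminus[OF vars_in_1] that] by (auto simp: a_inv_def)
      show "a \<otimes>\<^bsub>add_monoid (lss_ring n d)\<^esub> b \<in> I" if "a \<in> I" "b \<in> I" for a b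
        using ideal_in_add[OF I that] by simp
    qed
    show "x \<otimes>\<^bsub>lss_ring n d\<^esub> a \<in> I" "a \<otimes>\<^bsub>lss_ring n d\<^esub> x \<in> I"
      if "a \<in> I" "x \<in> carrier (lss_ring n d)" for a x
      using ideal_in_mult[OF I, of x a] that by (simp_all add: mult.commute)
  qed (rule ring_axioms)
qed

lemma primeideal_lss_ring_iff:
  "primeideal P (lss_ring n d) \<longleftrightarrow> prime_in (vars_in (grid n d)) (P :: 'k::field xpoly set)"
proof
  interpret cring "lss_ring n d :: 'k xpoly ring" by (rule cring_lss_ring)
  assume "primeideal P (lss_ring n d)"
  then interpret primeideal P "lss_ring n d :: 'k xpoly ring" .
  have "1 \<notin> P" using one_imp_carrier I_notcarr by auto
  then show "prime_in (vars_in (grid n d)) P"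
    unfolding prime_in_def using is_ideal I_prime by (auto simp: ideal_lss_ring_iff)
next
  assume P: "prime_in (vars_in (grid n d)) P"
  show "primeideal P (lss_ring n d)"
  proof (rule primeidealI)
    show "ideal P (lss_ring n d)" using P by (simp add: ideal_lss_ring_iff prime_in_ideal_in)
    show "cring (lss_ring n d :: 'k xpoly ring)" by (rule cring_lss_ring)
    show "carrier (lss_ring n d) \<noteq> P" using prime_in_1[OF P] vars_in_1 by auto
  qed (use prime_inD[OF P] in auto)
qed

text \<open>Transfers results about \<open>ideal_of\<close> in the ring of all variables to the
  ideals of the statement.\<close>

lemma Idl_lss_ring:
  assumes "G \<subseteq> vars_in (grid n d)"
  shows "Idl\<^bsub>lss_ring n d\<^esub> G = ideal_of G \<inter> (vars_in (grid n d) :: 'k::field xpoly set)"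
proof
  interpret cring "lss_ring n d :: 'k xpoly ring" by (rule cring_lss_ring)
  show "Idl\<^bsub>lss_ring n d\<^esub> G \<subseteq> ideal_of G \<inter> vars_in (grid n d)"
    by (rule genideal_minimal)
      (use assms in \<open>auto simp: ideal_lss_ring_iff intro: ideal_in_ideal_of ideal_gen.span_base\<close>)
  show "ideal_of G \<inter> vars_in (grid n d) \<subseteq> Idl\<^bsub>lss_ring n d\<^esub> G"
    using genideal_ideal[of G] genideal_self[of G] assms
    by (intro ideal_of_inter_subset) (auto simp: ideal_lss_ring_iff)
qed

lemma edge_poly_in_grid: "e \<subseteq> {1..n} \<Longrightarrow> edge_poly d Z e \<in> vars_in (grid n d)"
  by (rule vars_in_mono[OF edge_poly_vars_in]) auto

lemma lss_ideal_eq: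
  assumes "\<And>e. e \<in> E \<Longrightarrow> e \<subseteq> {1..n}"
  shows "lss_ideal n E d = ideal_of (edge_poly d {} ` E) \<inter> (vars_in (grid n d) :: 'k::field xpoly set)"
  unfolding lss_ideal_def lss_poly_eq_edge_poly
  by (rule Idl_lss_ring, rule image_subsetI) (rule edge_poly_in_grid, rule assms)

section \<open>Forests\<close>

text \<open>An edge with at least two vertices, of which at most one lies in earlier edges, has a
  fresh vertex.\<close>

lemma good_forest_order:
  assumes "good_forest E" and E: "\<And>e. e \<in> E \<Longrightarrow> finite e \<and> card e > 1"
  obtains es where "distinct es" "set es = E" "forest_order es" "fresh_order es"
proof -
  obtain es where es: "distinct es" "set es = E"
    and ov: "\<And>i. 1 \<le> i \<Longrightarrow> i < length es \<Longrightarrow> card (\<Union>(set (take i es)) \<inter> es ! i) \<le> 1"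
    using assms(1) by (auto simp: good_forest_def)
  have "forest_order (take k es) \<and> fresh_order (take k es)" if "k \<le> length es" for k
    using that
  proof (induction k)
    case 0
    then show ?case by (simp add: forest_order.Nil fresh_order.Nil)
  next
    case (Suc k)
    have e: "finite (es ! k)" "card (es ! k) > 1" using E[of "es ! k"] es(2) Suc.prems by auto
    \<comment> \<open>The condition in \<open>good_forest\<close> starts with the second edge; for
      the first one the union is empty.\<close>
    have ov': "card (\<Union>(set (take k es)) \<inter> es ! k) \<le> 1"
      using ov[of k] Suc.prems by (cases "k = 0") auto
    have "\<not> es ! k \<subseteq> \<Union>(set (take k es))"
      using ov' e(2) by (auto simp: Int_absorb1)
    then obtain u where u: "u \<in> es ! k" "u \<notin> \<Union>(set (take k es))" by blast
    have IH: "forest_order (take k es)" "fresh_order (take k es)" using Suc by simp_all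
    have "take (Suc k) es = take k es @ [es ! k]"
      using Suc.prems by (simp add: take_Suc_conv_app_nth)
    with forest_order.snoc[OF IH(1) ov' e(1)] fresh_order.snoc[OF IH(2) u e(1)] show ?case
      by (simp only: simp_thms)
  qed
  from this[of "length es"] es that show thesis by simp
qed

lemma forest_order_filter: "forest_order es \<Longrightarrow> forest_order (filter P es)"
proof (induction rule: forest_order.induct)
  case (snoc es e)
  have "card (\<Union>(set (filter P es)) \<inter> e) \<le> card (\<Union>(set es) \<inter> e)"
    using snoc.hyps by (intro card_mono) auto
  with snoc.hyps(2) have "card (\<Union>(set (filter P es)) \<inter> e) \<le> 1" by simp
  from forest_order.snoc[OF snoc.IH this snoc.hyps(3)] snoc.IH show ?case
    by (cases "P e") (simp_all only: filter_append filter.simps if_True if_False append_Nil2)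
qed (simp add: forest_order.Nil)

lemma fresh_order_filter: "fresh_order es \<Longrightarrow> fresh_order (filter P es)"
proof (induction rule: fresh_order.induct)
  case (snoc es u e)
  from snoc.hyps(3) have "u \<notin> \<Union>(set (filter P es))" by auto
  from fresh_order.snoc[OF snoc.IH snoc.hyps(2) this snoc.hyps(4)] snoc.IH show ?case
    by (cases "P e") (simp_all only: filter_append filter.simps if_True if_False append_Nil2)
qed (simp add: fresh_order.Nil)

text \<open>Greedy colouring: the new edge meets earlier ones only at \<open>v\<close>, so only the
  colours present there are forbidden. They are fewer than \<open>D\<close>, because the degree of
  \<open>v\<close> also counts the new edge.\<close>

lemma forest_proper_colouring:
  assumes "forest_order es" "distinct es" "{} \<notin> set es"
    and "\<And>v. v \<in> \<Union>(set es) \<Longrightarrow> vertex_degree (set es) v \<le> D"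
  shows "\<exists>col. proper_colouring D col (set es)"
  using assms
proof (induction rule: forest_order.induct)
  case Nil
  then show ?case by (simp add: proper_colouring_def)
next
  case (snoc es e)
  have mono: "vertex_degree (set es) v \<le> vertex_degree (set (es @ [e])) v" for v
    unfolding vertex_degree_def by (intro card_mono) auto
  have "vertex_degree (set es) v \<le> D" if "v \<in> \<Union>(set es)" for v
    using order_trans[OF mono snoc.prems(3)[of v]] that by simp
  then obtain col where col: "proper_colouring D col (set es)"
    using snoc.IH snoc.prems(1,2) by auto
  \<comment> \<open>If \<open>e\<close> is disjoint from all earlier edges, any of its vertices will
    do.\<close>
  obtain v where v: "v \<in> e" "\<Union>(set es) \<inter> e \<subseteq> {v}"
  proof (cases "\<Union>(set es) \<inter> e = {}")
    case True
    with snoc.prems(2) that show thesis by auto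
  next
    case False
    then have "card (\<Union>(set es) \<inter> e) = 1"
      using snoc.hyps(2,3) by (simp add: card_gt_0_iff le_Suc_eq)
    then obtain v where "\<Union>(set es) \<inter> e = {v}" by (rule card_1_singletonE)
    with that[of v] show thesis by blast
  qed
  let ?S = "{e' \<in> set es. v \<in> e'}"
  have "e \<notin> set es" using snoc.prems(1) by simp
  have "{e' \<in> set (es @ [e]). v \<in> e'} = insert e ?S" using v by auto
  then have "Suc (card ?S) \<le> D"
    using snoc.prems(3)[of v] v(1) \<open>e \<notin> set es\<close> by (simp add: vertex_degree_def)
  moreover have "card (col ` ?S) \<le> card ?S" by (rule card_image_le) simp
  ultimately have "card (col ` ?S) < card {1..D}" by simp
  then have "\<not> {1..D} \<subseteq> col ` ?S" using card_mono[of "col ` ?S" "{1..D}"] by auto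
  then obtain c where c: "c \<in> {1..D}" "c \<notin> col ` ?S" by blast
  have new: "c \<noteq> col e'" if e': "e' \<in> set es" "e \<inter> e' \<noteq> {}" for e'
  proof -
    have "v \<in> e'" using e' v(2) by blast
    with c(2) e'(1) show ?thesis by blast
  qed
  have "proper_colouring D (col(e := c)) (set (es @ [e]))"
    unfolding proper_colouring_def
  proof (intro conjI ballI impI)
    show "(col(e := c)) e' \<in> {1..D}" if "e' \<in> set (es @ [e])" for e'
      using that col c(1) \<open>e \<notin> set es\<close> by (auto simp: proper_colouring_def)
    show "(col(e := c)) e1 \<noteq> (col(e := c)) e2"
      if "e1 \<in> set (es @ [e])" "e2 \<in> set (es @ [e])" "e1 \<noteq> e2" "e1 \<inter> e2 \<noteq> {}" for e1 e2
    proof (cases "e1 = e \<or> e2 = e")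
      case True
      then show ?thesis using new[of e1] new[of e2] that by (auto simp: Int_commute)
    next
      case False
      then show ?thesis using that col unfolding proper_colouring_def by auto
    qed
  qed
  then show ?case by blast
qed

text \<open>Deleting a vertex of degree \<open>> d\<close> costs \<open>d\<close> variables and saves at least \<open>d + 1\<close> edges.\<close>

lemma delete_high_degree_vertices:
  fixes E :: "'v set set"
  assumes "finite E" "finite V"
  shows "\<exists>W\<subseteq>V. (\<forall>v\<in>V. vertex_degree {e \<in> E. e \<inter> W = {}} v \<le> d) \<and>
    card {e \<in> E. e \<inter> W = {}} + (d + 1) * card W \<le> card E"
  using assms(1)
proof (induction "card E" arbitrary: E rule: less_induct)
  case less
  show ?case
  proof (cases "\<forall>v\<in>V. vertex_degree E v \<le> d")
    case True
    then show ?thesis by (intro exI[of _ "{}"]) simp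
  next
    case False
    then obtain v where v: "v \<in> V" "d + 1 \<le> card {e \<in> E. v \<in> e}"
      by (auto simp: vertex_degree_def not_le Suc_le_eq)
    let ?E = "{e \<in> E. v \<notin> e}"
    have "E = ?E \<union> {e \<in> E. v \<in> e}" by blast
    then have cE: "card E = card ?E + card {e \<in> E. v \<in> e}"
      using card_Un_disjoint[of ?E "{e \<in> E. v \<in> e}"] less.prems by force
    obtain W where W: "W \<subseteq> V" "\<forall>u\<in>V. vertex_degree {e \<in> ?E. e \<inter> W = {}} u \<le> d"
      "card {e \<in> ?E. e \<inter> W = {}} + (d + 1) * card W \<le> card ?E"
      using less.hyps[of ?E] cE v(2) less.prems by auto
    have eq: "{e \<in> E. e \<inter> insert v W = {}} = {e \<in> ?E. e \<inter> W = {}}" by auto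
    have "card (insert v W) \<le> Suc (card W)" by (rule card_insert_le_m1) auto
    then have "(d + 1) * card (insert v W) \<le> (d + 1) * card W + (d + 1)"
      using mult_le_mono2[of "card (insert v W)" "Suc (card W)" "d + 1"] by simp
    with W v(1) cE v(2) show ?thesis unfolding eq[symmetric]
      by (intro exI[of _ "insert v W"]) auto
  qed
qed

lemma max_degree_le_iff:
  assumes "finite V"
  shows "max_degree V E \<le> d \<longleftrightarrow> (\<forall>v\<in>V. vertex_degree E v \<le> d)"
proof (cases "V = {}")
  case False
  with assms show ?thesis by (simp add: max_degree_def cSup_eq_Max)
qed (simp add: max_degree_def)

section \<open>Radicality over arbitrary fields\<close>

lemma multilin_edge_poly:
  assumes e: "finite e"
  shows "multilin (e \<times> {1..d}) e (edge_poly d {} e :: 'k::field xpoly)"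
proof -
  have "multilin (e \<times> {1..d}) a (\<Prod>i\<in>a. var (i, j) :: 'k xpoly)" if "finite a" "a \<subseteq> e" "j \<in> {1..d}" for a j
    using that
  proof (induction a rule: finite_induct)
    case empty
    show ?case using multilin.con[of _ 1] by simp
  qed (auto intro: multilin.var)
  then have "multilin (e \<times> {1..d}) e (\<Sum>j\<in>{1..d}. \<Prod>i\<in>e. var (i, j) :: 'k xpoly)"
    by (rule multilin_sum[OF _]) (use e in auto)
  then show ?thesis by (simp add: edge_poly_def)
qed

lemma homog_edge_poly: "finite e \<Longrightarrow> homog (card e) (edge_poly d {} e)"
  by (rule homog_multilin[OF multilin_edge_poly])

lemma radical_edge_polys_infinite:
  assumes "infinite (UNIV :: 'k::field set)" "forest_order es"
  shows "radical_set (ideal_of (edge_poly d {} ` set es) :: 'k xpoly set)"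
proof -
  have fin: "finite e" if "e \<in> set es" for e
    using assms(2) that by (induction rule: forest_order.induct) auto
  let ?X = "\<Union>(set es) \<times> {1..d}"
  have "list_all2 (multilin ?X) es (map (edge_poly d {}) es)"
    unfolding list_all2_map2 list_all2_same
    by (intro ballI multilin_mono[OF multilin_edge_poly[OF fin]]) auto
  from radical_multilin_forest[OF assms _ this] fin show ?thesis by (simp del: UN_simps)
qed

text \<open>An embedding of fields is injective and linear over the smaller field, so it has a
  linear left inverse.\<close>

lemma linear_retraction:
  fixes \<iota> :: "'k::field \<Rightarrow> 'l::field"
  assumes "ring_morph \<iota>"
  shows "\<exists>\<rho>. \<rho> 0 = 0 \<and> (\<forall>x y. \<rho> (x + y) = \<rho> x + \<rho> y) \<and> (\<forall>c x. \<rho> (\<iota> c * x) = c * \<rho> x) \<and> (\<forall>c. \<rho> (\<iota> c) = c)"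
proof -
  interpret vector_space_pair "(*) :: 'k \<Rightarrow> 'k \<Rightarrow> 'k" "\<lambda>c x. \<iota> c * x"
    by unfold_locales (simp_all add: algebra_simps ring_morph_simps[OF assms])
  have "Vector_Spaces.linear (*) (\<lambda>c x. \<iota> c * x) \<iota>"
    by unfold_locales (simp_all add: ring_morph_simps[OF assms])
  moreover have "inj \<iota>"
  proof (rule injI)
    fix a b assume "\<iota> a = \<iota> b"
    then have "\<iota> (a - b) = 0" by (simp add: ring_morph_simps[OF assms])
    moreover have "\<iota> (a - b) * \<iota> (inverse (a - b)) = 1" if "a \<noteq> b"
      using that by (simp add: ring_morph_one[OF assms] flip: ring_morph_mult[OF assms])
    ultimately show "a = b" by auto
  qed
  ultimately obtain \<rho> where \<rho>: "Vector_Spaces.linear (\<lambda>c x. \<iota> c * x) (*) \<rho>" "\<rho> \<circ> \<iota> = id"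
    using linear_injective_left_inverse by blast
  interpret \<rho>: Vector_Spaces.linear "\<lambda>c x. \<iota> c * x" "(*)" \<rho> by (rule \<rho>(1))
  show ?thesis
    using \<rho>.add \<rho>.scale \<rho>.zero \<rho>(2) by (intro exI[of _ \<rho>]) (auto simp: fun_eq_iff)
qed

text \<open>Applied to coefficients, \<open>\<rho>\<close> becomes a retraction \<open>P\<close>
  that is linear over the small polynomial ring. It carries the extended ideal back into
  \<open>ideal_of G\<close>, so membership can be tested over the larger field.\<close>

lemma radical_descent:
  fixes \<iota> :: "'k::field \<Rightarrow> 'l::field" and G :: "'k xpoly set"
  assumes \<iota>: "ring_morph \<iota>"
  defines "\<epsilon> \<equiv> ev (\<lambda>c. con (\<iota> c)) var"
  assumes rad: "radical_set (ideal_of (\<epsilon> ` G))"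
  shows "radical_set (ideal_of G)"
  unfolding radical_set_def
proof (intro allI impI)
  fix p N assume N: "p ^ N \<in> ideal_of G"
  have \<phi>: "ring_morph (\<lambda>c. con (\<iota> c))" by (rule ring_morph_comp[OF ring_morph_con \<iota>])
  have morph: "ring_morph \<epsilon>" unfolding \<epsilon>_def by (rule ring_morph_ev[OF \<phi>])
  have \<epsilon>_single: "\<epsilon> (Poly_Mapping.single m c) = Poly_Mapping.single m (\<iota> c)" for m c
    unfolding \<epsilon>_def ev_single[OF \<phi>] single_eq_monomial[of m "\<iota> c"] by simp
  obtain \<rho> where \<rho>: "\<rho> 0 = 0" "\<And>x y. \<rho> (x + y) = \<rho> x + \<rho> y" "\<And>c x. \<rho> (\<iota> c * x) = c * \<rho> x"
    "\<And>c. \<rho> (\<iota> c) = c" using linear_retraction[OF \<iota>] by blast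
  define P where "P q = Poly_Mapping.map \<rho> q" for q :: "'l xpoly"
  have lookup_P: "Poly_Mapping.lookup (P q) m = \<rho> (Poly_Mapping.lookup q m)" for q m
    by (simp add: P_def Poly_Mapping.map.rep_eq when_def \<rho>(1))
  have P_add: "P (q + q') = P q + P q'" for q q'
    by (rule poly_mapping_eqI) (simp add: lookup_P lookup_add \<rho>(2))
  have P_single: "P (Poly_Mapping.single m x) = Poly_Mapping.single m (\<rho> x)" for m x
    by (rule poly_mapping_eqI) (simp add: lookup_P lookup_single when_def \<rho>(1))
  have P_0: "P 0 = 0" by (rule poly_mapping_eqI) (simp add: lookup_P \<rho>(1))
  have P_mult: "P (q * \<epsilon> g) = P q * g" for q g
  proof (induction g rule: poly_mapping_additive_induct)
    case zero
    then show ?case by (simp add: ring_morph_zero[OF morph] P_0)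
  next
    case (single m c)
    show ?case
    proof (induction q rule: poly_mapping_additive_induct)
      case (single m' x)
      then show ?case using \<rho>(3)[of c x] by (simp add: \<epsilon>_single P_single mult_single mult.commute add.commute)
    qed (simp_all add: P_0 P_add distrib_right)
  next
    case (add g g')
    then show ?case by (simp add: ring_morph_add[OF morph] distrib_left P_add)
  qed
  have "\<epsilon> (p ^ N) \<in> ideal_of (\<epsilon> ` G)"
    by (rule ring_morph_ideal_of[OF morph N]) (auto intro: ideal_gen.span_base)
  then have "\<epsilon> p \<in> ideal_of (\<epsilon> ` G)" using radD[OF rad] by (simp add: ring_morph_power[OF morph])
  then have "P (\<epsilon> p) \<in> ideal_of G"
  proof (induction rule: ideal_gen.span_induct_alt)
    case base
    then show ?case by (simp add: P_0 ideal_gen.span_zero)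
  next
    case (step c x y)
    then show ?case by (auto simp: P_add P_mult intro!: ideal_gen.span_add ideal_gen.span_scale
          intro: ideal_gen.span_base)
  qed
  moreover have "P (\<epsilon> p) = p"
    using P_mult[of 1 p] P_single[of 0 1] \<rho>(4)[of 1] by (simp add: ring_morph_one[OF \<iota>])
  ultimately show "p \<in> ideal_of G" by simp
qed

text \<open>The fraction field of \<open>'k poly\<close> contains infinitely many powers of its
  variable, whatever \<open>'k\<close> is, and the extension does not change the edge
  polynomials.\<close>

lemma radical_edge_polys:
  assumes "forest_order es"
  shows "radical_set (ideal_of (edge_poly d {} ` set es) :: 'k::field xpoly set)"
proof -
  define \<iota> :: "'k \<Rightarrow> 'k poly fract" where "\<iota> c = to_fract [:c:]" for c
  have \<iota>: "ring_morph \<iota>" by (simp add: ring_morph_def \<iota>_def one_pCons[symmetric] flip: to_fract_add to_fract_mult)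
  have "inj (\<lambda>n. to_fract (monom 1 n) :: 'k poly fract)"
    by (rule injI) (simp add: monom_eq_iff')
  then have "infinite (UNIV :: 'k poly fract set)"
    using finite_subset[OF subset_UNIV] range_inj_infinite by blast
  note rad = radical_edge_polys_infinite[OF this assms, of d]
  have \<phi>: "ring_morph (\<lambda>c. con (\<iota> c))" by (rule ring_morph_comp[OF ring_morph_con \<iota>])
  have "ev (\<lambda>c. con (\<iota> c)) var (edge_poly d {} e) = edge_poly d {} e" for e
    unfolding edge_poly_def by (simp add: ring_morph_simps[OF ring_morph_ev[OF \<phi>]] ev_var[OF \<phi>])
  then show ?thesis using radical_descent[OF \<iota>, of "edge_poly d {} ` set es"] rad
    by (simp add: image_image)
qed

section \<open>The height of an LSS ideal\<close>

lemma prime_height_ge: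
  assumes "prime_chain (vars_in (grid n d)) C k (P :: 'k::field xpoly set)"
  shows "enat k \<le> prime_height (lss_ring n d) P"
  unfolding prime_height_def
  using assms by (intro Sup_upper) (auto simp: prime_chain_def primeideal_lss_ring_iff)

lemma prime_height_le:
  assumes "\<And>C k. prime_chain (vars_in (grid n d)) C k (P :: 'k::field xpoly set) \<Longrightarrow> k \<le> h"
  shows "prime_height (lss_ring n d) P \<le> enat h"
  unfolding prime_height_def
  using assms by (intro Sup_least) (auto simp: prime_chain_def primeideal_lss_ring_iff)

context
  fixes n d r :: nat and E :: "nat set set" and es :: "nat set list"
  assumes E: "\<And>e. e \<in> E \<Longrightarrow> e \<subseteq> {1..n} \<and> card e = r" and r: "r > 1" and d: "d \<ge> 1"
    and es: "distinct es" "set es = E" "forest_order es" "fresh_order es"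
begin

lemma finite_E: "finite E"
  using es(2) by auto

lemma edge: "e \<in> E \<Longrightarrow> finite e \<and> e \<noteq> {}"
  using E[of e] r by (auto intro: finite_subset)

lemma lss_ideal_E: "lss_ideal n E d = ideal_of (edge_poly d {} ` E) \<inter> (vars_in (grid n d) :: 'k::field xpoly set)"
  by (rule lss_ideal_eq) (use E in auto)

lemma height_ge:
  assumes "max_degree {1..n} E \<le> d"
  shows "enat (card E) \<le> ideal_height (lss_ring n d) (lss_ideal n E d :: 'k::field xpoly set)"
  unfolding ideal_height_def
proof (rule Inf_greatest, clarify)
  fix P :: "'k xpoly set"
  assume P: "primeideal P (lss_ring n d)" "lss_ideal n E d \<subseteq> P"
  have "vertex_degree (set es) v \<le> d" if "v \<in> \<Union>(set es)" for v
    using assms that E by (auto simp: max_degree_le_iff es(2))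
  moreover have "{} \<notin> set es" using edge es(2) by blast
  ultimately obtain col where col: "proper_colouring d col (set es)"
    using forest_proper_colouring[OF es(3,1)] by blast
  have "edge_poly d {} ` set es \<subseteq> lss_ideal n E d"
    unfolding lss_ideal_E es(2)
    by (intro image_subsetI IntI ideal_gen.span_base imageI edge_poly_in_grid) (use E in auto)
  with P(2) have "edge_poly d {} ` set es \<subseteq> P" by blast
  moreover have "\<Union>(set es) \<times> {1..d} \<subseteq> grid n d" using E es(2) by auto
  ultimately obtain C where "prime_chain (vars_in (grid n d)) C (length es) P"
    using prime_chain_below[OF es(4) col] P(1) unfolding primeideal_lss_ring_iff by blast
  from prime_height_ge[OF this] show "enat (card E) \<le> prime_height (lss_ring n d) P"
    using distinct_card[OF es(1)] es(2) by simp
qed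

text \<open>Kill the variables of the vertices in \<open>W\<close>. The remaining edges form a forest of degree at most
  \<open>d\<close>, and the ideal meets the polynomial ring in all but \<open>d * card W\<close> plus one variable per
  remaining edge trivially, so that it lies in a prime of small height.\<close>

lemma height_le_deleted:
  assumes W: "W \<subseteq> {1..n}" and deg: "\<And>v. v \<in> {1..n} \<Longrightarrow> vertex_degree {e \<in> E. e \<inter> W = {}} v \<le> d"
  shows "ideal_height (lss_ring n d) (lss_ideal n E d :: 'k::field xpoly set)
    \<le> enat (card {e \<in> E. e \<inter> W = {}} + d * card W)"
proof -
  define es' where "es' = filter (\<lambda>e. e \<inter> W = {}) es"
  define E' where "E' = {e \<in> E. e \<inter> W = {}}"
  have es': "distinct es'" "set es' = E'" "forest_order es'" "fresh_order es'"
    using es by (auto simp: es'_def E'_def forest_order_filter fresh_order_filter)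
  have "vertex_degree (set es') v \<le> d" if "v \<in> \<Union>(set es')" for v
  proof -
    have "v \<in> {1..n}" using that E es'(2) unfolding E'_def by blast
    from deg[OF this] show ?thesis by (simp add: es'(2) E'_def)
  qed
  moreover have "{} \<notin> set es'" using edge es'(2) by (auto simp: E'_def)
  ultimately obtain col where col: "proper_colouring d col (set es')"
    using forest_proper_colouring[OF es'(3,1)] by blast
  obtain Y where Y: "finite Y" "card Y \<le> length es'" "Y \<subseteq> \<Union>(set es') \<times> {1..d}"
    "\<forall>p\<in>vars_in (- Y). p \<in> ideal_of (edge_poly d {} ` set es') \<longrightarrow> p = (0 :: 'k xpoly)"
    using edge_polys_independent_of_vars[OF es'(4) col] by blast
  let ?X = "grid n d"
  define Z where "Z = W \<times> {1..d}"
  define X' where "X' = ?X - Y - Z"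
  have finW: "finite W" using W by (rule finite_subset) simp
  have Z: "Z \<subseteq> ?X" "finite Z" "card Z = card W * d"
    using W finW by (auto simp: Z_def card_cartesian_product)
  define G :: "'k xpoly set" where "G = edge_poly d {} ` E' \<union> var ` Z"
  define I where "I = ideal_of G \<inter> vars_in ?X"
  \<comment> \<open>Disjointness from \<open>T\<close> is the hypothesis on the prime in
    \<open>prime_chain_length\<close>.\<close>
  define T :: "'k xpoly set" where "T = vars_in X' - {0}"
  have "\<exists>P. prime_in (vars_in ?X) P \<and> I \<subseteq> P \<and> P \<inter> T = {}"
  proof (rule prime_avoiding_multiplicative_set[OF subring_set_vars_in])
    show "ideal_in (vars_in ?X) I" unfolding I_def by (rule ideal_in_ideal_of)
    show "1 \<in> T" by (simp add: T_def)
    show "T \<subseteq> vars_in ?X" using vars_in_mono[of _ X' ?X] by (auto simp: T_def X'_def)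
    show "x * y \<in> T" if "x \<in> T" "y \<in> T" for x y using that by (auto simp: T_def vars_in_mult)
    show "I \<inter> T = {}"
    proof (rule ccontr)
      assume "I \<inter> T \<noteq> {}"
      then obtain p where p: "p \<in> ideal_of G" "p \<in> vars_in X'" "p \<noteq> 0" by (auto simp: I_def T_def)
      \<comment> \<open>\<open>\<kappa>\<close> fixes \<open>p\<close> and the polynomials of the
        remaining edges and kills the other generators, so \<open>p\<close> lies in the ideal of the
        remaining edges alone.\<close>
      define \<kappa> :: "'k xpoly \<Rightarrow> 'k xpoly" where "\<kappa> = subst_vars (\<lambda>x. if x \<in> Z then 0 else var x)"
      have \<kappa>_id: "\<kappa> q = q" if "q \<in> vars_in (- Z)" for q
        unfolding \<kappa>_def by (rule subst_vars_id[OF that]) auto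
      have "\<kappa> p \<in> ideal_of (edge_poly d {} ` E')"
      proof (rule ring_morph_ideal_of[OF _ p(1)])
        show "ring_morph \<kappa>" unfolding \<kappa>_def by (rule ring_morph_subst)
        show "\<kappa> g \<in> ideal_of (edge_poly d {} ` E')" if g: "g \<in> G" for g
        proof (cases "g \<in> var ` Z")
          case True
          then have "\<kappa> g = 0" by (auto simp: \<kappa>_def subst_simps)
          then show ?thesis by (simp add: ideal_gen.span_zero)
        next
          case False
          with g obtain e where e: "g = edge_poly d {} e" "e \<in> E'" by (auto simp: G_def)
          have "g \<in> vars_in (- Z)"
            unfolding e(1) by (rule vars_in_mono[OF edge_poly_vars_in]) (use e(2) in \<open>auto simp: E'_def Z_def\<close>)
          with \<kappa>_id e show ?thesis by (auto intro: ideal_gen.span_base)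
        qed
      qed
      moreover have "\<kappa> p = p" by (rule \<kappa>_id, rule vars_in_mono[OF p(2)]) (auto simp: X'_def)
      moreover have "p \<in> vars_in (- Y)" by (rule vars_in_mono[OF p(2)]) (auto simp: X'_def)
      ultimately show False using Y(4) p(3) es'(2) by simp
    qed
  qed
  then obtain P where P: "prime_in (vars_in ?X) P" "I \<subseteq> P" "P \<inter> T = {}" by blast
  have "edge_poly d {} e \<in> ideal_of G" if e: "e \<in> E" for e
  proof (cases "e \<inter> W = {}")
    case True
    with e show ?thesis by (intro ideal_gen.span_base) (auto simp: G_def E'_def)
  next
    case False
    then obtain i where i: "i \<in> e" "i \<in> W" by blast
    \<comment> \<open>An edge that meets \<open>W\<close> has a killed variable in each of its
      products.\<close>
    have "(\<Prod>i\<in>e. var (i, j)) \<in> ideal_of G" if "j \<in> {1..d}" for j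
    proof -
      have "(\<Prod>i\<in>e. var (i, j)) = var (i, j) * (\<Prod>i\<in>e - {i}. var (i, j) :: 'k xpoly)"
        using i(1) edge[OF e] by (simp add: prod.remove)
      moreover have "var (i, j) \<in> ideal_of G"
        by (rule ideal_gen.span_base) (use i that in \<open>auto simp: G_def Z_def\<close>)
      ultimately show ?thesis by (simp add: ideal_of_mult_right)
    qed
    then show ?thesis by (auto simp: edge_poly_def intro!: ideal_gen.span_sum)
  qed
  then have "lss_ideal n E d \<subseteq> I"
    unfolding lss_ideal_E I_def using ideal_of_subset[of "edge_poly d {} ` E" G] by blast
  with P(2) have LP: "lss_ideal n E d \<subseteq> P" by blast
  have "card ?X \<le> card X' + (card Y + card Z)"
  proof -
    have "card ?X \<le> card (X' \<union> (Y \<union> Z))"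
      by (rule card_mono) (use Y(1) Z(2) in \<open>auto simp: X'_def\<close>)
    also have "\<dots> \<le> card X' + card (Y \<union> Z)" by (rule card_Un_le)
    also have "\<dots> \<le> card X' + (card Y + card Z)" using card_Un_le[of Y Z] by simp
    finally show ?thesis .
  qed
  then have X': "card ?X \<le> card X' + (card E' + d * card W)"
    using Y(2) Z(3) distinct_card[OF es'(1)] es'(2) by (simp add: mult.commute)
  have "prime_height (lss_ring n d) P \<le> enat (card E' + d * card W)"
  proof (rule prime_height_le)
    fix C k assume C: "prime_chain (vars_in ?X) C k P"
    have "k + card X' \<le> card ?X"
      by (rule prime_chain_length[OF _ _ _ C]) (use P(3) in \<open>auto simp: X'_def T_def\<close>)
    with X' show "k \<le> card E' + d * card W" by simp
  qed
  moreover have "ideal_height (lss_ring n d) (lss_ideal n E d :: 'k xpoly set) \<le> prime_height (lss_ring n d) P"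
    unfolding ideal_height_def using P(1) LP by (intro Inf_lower) (auto simp: primeideal_lss_ring_iff)
  ultimately show ?thesis unfolding E'_def by (rule order_trans[rotated])
qed

text \<open>By the choice of \<open>W\<close> the height is at most \<open>card E - card W\<close>.
  So the value \<open>card E\<close> forces \<open>W\<close> to be empty, and then all degrees are
  at most \<open>d\<close>; the same bound is the upper half of the converse.\<close>

lemma height_eq_iff:
  "ideal_height (lss_ring n d) (lss_ideal n E d :: 'k::field xpoly set) = enat (card E)
    \<longleftrightarrow> max_degree {1..n} E \<le> d"
proof -
  let ?h = "ideal_height (lss_ring n d) (lss_ideal n E d :: 'k xpoly set)"
  obtain W where W: "W \<subseteq> {1..n}" "\<forall>v\<in>{1..n}. vertex_degree {e \<in> E. e \<inter> W = {}} v \<le> d"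
    "card {e \<in> E. e \<inter> W = {}} + (d + 1) * card W \<le> card E"
    using delete_high_degree_vertices[OF finite_E finite_atLeastAtMost[of 1 n]] by blast
  have le: "?h \<le> enat (card {e \<in> E. e \<inter> W = {}} + d * card W)"
    by (rule height_le_deleted[OF W(1)]) (use W(2) in blast)
  show ?thesis
  proof
    assume h: "?h = enat (card E)"
    have "card W = 0" using le W(3) unfolding h by simp
    moreover have "finite W" using W(1) by (rule finite_subset) simp
    ultimately have "W = {}" by simp
    with W(2) show "max_degree {1..n} E \<le> d" by (simp add: max_degree_le_iff)
  next
    assume "max_degree {1..n} E \<le> d"
    note ge = height_ge[OF this, where 'k = 'k]
    have "enat (card {e \<in> E. e \<inter> W = {}} + d * card W) \<le> enat (card E)" using W(3) by simp
    with le have "?h \<le> enat (card E)" by (rule order_trans)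
    with ge show "?h = enat (card E)" by (rule antisym[rotated])
  qed
qed

section \<open>The number of generators\<close>

text \<open>A multiple of a generator reaches the lowest degree \<open>s\<close> only if the
  generator has that degree, and then only through the constant term of its coefficient.\<close>

lemma component_ideal_of_kspan:
  fixes p :: "'k::field xpoly"
  assumes "p \<in> ideal_of G" "\<And>g. g \<in> G \<Longrightarrow> \<exists>t\<ge>s. homog t g"
  shows "component s p \<in> kspan {g \<in> G. homog s g}"
  using assms(1)
proof (induction rule: ideal_gen.span_induct_alt)
  case base
  then show ?case by (simp add: kvs.span_zero)
next
  case (step c x y)
  obtain t where t: "t \<ge> s" "homog t x" using assms(2)[OF step(1)] by blast
  have "component s (c * x) \<in> kspan {g \<in> G. homog s g}"
  proof (cases "t = s")
    case True
    have "component 0 c = con (Poly_Mapping.lookup c 0)"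
    proof (rule poly_mapping_eqI)
      fix m
      have "monomial_degree m = 0 \<longleftrightarrow> m = 0"
        by (auto simp: monomial_degree_def in_keys_iff intro!: poly_mapping_eqI)
      then show "Poly_Mapping.lookup (component 0 c) m = Poly_Mapping.lookup (con (Poly_Mapping.lookup c 0)) m"
        by (auto simp: lookup_component con_def lookup_single when_def)
    qed
    with component_homog_mult[OF t(2), of s c] True
    have "component s (c * x) = con (Poly_Mapping.lookup c 0) * x" by (simp add: mult.commute)
    moreover have "x \<in> kspan {g \<in> G. homog s g}"
      by (rule kvs.span_base) (use step(1) t True in auto)
    ultimately show ?thesis by (simp add: kvs.span_scale)
  next
    case False
    with component_homog_mult[OF t(2), of s c] t(1) have "component s (c * x) = 0"
      by (simp add: mult.commute)
    then show ?thesis by (simp add: kvs.span_zero)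
  qed
  with step show ?case by (simp add: component_add kvs.span_add)
qed

lemma kspan_subset_ideal_of: "kspan G \<subseteq> ideal_of G"
proof
  fix p assume "p \<in> kspan G"
  then show "p \<in> ideal_of G"
    by (induction rule: kvs.span_induct_alt)
      (auto intro: ideal_gen.span_zero ideal_gen.span_add ideal_gen.span_scale ideal_gen.span_base)
qed

text \<open>The product of the variables \<open>(i, 1)\<close> over one edge occurs in the
  polynomial of that edge only, and it does occur as \<open>d \<ge> 1\<close>. These coefficients
  separate the generators.\<close>

lemma lookup_lss_poly:
  assumes "e \<in> E" "e' \<in> E"
  shows "Poly_Mapping.lookup (lss_poly d e :: 'k::field xpoly) (\<Sum>i\<in>e'. Poly_Mapping.single (i, 1) 1)
    = (if e = e' then 1 else 0)"
proof -
  let ?m = "\<lambda>e j. \<Sum>i\<in>e. Poly_Mapping.single (i, j) 1 :: monomial"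
  have prod: "(\<Prod>i\<in>e. xvar i j) = (Poly_Mapping.single (?m e j) 1 :: 'k xpoly)" if "finite e" for e j
    using that by (induction e rule: finite_induct) (simp_all add: xvar_def mult_single)
  have lookup: "Poly_Mapping.lookup (?m e j) (i, k) = (if i \<in> e \<and> j = k then 1 else 0)" if "finite e" for e i j k
    using that by (induction e rule: finite_induct) (auto simp: lookup_add lookup_single when_def)
  have eq_iff: "?m e j = ?m e' 1 \<longleftrightarrow> e = e' \<and> j = 1" for j
  proof
    assume eq: "?m e j = ?m e' 1"
    have fin: "finite e" "finite e'" using edge assms by blast+
    have *: "(i \<in> e \<and> j = k) = (i \<in> e' \<and> 1 = k)" for i k
      using arg_cong[OF eq, of "\<lambda>m. Poly_Mapping.lookup m (i, k)"]
      unfolding lookup[OF fin(1)] lookup[OF fin(2)] by (auto split: if_splits)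
    obtain i where i: "i \<in> e'" using edge[OF assms(2)] by blast
    with *[of i 1] have "j = 1" by auto
    with *[of _ 1] show "e = e' \<and> j = 1" by auto
  qed simp
  have "Poly_Mapping.lookup (lss_poly d e :: 'k xpoly) (?m e' 1) =
      (\<Sum>j\<in>{1..d}. if e = e' \<and> j = 1 then 1 else 0)"
    unfolding lss_poly_def lookup_sum
    using edge[OF assms(1)] by (intro sum.cong refl) (simp add: prod lookup_single when_def eq_iff del: One_nat_def)
  also have "\<dots> = (if e = e' then 1 else 0)" using d by (cases "e = e'") simp_all
  finally show ?thesis .
qed

lemma inj_on_lss_poly: "inj_on (lss_poly d :: nat set \<Rightarrow> 'k::field xpoly) E"
proof (rule inj_onI)
  fix e e' assume *: "e \<in> E" "e' \<in> E" "lss_poly d e = (lss_poly d e' :: 'k xpoly)"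
  with lookup_lss_poly[OF *(1,2), where 'k = 'k] lookup_lss_poly[OF *(2,2), where 'k = 'k]
  show "e = e'" by (auto split: if_splits)
qed

lemma lss_polys_independent: "\<not> kdependent (lss_poly d ` E :: 'k::field xpoly set)"
proof
  assume "kdependent (lss_poly d ` E :: 'k xpoly set)"
  then obtain u e0 where u: "(\<Sum>p\<in>lss_poly d ` E. con (u p) * p) = 0" and e0: "e0 \<in> E"
    "u (lss_poly d e0 :: 'k xpoly) \<noteq> 0"
    using finite_E by (auto simp: kvs.dependent_finite)
  have lookup_con: "Poly_Mapping.lookup (con c * p) m = c * Poly_Mapping.lookup p m" for c and p :: "'k xpoly" and m
    by (induction p rule: poly_mapping_additive_induct)
      (simp_all add: con_def mult_single lookup_single when_def distrib_left lookup_add)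
  let ?m = "\<Sum>i\<in>e0. Poly_Mapping.single (i, 1) 1 :: monomial"
  have "0 = Poly_Mapping.lookup (\<Sum>e\<in>E. con (u (lss_poly d e)) * (lss_poly d e :: 'k xpoly)) ?m"
    using u by (simp add: sum.reindex[OF inj_on_lss_poly])
  also have "\<dots> = (\<Sum>e\<in>E. if e = e0 then u (lss_poly d e0) else 0)"
    unfolding lookup_sum lookup_con
    by (intro sum.cong refl) (simp add: lookup_lss_poly e0(1) del: One_nat_def)
  also have "\<dots> = u (lss_poly d e0)" using finite_E e0(1) by simp
  finally show False using e0(2) by simp
qed

lemma homog_lss_poly: "e \<in> E \<Longrightarrow> homog r (lss_poly d e :: 'k::field xpoly)"
  using homog_edge_poly[of e d, where 'a = 'k] edge[of e] E[of e] by (simp add: lss_poly_eq_edge_poly)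

lemma lss_polys_in_grid: "lss_poly d ` E \<subseteq> (vars_in (grid n d) :: 'k::field xpoly set)"
  unfolding lss_poly_eq_edge_poly by (intro image_subsetI edge_poly_in_grid) (use E in blast)

lemma lss_ideal_lss_poly:
  "lss_ideal n E d = ideal_of (lss_poly d ` E) \<inter> (vars_in (grid n d) :: 'k::field xpoly set)"
  unfolding lss_ideal_def by (rule Idl_lss_ring[OF lss_polys_in_grid])

lemma lss_ideal_subset_kspan:
  assumes "p \<in> lss_ideal n E d" "homog r p"
  shows "p \<in> kspan (lss_poly d ` E :: 'k::field xpoly set)"
proof -
  have "component r p \<in> kspan {g \<in> lss_poly d ` E. homog r g}"
    by (rule component_ideal_of_kspan) (use assms lss_ideal_lss_poly homog_lss_poly in auto)
  moreover have "{g \<in> lss_poly d ` E. homog r g} \<subseteq> (lss_poly d ` E :: 'k xpoly set)" by blast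
  from kvs.span_mono[OF this] have "kspan {g \<in> lss_poly d ` E. homog r g} \<subseteq> kspan (lss_poly d ` E :: 'k xpoly set)" .
  ultimately show ?thesis using component_of_homog[OF assms(2), of r] by auto
qed

text \<open>If the others generated one of these polynomials, comparing degree \<open>r\<close>
  would make it a linear combination of them over the field.\<close>

lemma minimal_homogeneous_generators_lss_polys:
  "minimal_homogeneous_generators (lss_ring n d) (lss_ideal n E d) (lss_poly d ` E :: 'k::field xpoly set)"
  unfolding minimal_homogeneous_generators_def
proof (intro conjI allI impI)
  show "lss_poly d ` E \<subseteq> carrier (lss_ring n d :: 'k xpoly ring)" using lss_polys_in_grid by simp
  show "finite (lss_poly d ` E :: 'k xpoly set)" using finite_E by simp
  show "\<forall>g\<in>lss_poly d ` E. homogeneous (g :: 'k xpoly)"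
    using homog_lss_poly by (auto simp: homogeneous_iff)
  show "lss_ideal n E d = Idl\<^bsub>lss_ring n d\<^esub> (lss_poly d ` E :: 'k xpoly set)"
    by (simp add: lss_ideal_def)
  fix G' :: "'k xpoly set" assume G': "G' \<subset> lss_poly d ` E"
  show "Idl\<^bsub>lss_ring n d\<^esub> G' \<noteq> lss_ideal n E d"
  proof
    assume eq: "Idl\<^bsub>lss_ring n d\<^esub> G' = lss_ideal n E d"
    obtain e where e: "e \<in> E" "lss_poly d e \<notin> G'" using G' by blast
    have "(lss_poly d e :: 'k xpoly) \<in> lss_ideal n E d"
      unfolding lss_ideal_lss_poly using e(1) lss_polys_in_grid by (auto intro: ideal_gen.span_base)
    then have "lss_poly d e \<in> ideal_of G'"
      using Idl_lss_ring[of G' n d] G' lss_polys_in_grid unfolding eq[symmetric] by blast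
    then have "component r (lss_poly d e) \<in> kspan {g \<in> G'. homog r g}"
      by (rule component_ideal_of_kspan) (use G' homog_lss_poly in blast)
    then have "lss_poly d e \<in> kspan {g \<in> G'. homog r g}"
      using component_of_homog[OF homog_lss_poly[OF e(1), where 'k = 'k], of r] by simp
    moreover have "{g \<in> G'. homog r g} \<subseteq> lss_poly d ` E - {lss_poly d e}" using G' e(2) by blast
    ultimately have "lss_poly d e \<in> kspan (lss_poly d ` E - {lss_poly d e :: 'k xpoly})"
      using subsetD[OF kvs.span_mono] by blast
    moreover have "(lss_poly d e :: 'k xpoly) \<in> lss_poly d ` E" using e(1) by blast
    ultimately have "kdependent (lss_poly d ` E :: 'k xpoly set)" unfolding kvs.dependent_def ..
    with lss_polys_independent show False by blast
  qed
qed

text \<open>The ideal is generated in degree \<open>r\<close>, so a minimal system lives in that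
  degree. Both \<open>G\<close> and \<open>?F\<close> are then bases of the part of degree
  \<open>r\<close>.\<close>

lemma card_minimal_homogeneous_generators:
  assumes "minimal_homogeneous_generators (lss_ring n d) (lss_ideal n E d) (G :: 'k::field xpoly set)"
  shows "card G = card E"
proof -
  let ?F = "lss_poly d ` E :: 'k xpoly set"
  have G: "G \<subseteq> vars_in (grid n d)" "finite G" "\<And>g. g \<in> G \<Longrightarrow> \<exists>t. homog t g"
    "lss_ideal n E d = Idl\<^bsub>lss_ring n d\<^esub> G"
    "\<And>G'. G' \<subset> G \<Longrightarrow> Idl\<^bsub>lss_ring n d\<^esub> G' \<noteq> lss_ideal n E d"
    using assms unfolding minimal_homogeneous_generators_def homogeneous_iff lss_ring_simps by blast+
  have L: "lss_ideal n E d = ideal_of G \<inter> vars_in (grid n d)"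
    unfolding G(4) by (rule Idl_lss_ring[OF G(1)])
  have min: "G' = G" if "G' \<subseteq> G" "G \<subseteq> ideal_of G'" for G'
  proof (rule ccontr)
    assume "G' \<noteq> G"
    with that(1) have "G' \<subset> G" by blast
    moreover have "ideal_of G' = ideal_of G"
      using ideal_of_subset[OF that(2)] ideal_gen.span_mono[OF that(1)] by blast
    then have "Idl\<^bsub>lss_ring n d\<^esub> G' = lss_ideal n E d"
      using that(1) G(1) by (subst Idl_lss_ring) (auto simp: L)
    ultimately show False using G(5) by blast
  qed
  have GL: "g \<in> lss_ideal n E d" if "g \<in> G" for g
    using that G(1) by (auto simp: L intro: ideal_gen.span_base)
  have "0 \<notin> G"
  proof
    assume "0 \<in> G"
    have "G \<subseteq> ideal_of (G - {0})"
    proof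
      fix g assume "g \<in> G"
      then show "g \<in> ideal_of (G - {0})"
        by (cases "g = 0") (auto intro: ideal_gen.span_base ideal_gen.span_zero)
    qed
    from min[OF _ this] \<open>0 \<in> G\<close> show False by blast
  qed
  have deg: "\<exists>t\<ge>r. homog t g" if g: "g \<in> G" for g
  proof -
    obtain t where t: "homog t g" using G(3)[OF g] by blast
    have "t \<ge> r"
    proof (rule ccontr)
      assume "\<not> t \<ge> r"
      have "component t g \<in> kspan {f \<in> ?F. homog t f}"
        by (rule component_ideal_of_kspan)
          (use GL[OF g] homog_lss_poly \<open>\<not> t \<ge> r\<close> lss_ideal_lss_poly in \<open>auto intro!: exI[of _ r]\<close>)
      moreover have "f = 0" if "f \<in> ?F" "homog t f" for f
      proof -
        have "homog r f" using that homog_lss_poly[where 'k = 'k] by blast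
        then show ?thesis
          using component_of_homog[of r f t] component_of_homog[of t f t] that(2) \<open>\<not> t \<ge> r\<close> by auto
      qed
      then have "{f \<in> ?F. homog t f} \<subseteq> {0}" by blast
      ultimately have "component t g \<in> kspan {0}" using kvs.span_mono by blast
      then have "g = 0" using component_of_homog[OF t, of t] by (simp add: kvs.span_insert_0)
      with g \<open>0 \<notin> G\<close> show False by blast
    qed
    with t show ?thesis by blast
  qed
  have FG: "?F \<subseteq> kspan {g \<in> G. homog r g}"
  proof
    fix f assume f: "f \<in> ?F"
    then have "f \<in> lss_ideal n E d"
      using lss_polys_in_grid lss_ideal_lss_poly by (auto intro: ideal_gen.span_base)
    then have "component r f \<in> kspan {g \<in> G. homog r g}"
      by (intro component_ideal_of_kspan deg) (auto simp: L)
    then show "f \<in> kspan {g \<in> G. homog r g}"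
      using f homog_lss_poly[where 'k = 'k] component_of_homog[of r f r] by auto
  qed
  \<comment> \<open>The elements of degree \<open>r\<close> already generate the ideal, so
    minimality excludes all others.\<close>
  have "{g \<in> G. homog r g} = G"
  proof (rule min)
    have "ideal_of ?F \<subseteq> ideal_of {g \<in> G. homog r g}"
      using FG kspan_subset_ideal_of by (intro ideal_of_subset) blast
    then show "G \<subseteq> ideal_of {g \<in> G. homog r g}" using GL lss_ideal_lss_poly by blast
  qed blast
  with FG have FG: "?F \<subseteq> kspan G" and hom: "\<And>g. g \<in> G \<Longrightarrow> homog r g" by auto
  have GF: "G \<subseteq> kspan ?F" using lss_ideal_subset_kspan GL hom by blast
  have indep: "\<not> kdependent G"
  proof
    assume "kdependent G"
    then obtain g where g: "g \<in> G" "g \<in> kspan (G - {g})" by (auto simp: kvs.dependent_def)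
    have "G \<subseteq> ideal_of (G - {g})"
    proof
      fix g' assume "g' \<in> G"
      then show "g' \<in> ideal_of (G - {g})"
        using g(2) kspan_subset_ideal_of by (cases "g' = g") (auto intro: ideal_gen.span_base)
    qed
    from min[OF _ this] g(1) show False by blast
  qed
  have "card ?F \<le> card G" "card G \<le> card ?F"
    using kvs.independent_span_bound[OF G(2) lss_polys_independent FG]
      kvs.independent_span_bound[OF _ indep GF] finite_E by auto
  then show ?thesis using card_image[OF inj_on_lss_poly[where 'k = 'k]] by simp
qed

lemma num_generators_lss_ideal:
  "num_generators (lss_ring n d) (lss_ideal n E d :: 'k::field xpoly set) = card E"
  unfolding num_generators_def
proof (rule the_equality)
  show "\<exists>G. minimal_homogeneous_generators (lss_ring n d) (lss_ideal n E d :: 'k xpoly set) G \<and> card G = card E"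
    using minimal_homogeneous_generators_lss_polys card_minimal_homogeneous_generators by blast
qed (use card_minimal_homogeneous_generators in auto)

section \<open>The three properties of LSS ideals\<close>

lemma complete_intersection_lss_ideal_iff:
  "complete_intersection (lss_ring n d) (lss_ideal n E d :: 'k::field xpoly set)
    \<longleftrightarrow> max_degree {1..n} E \<le> d"
proof -
  have "homogeneous_ideal (lss_ring n d) (lss_ideal n E d :: 'k xpoly set)"
    using minimal_homogeneous_generators_lss_polys[where 'k = 'k]
    by (auto simp: homogeneous_ideal_def minimal_homogeneous_generators_def)
  then show ?thesis
    using height_eq_iff[where 'k = 'k] by (auto simp: complete_intersection_def num_generators_lss_ideal)
qed

lemma radical_lss_ideal: "radical_ideal (lss_ring n d) (lss_ideal n E d :: 'k::field xpoly set)"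
proof -
  let ?A = "vars_in (grid n d) :: 'k xpoly set"
  have rad: "radical_set (ideal_of (edge_poly d {} ` E) :: 'k xpoly set)"
    using radical_edge_polys[OF es(3)] es(2) by simp
  have "lss_ideal n E d = {a \<in> ?A. \<exists>k::nat. a ^ k \<in> lss_ideal n E d}"
    unfolding lss_ideal_E
  proof (intro equalityI subsetI)
    fix a assume "a \<in> {a \<in> ?A. \<exists>k::nat. a ^ k \<in> ideal_of (edge_poly d {} ` E) \<inter> ?A}"
    then show "a \<in> ideal_of (edge_poly d {} ` E) \<inter> ?A" using radD[OF rad] by blast
  qed (auto intro!: exI[of _ 1])
  moreover have "ideal_in ?A (lss_ideal n E d)" unfolding lss_ideal_E by (rule ideal_in_ideal_of)
  ultimately show ?thesis by (simp add: radical_ideal_def ideal_lss_ring_iff pow_lss_ring)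
qed

text \<open>The degree bound allows a colouring with \<open>d - 1\<close> colours, which leaves
  \<open>d\<close> as the spare one.\<close>

lemma prime_lss_ideal:
  assumes "max_degree {1..n} E + 1 \<le> d"
  shows "primeideal (lss_ideal n E d :: 'k::field xpoly set) (lss_ring n d)"
proof -
  have "vertex_degree (set es) v \<le> d - 1" if "v \<in> \<Union>(set es)" for v
  proof -
    have "v \<in> {1..n}" using that E es(2) by blast
    moreover have "max_degree {1..n} E \<le> d - 1" using assms by simp
    ultimately show ?thesis using max_degree_le_iff[of "{1..n}" E] es(2) by auto
  qed
  moreover have "{} \<notin> set es" using edge es(2) by blast
  ultimately obtain col where col: "proper_colouring (d - 1) col (set es)"
    using forest_proper_colouring[OF es(3,1)] by blast
  have col': "proper_colouring d col (set es)" using col by (fastforce simp: proper_colouring_def)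
  have "col e \<noteq> d" if "e \<in> set es" for e using that col assms by (auto simp: proper_colouring_def)
  from prime_edge_polys[OF es(4) col' _ this] d
  have "prime_set (ideal_of (edge_poly d {} ` E) :: 'k xpoly set)" by (simp add: es(2))
  then have "prime_in (vars_in (grid n d)) (lss_ideal n E d :: 'k xpoly set)"
    unfolding lss_ideal_E prime_in_def prime_set_def using ideal_in_ideal_of by blast
  then show ?thesis by (simp add: primeideal_lss_ring_iff)
qed

end

theorem theorem1p4:
  fixes n r d :: nat and E :: "nat set set"
  assumes "r > 1"
    and "uniform_hypergraph r {1..n} E"
    and "good_forest E"
    and "d \<ge> 1"
  shows "radical_ideal (lss_ring n d) (lss_ideal n E d :: 'k::field xpoly set) \<and>
    (complete_intersection (lss_ring n d) (lss_ideal n E d :: 'k xpoly set)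
       \<longleftrightarrow> d \<ge> max_degree {1..n} E) \<and>
    (d \<ge> max_degree {1..n} E + 1 \<longrightarrow>
       primeideal (lss_ideal n E d :: 'k xpoly set) (lss_ring n d))"
proof -
  have E: "e \<subseteq> {1..n} \<and> card e = r" if "e \<in> E" for e
    using assms(2) that by (auto simp: uniform_hypergraph_def)
  then have "finite e \<and> card e > 1" if "e \<in> E" for e
    using that assms(1) by (auto intro: finite_subset)
  then obtain es where es: "distinct es" "set es = E" "forest_order es" "fresh_order es"
    using good_forest_order[OF assms(3)] by blast
  note facts = E assms(1,4) es
  show ?thesis
    by (intro conjI impI radical_lss_ideal[OF facts] prime_lss_ideal[OF facts]
        complete_intersection_lss_ideal_iff[OF facts])
qed

end
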